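(* If $w$ is an eigenfunction of $\mathcal{T}$ corresponding to an eigenvalue $\lambda$ with $\lambda\neq\lambda_1(\Omega)$, then $w$ changes sign (i.e. both $\{x\in\Omega: w(x)>0\}$ and $\{x\in\Omega: w(x)<0\}$ have positive Lebesgue measure).
   Context: Let $N$ be a positive integer, $0<s<1<p<N$, $\theta\in[s,1]$, and let $\Omega\subset\mathbb{R}^N$ be a bounded domain. $W_0^{1,p}(\Omega)$ is the closure of $C_c^\infty(\Omega)$ with respect to $\left(\int_\Omega|\nabla u|^p\right)^{1/p}$, and $X(\Omega)=\{u\in W^{1,p}(\mathbb{R}^N): u|_\Omega\in W_0^{1,p}(\Omega),\ u=0 \text{ a.e. in } \mathbb{R}^N\setminus\Omega\}$. Constants: $C_H=\left(\frac{N-p}{p}\right)^p$; $C_{N,p,s}=2\int_0^1 r^{ps-1}|1-r^{(N-ps)/p}|^p\Psi_{N,s,p}(r)\,dr$ with $\Psi_{N,s,p}(r)=|\mathbb{S}^{N-2}|\int_{-1}^1\frac{(1-t^2)^{(N-3)/2}}{(1-2rt+r^2)^{(N+ps)/2}}\,dt$ ($N\ge2$). Set $\mu_0(\theta)=C_{N,p,s}$ if $\theta=s$; $\mu_0(\theta)=\min\left\{\frac{C_H(1-s)}{\theta-s},\frac{C_{N,p,s}(1-s)}{1-\theta}\right\}$ if $\theta\in(s,1)$; $\mu_0(\theta)=C_H$ if $\theta=1$. Fix $\mu\in(0,\mu_0(\theta))$. Write $F(t)=|t|^{p-2}t$ ($F(0)=0$). The operator is $\mathcal{T}(u)=-\Delta_p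 u+(-\Delta_p)^su-\mu\frac{|u|^{p-2}u}{|x|^{p\theta}}$. A real $\lambda$ is an eigenvalue of $\mathcal{T}$ with eigenfunction $u$ if $u\in X(\Omega)\setminus\{0\}$ and for all $v\in X(\Omega)$ $$\int_\Omega|\nabla u|^{p-2}\nabla u\cdot\nabla v+\int_{\mathbb{R}^N}\int_{\mathbb{R}^N}\frac{F(u(x)-u(y))(v(x)-v(y))}{|x-y|^{N+ps}}\,dx\,dy-\mu\int_\Omega\frac{|u|^{p-2}uv}{|x|^{p\theta}}=\lambda\int_\Omega|u|^{p-2}uv .$$ The first eigenvalue is $\lambda_1(\Omega)=\inf\left\{\int_\Omega|\nabla u|^p+\int_{\mathbb{R}^N}\int_{\mathbb{R}^N}\frac{|u(x)-u(y)|^p}{|x-y|^{N+sp}}\,dx\,dy-\mu\int_\Omega\frac{|u|^p}{|x|^{p\theta}}: u\in X(\Omega),\ \int_\Omega|u|^p=1\right\}$. *)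

theory Defs
  imports "HOL-Analysis.Analysis"
begin

text \<open>
  \<open>\<real>\<^sup>N\<close> is an arbitrary Euclidean space \<open>'a\<close> with \<open>N = DIM('a)\<close>. Elements of Lebesgue and
  Sobolev spaces are represented by functions \<open>'a \<Rightarrow> real\<close>, so equality in such a space is
  equality almost everywhere. All integrals are Lebesgue integrals.

  Since \<open>0 powr a = 0\<close>, the expression \<open>\<bar>t\<bar> powr (p - 2) * t\<close> has value \<open>0\<close> at \<open>t = 0\<close> for every
  \<open>p > 1\<close>. Since \<open>c / 0 = 0\<close>, singular kernels are \<open>0\<close> at the singularity, which only affects
  null sets.
\<close>


section \<open>Test functions\<close>

primrec Ck :: "nat \<Rightarrow> ('a::euclidean_space \<Rightarrow> real) \<Rightarrow> bool" where
  "Ck 0 f \<longleftrightarrow> continuous_on UNIV f"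
| "Ck (Suc k) f \<longleftrightarrow>
     (\<forall>x. f differentiable (at x)) \<and> (\<forall>b\<in>Basis. Ck k (\<lambda>x. frechet_derivative f (at x) b))"

definition test_functions :: "'a::euclidean_space set \<Rightarrow> ('a \<Rightarrow> real) set" where
  "test_functions \<Omega> =
     {\<phi>. (\<forall>k. Ck k \<phi>) \<and> compact (closure {x. \<phi> x \<noteq> 0}) \<and> closure {x. \<phi> x \<noteq> 0} \<subseteq> \<Omega>}"

definition grad :: "('a::euclidean_space \<Rightarrow> real) \<Rightarrow> 'a \<Rightarrow> 'a" where
  "grad \<phi> x = (\<Sum>b\<in>Basis. frechet_derivative \<phi> (at x) b *\<^sub>R b)"


section \<open>Sobolev spaces\<close>

definition Lp :: "real \<Rightarrow> 'a::euclidean_space set \<Rightarrow> ('a \<Rightarrow> 'b::euclidean_space) set" where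
  "Lp p \<Omega> = {f. set_borel_measurable lebesgue \<Omega> f \<and>
                set_integrable lebesgue \<Omega> (\<lambda>x. norm (f x) powr p)}"

definition has_weak_gradient ::
    "'a::euclidean_space set \<Rightarrow> ('a \<Rightarrow> real) \<Rightarrow> ('a \<Rightarrow> 'a) \<Rightarrow> bool" where
  "has_weak_gradient \<Omega> u G \<longleftrightarrow>
     (\<forall>K. compact K \<and> K \<subseteq> \<Omega> \<longrightarrow> set_integrable lebesgue K u \<and> set_integrable lebesgue K G) \<and>
     (\<forall>\<phi>\<in>test_functions \<Omega>.
        (LINT x:\<Omega>|lebesgue. u x *\<^sub>R grad \<phi> x) = - (LINT x:\<Omega>|lebesgue. \<phi> x *\<^sub>R G x))"

text \<open>A weak gradient on an open set is unique up to null sets.\<close>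

definition weak_grad :: "'a::euclidean_space set \<Rightarrow> ('a \<Rightarrow> real) \<Rightarrow> 'a \<Rightarrow> 'a" where
  "weak_grad \<Omega> u = (SOME G. has_weak_gradient \<Omega> u G)"

definition W1p :: "real \<Rightarrow> 'a::euclidean_space set \<Rightarrow> ('a \<Rightarrow> real) set" where
  "W1p p \<Omega> = {u. u \<in> Lp p \<Omega> \<and> (\<exists>G. has_weak_gradient \<Omega> u G \<and> G \<in> Lp p \<Omega>)}"

text \<open>
  The closure of the test functions for the norm \<open>(\<integral>|\<nabla>u|\<^sup>p)\<^sup>1\<^sup>/\<^sup>p\<close>. This is a norm on the test
  functions, but only a seminorm on \<open>W1p p \<Omega>\<close> (it vanishes on constants), so the limit function
  has to be pinned down by \<open>L\<^sup>p\<close> convergence as well. For bounded \<open>\<Omega>\<close> Poincare's inequality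
  makes gradient-Cauchy sequences of test functions converge in \<open>L\<^sup>p\<close>, so this condition
  excludes no element of the closure.
\<close>

definition W01p :: "real \<Rightarrow> 'a::euclidean_space set \<Rightarrow> ('a \<Rightarrow> real) set" where
  "W01p p \<Omega> = {u \<in> W1p p \<Omega>. \<exists>\<phi> :: nat \<Rightarrow> 'a \<Rightarrow> real.
     (\<forall>k. \<phi> k \<in> test_functions \<Omega>) \<and>
     (\<lambda>k. LINT x:\<Omega>|lebesgue. norm (grad (\<phi> k) x - weak_grad \<Omega> u x) powr p) \<longlonglongrightarrow> 0 \<and>
     (\<lambda>k. LINT x:\<Omega>|lebesgue. \<bar>\<phi> k x - u x\<bar> powr p) \<longlonglongrightarrow> 0}"

definition X_space :: "real \<Rightarrow> 'a::euclidean_space set \<Rightarrow> ('a \<Rightarrow> real) set" where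
  "X_space p \<Omega> = {u \<in> W1p p UNIV. u \<in> W01p p \<Omega> \<and> (AE x in lebesgue. x \<notin> \<Omega> \<longrightarrow> u x = 0)}"


section \<open>Hardy constants\<close>

text \<open>
  The dimension is a natural number argument here. The sphere \<open>S\<^sup>N\<^sup>-\<^sup>2\<close> is the unit sphere of an
  \<open>(N - 1)\<close>-dimensional space, so its surface area is \<open>N - 1\<close> times the volume of the unit ball
  of that space.
\<close>

definition sphere_area :: "nat \<Rightarrow> real" where
  "sphere_area N = real (N - 1) * unit_ball_vol (real (N - 1))"

definition C_H :: "nat \<Rightarrow> real \<Rightarrow> real" where
  "C_H N p = ((real N - p) / p) powr p"

definition Psi :: "nat \<Rightarrow> real \<Rightarrow> real \<Rightarrow> real \<Rightarrow> real" where
  "Psi N s p r = sphere_area N *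
     (LINT t:{-1<..<1}|lebesgue.
        (1 - t\<^sup>2) powr ((real N - 3) / 2) / (1 - 2 * r * t + r\<^sup>2) powr ((real N + p * s) / 2))"

definition C_Nps :: "nat \<Rightarrow> real \<Rightarrow> real \<Rightarrow> real" where
  "C_Nps N p s = 2 *
     (LINT r:{0<..<1}|lebesgue.
        r powr (p * s - 1) * \<bar>1 - r powr ((real N - p * s) / p)\<bar> powr p * Psi N s p r)"

definition mu0 :: "nat \<Rightarrow> real \<Rightarrow> real \<Rightarrow> real \<Rightarrow> real" where
  "mu0 N p s \<theta> =
     (if \<theta> = s then C_Nps N p s
      else if \<theta> = 1 then C_H N p
      else min (C_H N p * (1 - s) / (\<theta> - s)) (C_Nps N p s * (1 - s) / (1 - \<theta>)))"


section \<open>Eigenfunctions and the first eigenvalue\<close>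

definition F :: "real \<Rightarrow> real \<Rightarrow> real" where
  "F p t = \<bar>t\<bar> powr (p - 2) * t"

text \<open>The weak form of the operator \<open>-\<Delta>\<^sub>p u + (-\<Delta>\<^sub>p)\<^sup>s u - \<mu> |u|\<^sup>p\<^sup>-\<^sup>2 u / |x|\<^sup>p\<^sup>\<theta>\<close> tested against \<open>v\<close>.\<close>

definition T_form ::
    "real \<Rightarrow> real \<Rightarrow> real \<Rightarrow> real \<Rightarrow> 'a::euclidean_space set \<Rightarrow> ('a \<Rightarrow> real) \<Rightarrow> ('a \<Rightarrow> real) \<Rightarrow> real"
  where
  "T_form p s \<theta> \<mu> \<Omega> u v =
     (LINT x:\<Omega>|lebesgue.
        norm (weak_grad \<Omega> u x) powr (p - 2) * (weak_grad \<Omega> u x \<bullet> weak_grad \<Omega> v x))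
     + (LINT y|lebesgue. LINT x|lebesgue.
          F p (u x - u y) * (v x - v y) / norm (x - y) powr (real DIM('a) + p * s))
     - \<mu> * (LINT x:\<Omega>|lebesgue. F p (u x) * v x / norm x powr (p * \<theta>))"

definition is_eigenfunction ::
    "real \<Rightarrow> real \<Rightarrow> real \<Rightarrow> real \<Rightarrow> 'a::euclidean_space set \<Rightarrow> real \<Rightarrow> ('a \<Rightarrow> real) \<Rightarrow> bool" where
  "is_eigenfunction p s \<theta> \<mu> \<Omega> lam u \<longleftrightarrow>
     u \<in> X_space p \<Omega> \<and> \<not> (AE x in lebesgue. u x = 0) \<and>
     (\<forall>v\<in>X_space p \<Omega>. T_form p s \<theta> \<mu> \<Omega> u v = lam * (LINT x:\<Omega>|lebesgue. F p (u x) * v x))"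

definition energy ::
    "real \<Rightarrow> real \<Rightarrow> real \<Rightarrow> real \<Rightarrow> 'a::euclidean_space set \<Rightarrow> ('a \<Rightarrow> real) \<Rightarrow> real" where
  "energy p s \<theta> \<mu> \<Omega> u =
     (LINT x:\<Omega>|lebesgue. norm (weak_grad \<Omega> u x) powr p)
     + (LINT y|lebesgue. LINT x|lebesgue.
          \<bar>u x - u y\<bar> powr p / norm (x - y) powr (real DIM('a) + s * p))
     - \<mu> * (LINT x:\<Omega>|lebesgue. \<bar>u x\<bar> powr p / norm x powr (p * \<theta>))"

definition lambda1 :: "real \<Rightarrow> real \<Rightarrow> real \<Rightarrow> real \<Rightarrow> 'a::euclidean_space set \<Rightarrow> real" where
  "lambda1 p s \<theta> \<mu> \<Omega> =
     Inf {energy p s \<theta> \<mu> \<Omega> u | u. u \<in> X_space p \<Omega> \<and> (LINT x:\<Omega>|lebesgue. \<bar>u x\<bar> powr p) = 1}"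

end

theory Submission
  imports Defs
begin

text \<open>
  Suppose that an eigenfunction \<open>w\<close> does not change sign. The operator is odd, so let \<open>w \<ge> 0\<close>; the
  claim is that the eigenvalue \<open>\<lambda>\<close> equals \<open>\<lambda>\<^sub>1\<close>. Testing the equation with \<open>w\<close> itself shows that the
  normalised \<open>w\<close> has energy \<open>\<lambda>\<close>, so it suffices that \<open>\<lambda> \<integral> \<bar>u\<bar>\<^sup>p\<close> is at most the energy of \<open>u\<close> for every
  \<open>u\<close> in \<open>X_space\<close>. Formally this results from testing the equation with \<open>\<bar>u\<bar>\<^sup>p / w\<^sup>p\<^sup>-\<^sup>1\<close>: by the local and
  the discrete Picone inequality (\<open>Picone_local\<close>, \<open>Picone_discrete\<close>) the first two terms of the weak form are at
  most \<open>\<integral> \<bar>\<nabla>u\<bar>\<^sup>p\<close> and the Gagliardo seminorm of \<open>u\<close>, and the other terms become the potential term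
  of the energy and \<open>\<lambda> \<integral> \<bar>u\<bar>\<^sup>p\<close>.

  To justify this, \<open>u\<close> is first a test function \<open>\<phi>\<close>, and the denominator is \<open>g\<^sub>\<epsilon> w\<close> to the power
  \<open>p - 1\<close>, where \<open>g\<^sub>\<epsilon>\<close> (\<open>pos_shift\<close>) is a smooth positive approximation of the identity on
  \<open>[0, \<infinity>)\<close> of slope at least \<open>1\<close>; this slope keeps both Picone inequalities intact. The zeros
  of \<open>w\<close> are excluded by the nonlocal term: at a pair \<open>(x, y)\<close> with \<open>w x = 0 < w y\<close> and
  \<open>\<phi> x \<noteq> 0\<close>, the defect of the discrete Picone inequality tends to infinity as \<open>\<epsilon> \<rightarrow> 0\<close>, but its
  integral over all pairs stays bounded. By Fatou's lemma the set of these pairs is null, and as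
  \<open>w\<close> does not vanish identically, \<open>w > 0\<close> almost everywhere on \<open>{x. \<phi> x \<noteq> 0}\<close>. Then \<open>\<epsilon> \<rightarrow> 0\<close>
  gives \<open>Picone_inequality\<close>, and approximation of \<open>u\<close> by test functions gives
  \<open>eigenvalue_le_energy\<close>.

  The analysis rests on Borel pairs \<open>(u, G)\<close> that are \<open>L\<^sup>p\<close> limits of test functions and their
  gradients (\<open>test_limit\<close>). They represent exactly the elements of \<open>X_space\<close>
  (\<open>X_space_represents\<close>, \<open>test_limit_imp_X_space\<close>), since weak gradients are unique
  (\<open>weak_gradient_unique\<close>). They have a finite Gagliardo seminorm (\<open>Gagliardo_test_limit\<close>), because
  translating a test function by \<open>h\<close> changes it in \<open>L\<^sup>p\<close> by at most \<open>\<bar>h\<bar>\<close> times the norm of its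
  gradient. And they obey the chain rule that makes the quotient above an admissible test
  function (\<open>test_limit_abs_powr_mult\<close>).
\<close>

section \<open>Iterated differentiability\<close>

lemma Ck_SucI:
  fixes f :: "'a::euclidean_space \<Rightarrow> real"
  assumes "\<And>x. (f has_derivative D x) (at x)" and "\<And>b. b \<in> Basis \<Longrightarrow> Ck k (\<lambda>x. D x b)"
  shows "Ck (Suc k) f"
proof -
  have "frechet_derivative f (at x) = D x" for x
    using assms(1) frechet_derivative_at by metis
  then show ?thesis using assms by (auto simp: differentiable_def)
qed

lemma Ck_SucD:
  fixes f :: "'a::euclidean_space \<Rightarrow> real"
  assumes "Ck (Suc k) f"
  shows "(f has_derivative frechet_derivative f (at x)) (at x)"
    and "b \<in> Basis \<Longrightarrow> Ck k (\<lambda>x. frechet_derivative f (at x) b)"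
  using assms by (auto simp: frechet_derivative_works)

lemma Ck_lower:
  fixes f :: "'a::euclidean_space \<Rightarrow> real"
  shows "Ck (Suc k) f \<Longrightarrow> Ck k f"
proof (induction k arbitrary: f)
  case 0
  then show ?case
    by (auto intro!: continuous_at_imp_continuous_on differentiable_imp_continuous_within)
next
  case (Suc k)
  then show ?case by simp
qed

lemma Ck_const: "Ck k (\<lambda>x::'a::euclidean_space. c)"
proof (induction k arbitrary: c)
  case 0
  then show ?case by simp
next
  case (Suc k)
  show ?case by (rule Ck_SucI[where D = "\<lambda>_ _. 0"]) (auto intro: Suc)
qed

lemma Ck_add:
  fixes f g :: "'a::euclidean_space \<Rightarrow> real"
  shows "Ck k f \<Longrightarrow> Ck k g \<Longrightarrow> Ck k (\<lambda>x. f x + g x)"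
proof (induction k arbitrary: f g)
  case 0
  then show ?case by (auto intro: continuous_intros)
next
  case (Suc k)
  show ?case
    by (rule Ck_SucI[where
          D = "\<lambda>x h. frechet_derivative f (at x) h + frechet_derivative g (at x) h"])
      (auto intro!: Suc.IH Ck_SucD[OF Suc.prems(1)] Ck_SucD[OF Suc.prems(2)] derivative_eq_intros)
qed

lemma Ck_mult:
  fixes f g :: "'a::euclidean_space \<Rightarrow> real"
  shows "Ck k f \<Longrightarrow> Ck k g \<Longrightarrow> Ck k (\<lambda>x. f x * g x)"
proof (induction k arbitrary: f g)
  case 0
  then show ?case by (auto intro: continuous_intros)
next
  case (Suc k)
  show ?case
    by (rule Ck_SucI[where D = "\<lambda>x h. f x * frechet_derivative g (at x) h
            + frechet_derivative f (at x) h * g x"])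
      (intro has_derivative_mult Ck_add Suc.IH Ck_lower[OF Suc.prems(1)] Ck_lower[OF Suc.prems(2)]
          Ck_SucD[OF Suc.prems(1)] Ck_SucD[OF Suc.prems(2)]; assumption)+
qed

lemma Ck_cmult:
  fixes f :: "'a::euclidean_space \<Rightarrow> real"
  shows "Ck k f \<Longrightarrow> Ck k (\<lambda>x. c * f x)"
  by (intro Ck_mult Ck_const)

lemma Ck_diff:
  fixes f g :: "'a::euclidean_space \<Rightarrow> real"
  assumes "Ck k f" "Ck k g"
  shows "Ck k (\<lambda>x. f x - g x)"
  using Ck_add[OF assms(1) Ck_cmult[OF assms(2), of "-1"]] by simp

lemma Ck_prod:
  fixes f :: "'i \<Rightarrow> 'a::euclidean_space \<Rightarrow> real"
  assumes "finite I" "\<And>i. i \<in> I \<Longrightarrow> Ck k (f i)"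
  shows "Ck k (\<lambda>x. \<Prod>i\<in>I. f i x)"
  using assms by (induction I rule: finite_induct) (auto intro: Ck_const Ck_mult)

lemma Ck_powr:
  fixes f :: "'a::euclidean_space \<Rightarrow> real"
  shows "Ck k f \<Longrightarrow> (\<And>x. f x > 0) \<Longrightarrow> Ck k (\<lambda>x. f x powr c)"
proof (induction k arbitrary: c)
  case 0
  then have "\<And>x. f x \<noteq> 0" by (metis less_irrefl)
  with 0 show ?case by (auto intro!: continuous_intros)
next
  case (Suc k)
  have *: "((\<lambda>x. f x powr c) has_derivative
      (\<lambda>h. (c * f x powr (c - 1)) * frechet_derivative f (at x) h)) (at x)" for x
    using Suc.prems(2)[of x]
    by (auto intro!: derivative_eq_intros Ck_SucD(1)[OF Suc.prems(1)]
        simp: field_simps powr_diff)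
  show ?case
    by (rule Ck_SucI[OF *])
      (intro Ck_cmult Ck_mult Ck_SucD[OF Suc.prems(1)] Suc Ck_lower[OF Suc.prems(1)]; assumption?)
qed

lemma Ck_inner: "Ck k (\<lambda>x::'a::euclidean_space. c * (x \<bullet> b) + d)"
proof (cases k)
  case 0
  then show ?thesis by (auto intro!: continuous_intros)
next
  case (Suc j)
  show ?thesis unfolding Suc
    by (rule Ck_SucI[where D = "\<lambda>x h. c * (h \<bullet> b)"]) (auto intro!: derivative_eq_intros Ck_const)
qed

text \<open>
  The family \<open>e\<^sup>-\<^sup>1\<^sup>/\<^sup>t / t\<^sup>m\<close> extended by \<open>0\<close> to \<open>t \<le> 0\<close> is closed under differentiation, which is
  what makes \<open>e\<^sup>-\<^sup>1\<^sup>/\<^sup>t\<close> smooth across the origin.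
\<close>

definition flat_exp :: "nat \<Rightarrow> real \<Rightarrow> real" where
  "flat_exp m t = (if t > 0 then exp (- (1 / t)) / t ^ m else 0)"

lemma flat_exp_has_derivative:
  "(flat_exp m has_real_derivative flat_exp (m + 2) t - real m * flat_exp (Suc m) t) (at t)"
proof (cases t "0::real" rule: linorder_cases)
  case less
  have "(flat_exp m has_real_derivative 0) (at t)"
    by (rule has_field_derivative_transform_within_open[where f = "\<lambda>_. 0" and S = "{..<0}"])
      (use less in \<open>auto simp: flat_exp_def\<close>)
  then show ?thesis using less by (simp add: flat_exp_def)
next
  case greater
  have pow: "((\<lambda>t. t ^ m) has_real_derivative real m * t ^ (m - 1)) (at t)"
    by (auto intro!: derivative_eq_intros)
  have exp: "((\<lambda>t. exp (- (1 / t))) has_real_derivative exp (- (1 / t)) / t\<^sup>2) (at t)"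
    using greater by (auto intro!: derivative_eq_intros simp: power2_eq_square)
  have "((\<lambda>t. exp (- (1 / t)) / t ^ m) has_real_derivative
      (exp (- (1 / t)) / t\<^sup>2 * t ^ m - exp (- (1 / t)) * (real m * t ^ (m - 1))) / (t ^ m * t ^ m)) (at t)"
    using greater by (intro DERIV_divide exp pow) auto
  also have "(exp (- (1 / t)) / t\<^sup>2 * t ^ m - exp (- (1 / t)) * (real m * t ^ (m - 1))) / (t ^ m * t ^ m)
      = flat_exp (m + 2) t - real m * flat_exp (Suc m) t"
    using greater by (cases m) (auto simp: flat_exp_def field_simps power2_eq_square)
  finally have "((\<lambda>t. exp (- (1 / t)) / t ^ m) has_real_derivative
      flat_exp (m + 2) t - real m * flat_exp (Suc m) t) (at t)" .
  then show ?thesis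
    by (rule has_field_derivative_transform_within_open[where S = "{0<..}"])
      (use greater in \<open>auto simp: flat_exp_def\<close>)
next
  case equal
  \<comment> \<open>The exponential beats every power, so the difference quotients at the origin tend to \<open>0\<close>.\<close>
  have "((\<lambda>h::real. flat_exp m h / h) \<longlongrightarrow> 0) (at 0)"
  proof -
    have r: "((\<lambda>h::real. exp (- (1 / h)) / h ^ m / h) \<longlongrightarrow> 0) (at_right 0)"
    proof -
      have "((\<lambda>y::real. y ^ (Suc m) / exp y) \<longlongrightarrow> 0) at_top"
        by (rule tendsto_power_div_exp_0)
      then have "((\<lambda>h::real. inverse h ^ (Suc m) / exp (inverse h)) \<longlongrightarrow> 0) (at_right 0)"
        by (rule filterlim_compose[OF _ filterlim_inverse_at_top_right])
      then show ?thesis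
        by (simp add: exp_minus field_simps)
    qed
    have "((\<lambda>h::real. flat_exp m h / h) \<longlongrightarrow> 0) (at_right 0)"
      by (rule Lim_transform_eventually[OF r])
        (auto simp: flat_exp_def eventually_at_filter)
    moreover have "((\<lambda>h::real. flat_exp m h / h) \<longlongrightarrow> 0) (at_left 0)"
      by (rule Lim_transform_eventually[OF tendsto_const])
        (auto simp: flat_exp_def eventually_at_filter)
    ultimately show ?thesis by (simp add: filterlim_split_at)
  qed
  then show ?thesis unfolding equal
    by (simp add: has_field_derivative_iff flat_exp_def)
qed

lemma Ck_flat_exp:
  fixes l :: "'a::euclidean_space \<Rightarrow> real"
  shows "Ck k l \<Longrightarrow> Ck k (\<lambda>x. flat_exp m (l x))"
proof (induction k arbitrary: m)
  case 0
  have "continuous_on UNIV (flat_exp m)"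
    using flat_exp_has_derivative
    by (meson DERIV_isCont continuous_at_imp_continuous_on)
  then have "continuous_on UNIV (flat_exp m \<circ> l)"
    using 0 by (intro continuous_on_compose) (auto intro: continuous_on_subset)
  then show ?case by (simp add: o_def)
next
  case (Suc k)
  have *: "((\<lambda>x. flat_exp m (l x)) has_derivative (\<lambda>h. frechet_derivative l (at x) h *
     (flat_exp (m + 2) (l x) - real m * flat_exp (Suc m) (l x)))) (at x)" for x
    using DERIV_compose_FDERIV[OF flat_exp_has_derivative Ck_SucD(1)[OF Suc.prems]] .
  show ?case
    by (rule Ck_SucI[OF *])
      (intro Ck_mult Ck_diff Ck_cmult Ck_SucD[OF Suc.prems] Suc.IH Ck_lower[OF Suc.prems]; assumption)
qed

section \<open>Gradients and integration by parts for test functions\<close>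

lemma inner_grad:
  fixes f :: "'a::euclidean_space \<Rightarrow> real"
  assumes "f differentiable (at x)"
  shows "grad f x \<bullet> h = frechet_derivative f (at x) h"
proof -
  have l: "linear (frechet_derivative f (at x))"
    using assms frechet_derivative_works has_derivative_linear by blast
  have "frechet_derivative f (at x) h = frechet_derivative f (at x) (\<Sum>b\<in>Basis. (h \<bullet> b) *\<^sub>R b)"
    by (simp add: euclidean_representation)
  also have "\<dots> = (\<Sum>b\<in>Basis. (h \<bullet> b) * frechet_derivative f (at x) b)"
    by (simp add: linear_sum[OF l] linear_scale[OF l])
  also have "\<dots> = grad f x \<bullet> h"
    by (simp add: grad_def inner_sum_right inner_commute[of _ h] mult.commute)
  finally show ?thesis by simp
qed

lemma has_derivative_grad:
  fixes f :: "'a::euclidean_space \<Rightarrow> real"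
  assumes "f differentiable (at x)"
  shows "(f has_derivative (\<lambda>h. grad f x \<bullet> h)) (at x)"
proof -
  have "(\<lambda>h. grad f x \<bullet> h) = frechet_derivative f (at x)"
    using inner_grad[OF assms] by auto
  then show ?thesis using assms by (simp add: frechet_derivative_works)
qed

lemma grad_eqI:
  fixes f :: "'a::euclidean_space \<Rightarrow> real"
  assumes "(f has_derivative (\<lambda>h. G \<bullet> h)) (at x)"
  shows "grad f x = G"
proof -
  have "frechet_derivative f (at x) = (\<lambda>h. G \<bullet> h)"
    using frechet_derivative_at[OF assms] by simp
  then show ?thesis
    by (simp add: grad_def euclidean_representation)
qed

lemma grad_mult:
  fixes f g :: "'a::euclidean_space \<Rightarrow> real"
  assumes "f differentiable (at x)" "g differentiable (at x)"
  shows "grad (\<lambda>x. f x * g x) x = f x *\<^sub>R grad g x + g x *\<^sub>R grad f x"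
proof (rule grad_eqI)
  show "((\<lambda>x. f x * g x) has_derivative (\<bullet>) (f x *\<^sub>R grad g x + g x *\<^sub>R grad f x)) (at x)"
    using has_derivative_mult[OF assms[THEN has_derivative_grad]]
    by (rule has_derivative_eq_rhs) (auto simp: inner_add_left)
qed

lemma grad_diff:
  fixes f g :: "'a::euclidean_space \<Rightarrow> real"
  assumes "f differentiable (at x)" "g differentiable (at x)"
  shows "grad (\<lambda>x. f x - g x) x = grad f x - grad g x"
proof (rule grad_eqI)
  show "((\<lambda>x. f x - g x) has_derivative (\<bullet>) (grad f x - grad g x)) (at x)"
    using has_derivative_diff[OF assms[THEN has_derivative_grad]]
    by (rule has_derivative_eq_rhs) (auto simp: inner_diff_left)
qed

lemma grad_chain:
  fixes f :: "'a::euclidean_space \<Rightarrow> real"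
  assumes "f differentiable (at x)" "(h has_real_derivative d) (at (f x))"
  shows "grad (\<lambda>x. h (f x)) x = d *\<^sub>R grad f x"
proof (rule grad_eqI)
  show "((\<lambda>x. h (f x)) has_derivative (\<bullet>) (d *\<^sub>R grad f x)) (at x)"
    using DERIV_compose_FDERIV[OF assms(2) has_derivative_grad[OF assms(1)]]
    by (rule has_derivative_eq_rhs) (auto simp: mult.commute)
qed

lemma test_Ck: "\<phi> \<in> test_functions \<Omega> \<Longrightarrow> Ck k \<phi>"
  by (auto simp: test_functions_def)

lemma test_differentiable: "\<phi> \<in> test_functions \<Omega> \<Longrightarrow> \<phi> differentiable (at x)"
  using test_Ck[of \<phi> \<Omega> "Suc 0"] by auto

lemma test_mono: "\<Omega> \<subseteq> \<Omega>' \<Longrightarrow> \<phi> \<in> test_functions \<Omega> \<Longrightarrow> \<phi> \<in> test_functions \<Omega>'"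
  by (auto simp: test_functions_def)

lemma test_continuous: "\<phi> \<in> test_functions \<Omega> \<Longrightarrow> continuous_on UNIV \<phi>"
  using test_Ck[of \<phi> \<Omega> 0] by auto

lemma grad_continuous:
  assumes "Ck (Suc 0) \<phi>"
  shows "continuous_on UNIV (grad \<phi>)"
proof -
  have "continuous_on UNIV (\<lambda>x. frechet_derivative \<phi> (at x) b)" if "b \<in> Basis" for b
    using assms that by auto
  then show ?thesis unfolding grad_def by (auto intro!: continuous_intros)
qed

lemma test_grad_continuous: "\<phi> \<in> test_functions \<Omega> \<Longrightarrow> continuous_on UNIV (grad \<phi>)"
  by (rule grad_continuous[OF test_Ck])

lemma test_support:
  assumes "\<phi> \<in> test_functions \<Omega>"
  shows "\<exists>K. compact K \<and> K \<subseteq> \<Omega> \<and> (\<forall>x. x \<notin> K \<longrightarrow> \<phi> x = 0 \<and> grad \<phi> x = 0)"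
proof (intro exI conjI allI impI)
  let ?K = "closure {x. \<phi> x \<noteq> 0}"
  show "compact ?K" "?K \<subseteq> \<Omega>" using assms by (auto simp: test_functions_def)
  show z: "\<phi> x = 0" if "x \<notin> ?K" for x using that closure_subset[of "{x. \<phi> x \<noteq> 0}"] by auto
  show "grad \<phi> x = 0" if "x \<notin> ?K" for x
  proof (rule grad_eqI)
    have "((\<lambda>_. 0) has_derivative (\<lambda>h. 0 \<bullet> h)) (at x)" by simp
    then show "(\<phi> has_derivative (\<lambda>h. 0 \<bullet> h)) (at x)"
      by (rule has_derivative_transform_within_open[OF _ open_Compl[OF closed_closure] iffD2[OF Compl_iff that]])
        (rule z[symmetric], erule ComplD)
  qed
qed

lemma test_outside:
  assumes "\<phi> \<in> test_functions \<Omega>" "x \<notin> \<Omega>"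
  shows "\<phi> x = 0" "grad \<phi> x = 0"
  using test_support[OF assms(1)] assms(2) by auto

lemma compact_closure_subset:
  assumes "closure A \<subseteq> B" "compact B"
  shows "compact (closure A)"
proof -
  have "B \<inter> closure A = closure A" using assms(1) by blast
  then show ?thesis using compact_Int_closed[OF assms(2) closed_closure, of A] by simp
qed

lemma test_I:
  assumes "\<And>k. Ck k f" "\<phi> \<in> test_functions \<Omega>" "\<And>x. \<phi> x = 0 \<Longrightarrow> f x = 0"
  shows "f \<in> test_functions \<Omega>"
proof -
  have *: "closure {x. f x \<noteq> 0} \<subseteq> closure {x. \<phi> x \<noteq> 0}"
    by (rule closure_mono) (use assms(3) in auto)
  moreover have "compact (closure {x. f x \<noteq> 0})"
    by (rule compact_closure_subset[OF *]) (use assms(2) in \<open>simp add: test_functions_def\<close>)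
  ultimately show ?thesis using assms(1,2) * unfolding test_functions_def by blast
qed

lemma test_diff:
  assumes "\<phi> \<in> test_functions \<Omega>" "\<psi> \<in> test_functions \<Omega>"
  shows "(\<lambda>x. \<phi> x - \<psi> x) \<in> test_functions \<Omega>"
proof -
  have *: "closure {x. \<phi> x - \<psi> x \<noteq> 0} \<subseteq> closure {x. \<phi> x \<noteq> 0} \<union> closure {x. \<psi> x \<noteq> 0}"
    unfolding closure_Un[symmetric] by (rule closure_mono) auto
  have "compact (closure {x. \<phi> x \<noteq> 0} \<union> closure {x. \<psi> x \<noteq> 0})"
    using assms by (intro compact_Un) (auto simp: test_functions_def)
  then have "compact (closure {x. \<phi> x - \<psi> x \<noteq> 0})"
    by (rule compact_closure_subset[OF *])
  moreover have "closure {x. \<phi> x \<noteq> 0} \<union> closure {x. \<psi> x \<noteq> 0} \<subseteq> \<Omega>"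
    using assms by (simp add: test_functions_def)
  moreover have "Ck k (\<lambda>x. \<phi> x - \<psi> x)" for k
    by (intro Ck_diff test_Ck[OF assms(1)] test_Ck[OF assms(2)])
  ultimately show ?thesis using * unfolding test_functions_def by blast
qed

lemma borel_measurable_test:
  "\<phi> \<in> test_functions \<Omega> \<Longrightarrow> \<phi> \<in> borel_measurable borel"
  "\<phi> \<in> test_functions \<Omega> \<Longrightarrow> grad \<phi> \<in> borel_measurable borel"
  by (auto intro!: borel_measurable_continuous_onI test_continuous test_grad_continuous)

definition test_bounds :: "('a::euclidean_space \<Rightarrow> real) \<Rightarrow> real \<Rightarrow> real \<Rightarrow> bool" where
  "test_bounds \<phi> r C \<longleftrightarrow> r > 0 \<and> C > 0 \<and> (\<forall>x. \<bar>\<phi> x\<bar> \<le> C \<and> norm (grad \<phi> x) \<le> C) \<and>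
     (\<forall>x. norm x > r \<longrightarrow> \<phi> x = 0 \<and> grad \<phi> x = 0)"

lemma test_boundsD:
  assumes "test_bounds \<phi> r C"
  shows "r > 0" "C > 0" "\<And>x. \<bar>\<phi> x\<bar> \<le> C" "\<And>x. norm (grad \<phi> x) \<le> C"
    "\<And>x. norm x > r \<Longrightarrow> \<phi> x = 0" "\<And>x. norm x > r \<Longrightarrow> grad \<phi> x = 0"
  using assms by (auto simp: test_bounds_def)

lemma test_bounded:
  assumes "\<phi> \<in> test_functions \<Omega>"
  shows "\<exists>r C. test_bounds \<phi> r C"
proof -
  obtain K where *: "compact K \<and> K \<subseteq> \<Omega> \<and> (\<forall>x. x \<notin> K \<longrightarrow> \<phi> x = 0 \<and> grad \<phi> x = 0)"
    using test_support[OF assms] by blast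
  then have K: "compact K" "K \<subseteq> \<Omega>"
    "\<And>x. x \<notin> K \<Longrightarrow> \<phi> x = 0" "\<And>x. x \<notin> K \<Longrightarrow> grad \<phi> x = 0" by auto
  have c: "continuous_on K \<phi>" "continuous_on K (grad \<phi>)"
    using test_continuous[OF assms] test_grad_continuous[OF assms]
    by (auto intro: continuous_on_subset)
  obtain r where r: "\<And>x. x \<in> K \<Longrightarrow> norm x \<le> r"
    using compact_imp_bounded[OF K(1)] by (auto simp: bounded_iff)
  obtain C1 where C1: "\<And>x. x \<in> K \<Longrightarrow> norm (\<phi> x) \<le> C1"
    using compact_imp_bounded[OF compact_continuous_image[OF c(1) K(1)]] by (auto simp: bounded_iff)
  obtain C2 where C2: "\<And>x. x \<in> K \<Longrightarrow> norm (grad \<phi> x) \<le> C2"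
    using compact_imp_bounded[OF compact_continuous_image[OF c(2) K(1)]] by (auto simp: bounded_iff)
  have "test_bounds \<phi> (max 1 r) (max 1 (max C1 C2))"
    unfolding test_bounds_def
  proof (intro conjI allI impI)
    show "\<bar>\<phi> x\<bar> \<le> max 1 (max C1 C2)" for x
      using C1[of x] K(3)[of x] by (cases "x \<in> K") auto
    show "norm (grad \<phi> x) \<le> max 1 (max C1 C2)" for x
      using C2[of x] K(4)[of x] by (cases "x \<in> K") auto
    show "\<phi> x = 0" if "norm x > max 1 r" for x using K(3)[of x] r[of x] that by linarith
    show "grad \<phi> x = 0" if "norm x > max 1 r" for x
      using K(4)[of x] r[of x] that by (cases "x \<in> K") auto
  qed auto
  then show ?thesis by blast
qed

lemma integrable_bounded_support:
  fixes f :: "'a::euclidean_space \<Rightarrow> 'b::{banach, second_countable_topology}"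
  assumes "f \<in> borel_measurable borel" "\<And>x. norm (f x) \<le> C" "\<And>x. norm x > r \<Longrightarrow> f x = 0"
  shows "integrable lborel f"
proof (rule Bochner_Integration.integrable_bound)
  show "integrable lborel (\<lambda>x::'a. C * indicator (cball 0 r) x)"
    using emeasure_lborel_cball_finite[of 0 r] by (auto intro!: integrable_mult_right)
  show "AE x in lborel. norm (f x) \<le> norm (C * indicator (cball 0 r) x :: real)"
    using assms(2,3) by (auto simp: indicator_def not_le intro!: AE_I2 order_trans[OF assms(2)])
qed (use assms in auto)

lemma test_integrable:
  assumes "\<phi> \<in> test_functions \<Omega>"
  shows "integrable lborel \<phi>" "integrable lborel (grad \<phi>)"
    and "p > 0 \<Longrightarrow> integrable lborel (\<lambda>x. \<bar>\<phi> x\<bar> powr p)"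
    and "p > 0 \<Longrightarrow> integrable lborel (\<lambda>x. norm (grad \<phi> x) powr p)"
proof -
  obtain r C where "test_bounds \<phi> r C" using test_bounded[OF assms] by blast
  note * = test_boundsD[OF this]
  note [measurable] = borel_measurable_test[OF assms]
  show "integrable lborel \<phi>" "integrable lborel (grad \<phi>)"
    by (rule integrable_bounded_support[where C = C and r = r]; use * in auto)+
  show "integrable lborel (\<lambda>x. \<bar>\<phi> x\<bar> powr p)" if "p > 0"
    by (rule integrable_bounded_support[where C = "C powr p" and r = r])
      (use * that in \<open>auto intro!: powr_mono2\<close>)
  show "integrable lborel (\<lambda>x. norm (grad \<phi> x) powr p)" if "p > 0"
    by (rule integrable_bounded_support[where C = "C powr p" and r = r])
      (use * that in \<open>auto intro!: powr_mono2\<close>)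
qed

lemma lborel_integral_translate:
  fixes f :: "'a::euclidean_space \<Rightarrow> 'b::{banach, second_countable_topology}"
  assumes "f \<in> borel_measurable borel"
  shows "(LINT x|lborel. f (x + c)) = (LINT x|lborel. f x)"
    and "integrable lborel f \<Longrightarrow> integrable lborel (\<lambda>x. f (x + c))"
proof -
  have d: "lborel = distr lborel borel (\<lambda>x. x + c)"
    using lborel_distr_plus[of c] by (simp add: add.commute[of _ c])
  show "(LINT x|lborel. f (x + c)) = (LINT x|lborel. f x)"
    by (subst (2) d) (use assms in \<open>auto simp: integral_distr\<close>)
  show "integrable lborel f \<Longrightarrow> integrable lborel (\<lambda>x. f (x + c))"
    by (subst (asm) d) (use assms in \<open>auto simp: integrable_distr_eq\<close>)
qed

lemma nn_integral_translate:
  fixes f :: "'a::euclidean_space \<Rightarrow> ennreal"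
  assumes [measurable]: "f \<in> borel_measurable borel"
  shows "(\<integral>\<^sup>+ x. f (x + c) \<partial>lborel) = (\<integral>\<^sup>+ x. f x \<partial>lborel)"
proof -
  have d: "lborel = distr lborel borel (\<lambda>x. x + c)"
    using lborel_distr_plus[of c] by (simp add: add.commute[of _ c])
  show ?thesis by (subst (2) d) (auto simp: nn_integral_distr)
qed

lemma lipschitz_of_grad_bound:
  fixes \<phi> :: "'a::euclidean_space \<Rightarrow> real"
  assumes d: "\<And>x. \<phi> differentiable (at x)" and C: "\<And>x. norm (grad \<phi> x) \<le> C"
  shows "\<bar>\<phi> y - \<phi> x\<bar> \<le> C * norm (y - x)"
proof -
  have on: "onorm ((\<bullet>) (grad \<phi> x)) \<le> C" for x
  proof (rule onorm_le)
    fix h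
    have "norm (grad \<phi> x \<bullet> h) \<le> norm (grad \<phi> x) * norm h"
      using Cauchy_Schwarz_ineq2[of "grad \<phi> x" h] by simp
    also have "\<dots> \<le> C * norm h" by (intro mult_right_mono C) simp
    finally show "norm (grad \<phi> x \<bullet> h) \<le> C * norm h" .
  qed
  have "norm (\<phi> y - \<phi> x) \<le> C * norm (y - x)"
    by (rule differentiable_bound[OF convex_UNIV has_derivative_grad[OF d] on]) simp_all
  then show ?thesis by simp
qed

lemma has_real_derivative_along_line:
  fixes \<phi> :: "'a::euclidean_space \<Rightarrow> real"
  assumes d: "\<And>x. \<phi> differentiable (at x)"
  shows "((\<lambda>s. \<phi> (x + s *\<^sub>R h)) has_real_derivative (grad \<phi> (x + t *\<^sub>R h) \<bullet> h)) (at t within S)"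
proof -
  have 1: "((\<lambda>s. x + s *\<^sub>R h) has_derivative (\<lambda>s. s *\<^sub>R h)) (at t within S)"
    by (auto intro!: derivative_eq_intros)
  have "((\<lambda>s. \<phi> (x + s *\<^sub>R h)) has_derivative (\<lambda>s. grad \<phi> (x + t *\<^sub>R h) \<bullet> (s *\<^sub>R h))) (at t within S)"
    by (rule has_derivative_compose[OF 1 has_derivative_grad[OF d]])
  then show ?thesis
    by (rule has_derivative_imp_has_field_derivative) simp
qed

text \<open>
  Translation invariance gives \<open>\<integral> (\<phi> (x + t b) - \<phi> x) / t = 0\<close> for every \<open>t\<close>; the claim is
  the limit \<open>t \<rightarrow> 0\<close>.
\<close>

lemma integral_grad_test:
  assumes \<phi>: "\<phi> \<in> test_functions \<Omega>"
  shows "(LINT x|lborel. grad \<phi> x) = 0"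
proof (rule euclidean_eqI)
  fix b :: 'a assume "b \<in> Basis"
  then have nb: "norm b = 1" by simp
  obtain r C where "test_bounds \<phi> r C" using test_bounded[OF \<phi>] by blast
  note r = test_boundsD[OF this]
  note [measurable] = borel_measurable_test[OF \<phi>]
  define t where "t n = inverse (real (Suc n))" for n
  have t0: "t n > 0" "t n \<le> 1" for n by (auto simp: t_def inverse_le_1_iff)
  have tlim: "t \<longlonglongrightarrow> 0" unfolding t_def by (rule LIMSEQ_inverse_real_of_nat)
  define g where "g n x = (\<phi> (x + t n *\<^sub>R b) - \<phi> x) / t n" for n x
  have [measurable]: "g n \<in> borel_measurable borel" for n unfolding g_def by measurable
  have g_lim: "(\<lambda>n. g n x) \<longlonglongrightarrow> grad \<phi> x \<bullet> b" for x
  proof -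
    have "((\<lambda>s. (\<phi> (x + s *\<^sub>R b) - \<phi> x) / s) \<longlongrightarrow> grad \<phi> x \<bullet> b) (at 0)"
      using has_real_derivative_along_line[OF test_differentiable[OF \<phi>], of x b 0 UNIV]
      by (simp add: has_field_derivative_iff)
    moreover have "filterlim t (at 0) sequentially"
      using tlim t0 by (auto simp: filterlim_at less_imp_neq[THEN not_sym])
    ultimately show ?thesis unfolding g_def by (rule filterlim_compose)
  qed
  have bound: "norm (g n x) \<le> C * indicator (cball 0 (r + 1)) x" for n x
  proof -
    have n: "norm (t n *\<^sub>R b) \<le> 1" using t0[of n] nb by simp
    have "\<bar>\<phi> (x + t n *\<^sub>R b) - \<phi> x\<bar> \<le> C * t n"
      using lipschitz_of_grad_bound[of \<phi> C "x + t n *\<^sub>R b" x, OF test_differentiable[OF \<phi>] r(4)]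
        t0[of n] nb by simp
    then have "\<bar>g n x\<bar> \<le> C"
      using t0[of n] by (simp add: g_def abs_divide pos_divide_le_eq)
    moreover have "g n x = 0" if "norm x > r + 1"
    proof -
      have "norm (x + t n *\<^sub>R b) \<ge> norm x - norm (t n *\<^sub>R b)" by (rule norm_diff_ineq)
      then have "norm (x + t n *\<^sub>R b) > r" using n that by linarith
      then show ?thesis using r(5)[of x] r(5)[of "x + t n *\<^sub>R b"] that by (simp add: g_def)
    qed
    ultimately show ?thesis
      by (auto simp: indicator_def not_le)
  qed
  have ind: "integrable lborel (\<lambda>x::'a. C * indicator (cball 0 (r + 1)) x)"
    using emeasure_lborel_cball_finite[of "0::'a" "r + 1"] by (auto intro!: integrable_mult_right)
  have "(\<lambda>n. LINT x|lborel. g n x) \<longlonglongrightarrow> (LINT x|lborel. grad \<phi> x \<bullet> b)"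
    by (rule integral_dominated_convergence[OF _ _ ind]) (use g_lim bound in auto)
  moreover have "(LINT x|lborel. g n x) = 0" for n
  proof -
    have "(LINT x|lborel. \<phi> (x + t n *\<^sub>R b) - \<phi> x) = 0"
      using lborel_integral_translate[OF borel_measurable_test(1)[OF \<phi>], of "t n *\<^sub>R b"]
        test_integrable(1)[OF \<phi>] by (simp add: Bochner_Integration.integral_diff)
    then show ?thesis unfolding g_def by simp
  qed
  ultimately have "(LINT x|lborel. grad \<phi> x \<bullet> b) = 0"
    by (simp add: LIMSEQ_const_iff)
  then show "(LINT x|lborel. grad \<phi> x) \<bullet> b = 0 \<bullet> b"
    using test_integrable(2)[OF \<phi>] by simp
qed

lemma test_mult:
  assumes "\<phi> \<in> test_functions \<Omega>" "\<psi> \<in> test_functions \<Omega>'"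
  shows "(\<lambda>x. \<phi> x * \<psi> x) \<in> test_functions \<Omega>"
  by (rule test_I[OF Ck_mult[OF test_Ck[OF assms(1)] test_Ck[OF assms(2)]] assms(1)]) simp

lemma integration_by_parts_test:
  assumes \<phi>: "\<phi> \<in> test_functions \<Omega>" and \<psi>: "\<psi> \<in> test_functions \<Omega>'"
  shows "(LINT x|lborel. \<phi> x *\<^sub>R grad \<psi> x) = - (LINT x|lborel. \<psi> x *\<^sub>R grad \<phi> x)"
proof -
  obtain r C where "test_bounds \<phi> r C" using test_bounded[OF \<phi>] by blast
  note r = test_boundsD[OF this]
  obtain r' D where "test_bounds \<psi> r' D" using test_bounded[OF \<psi>] by blast
  note r' = test_boundsD[OF this]
  note [measurable] = borel_measurable_test[OF \<phi>] borel_measurable_test[OF \<psi>]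
  have 1: "integrable lborel (\<lambda>x. \<phi> x *\<^sub>R grad \<psi> x)"
    by (rule integrable_bounded_support[where C = "C * D" and r = r])
      (use r r' in \<open>auto intro!: mult_mono\<close>)
  have 2: "integrable lborel (\<lambda>x. \<psi> x *\<^sub>R grad \<phi> x)"
    by (rule integrable_bounded_support[where C = "D * C" and r = r])
      (use r r' in \<open>auto intro!: mult_mono\<close>)
  have "grad (\<lambda>x. \<phi> x * \<psi> x) = (\<lambda>x. \<phi> x *\<^sub>R grad \<psi> x + \<psi> x *\<^sub>R grad \<phi> x)"
    by (rule ext) (rule grad_mult[OF test_differentiable[OF \<phi>] test_differentiable[OF \<psi>]])
  then have "(LINT x|lborel. \<phi> x *\<^sub>R grad \<psi> x + \<psi> x *\<^sub>R grad \<phi> x) = 0"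
    using integral_grad_test[OF test_mult[OF \<phi> \<psi>]] by simp
  then have "(LINT x|lborel. \<phi> x *\<^sub>R grad \<psi> x) + (LINT x|lborel. \<psi> x *\<^sub>R grad \<phi> x) = 0"
    by (simp only: Bochner_Integration.integral_add[OF 1 2])
  then show ?thesis by (rule eq_neg_iff_add_eq_0[THEN iffD2])
qed

section \<open>Uniqueness of weak gradients\<close>

text \<open>
  Each factor \<open>e\<^sup>-\<^sup>1\<^sup>/\<^sup>t\<close> lies in \<open>(0, 1)\<close> inside the box and vanishes outside. Dilating its argument
  by \<open>n + 1\<close> makes the product converge to the indicator of the open box, so the bumps need no
  normalising constants.
\<close>

definition box_bump :: "'a::euclidean_space \<Rightarrow> 'a \<Rightarrow> nat \<Rightarrow> 'a \<Rightarrow> real" where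
  "box_bump a b n x = (\<Prod>i\<in>Basis.
     flat_exp 0 (real (Suc n) * (x \<bullet> i) + - (real (Suc n) * (a \<bullet> i))) *
     flat_exp 0 (- real (Suc n) * (x \<bullet> i) + real (Suc n) * (b \<bullet> i)))"

lemma flat_exp_0: "0 \<le> flat_exp 0 t" "flat_exp 0 t \<le> 1" "flat_exp 0 t = 0 \<longleftrightarrow> t \<le> 0"
  by (auto simp: flat_exp_def)

lemma box_bump_bounds: "0 \<le> box_bump a b n x" "box_bump a b n x \<le> 1"
  unfolding box_bump_def
  by (auto intro!: prod_nonneg prod_le_1 mult_nonneg_nonneg mult_le_one flat_exp_0(1,2))

lemma flat_exp_0_factor: "flat_exp 0 (real (Suc n) * s + - (real (Suc n) * t)) = 0 \<longleftrightarrow> s \<le> t"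
proof -
  have "real (Suc n) * s + - (real (Suc n) * t) \<le> 0 \<longleftrightarrow> real (Suc n) * s \<le> real (Suc n) * t"
    by linarith
  then show ?thesis unfolding flat_exp_0(3) by simp
qed

lemma box_bump_zero_iff: "box_bump a b n x = 0 \<longleftrightarrow> x \<notin> box a b"
proof -
  have "flat_exp 0 (- real (Suc n) * (x \<bullet> i) + real (Suc n) * (b \<bullet> i)) = 0 \<longleftrightarrow> b \<bullet> i \<le> x \<bullet> i" for i
    using flat_exp_0_factor[of n "b \<bullet> i" "x \<bullet> i"] by (simp only: add.commute mult_minus_left)
  then show ?thesis
    by (auto simp only: box_bump_def prod_zero_iff[OF finite_Basis] mult_eq_0_iff
        flat_exp_0_factor mem_box not_less not_le) (metis not_le)+
qed

lemma box_bump_test: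
  assumes "box a b \<subseteq> C" "closed C" "bounded C" "C \<subseteq> \<Omega>"
  shows "box_bump a b n \<in> test_functions \<Omega>"
proof -
  have "closure {x. box_bump a b n x \<noteq> 0} \<subseteq> C"
    using closure_minimal[OF assms(1,2)] by (simp add: box_bump_zero_iff box_def)
  moreover have "compact C" using assms by (simp add: compact_eq_bounded_closed)
  moreover have "Ck k (box_bump a b n)" for k
    unfolding box_bump_def[abs_def] by (intro Ck_prod finite_Basis Ck_mult Ck_flat_exp Ck_inner)
  ultimately show ?thesis
    using assms(4) compact_closure_subset[of "{x. box_bump a b n x \<noteq> 0}" C]
    unfolding test_functions_def by blast
qed

lemma flat_exp_0_tendsto:
  assumes "s > 0"
  shows "(\<lambda>n. flat_exp 0 (real (Suc n) * s)) \<longlonglongrightarrow> 1"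
proof -
  have "(\<lambda>n. exp (- (inverse (real (Suc n)) * inverse s))) \<longlonglongrightarrow> exp (- (0 * inverse s))"
    by (intro tendsto_intros LIMSEQ_inverse_real_of_nat)
  moreover have "flat_exp 0 (real (Suc n) * s) = exp (- (inverse (real (Suc n)) * inverse s))" for n
    using assms by (simp add: flat_exp_def divide_inverse inverse_mult_distrib del: of_nat_Suc)
  ultimately show ?thesis by simp
qed

lemma box_bump_tendsto: "(\<lambda>n. box_bump a b n x) \<longlonglongrightarrow> indicator (box a b) x"
proof (cases "x \<in> box a b")
  case True
  have "(\<lambda>n. \<Prod>i\<in>Basis. flat_exp 0 (real (Suc n) * (x \<bullet> i - a \<bullet> i)) *
      flat_exp 0 (real (Suc n) * (b \<bullet> i - x \<bullet> i))) \<longlonglongrightarrow> (\<Prod>i\<in>(Basis::'a set). 1 * 1)"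
    by (intro tendsto_prod tendsto_mult flat_exp_0_tendsto) (use True in \<open>auto simp: mem_box\<close>)
  moreover have "box_bump a b n x = (\<Prod>i\<in>Basis. flat_exp 0 (real (Suc n) * (x \<bullet> i - a \<bullet> i)) *
      flat_exp 0 (real (Suc n) * (b \<bullet> i - x \<bullet> i)))" for n
    unfolding box_bump_def by (simp add: right_diff_distrib del: of_nat_Suc)
  ultimately show ?thesis using True by simp
next
  case False
  then have "box_bump a b n x = 0" for n by (simp add: box_bump_zero_iff)
  then show ?thesis using False by simp
qed

text \<open>
  The bumps are dominated by, and converge to, the indicator of their box, so \<open>f\<close> integrates to
  \<open>0\<close> over every small box.
\<close>

lemma integral_box_eq_0:
  fixes f :: "'a::euclidean_space \<Rightarrow> 'b::{banach, second_countable_topology}"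
  assumes [measurable]: "f \<in> borel_measurable borel"
    and int: "set_integrable lborel (cbox a b) f" and ab: "cbox a b \<subseteq> \<Omega>"
    and z: "\<And>\<phi>. \<phi> \<in> test_functions \<Omega> \<Longrightarrow> (LINT x:\<Omega>|lborel. \<phi> x *\<^sub>R f x) = 0"
    and cd: "box c d \<subseteq> cbox a b"
  shows "(LINT x|lborel. indicat_real (box c d) x *\<^sub>R f x) = 0"
proof -
  have test: "box_bump c d n \<in> test_functions \<Omega>" for n
    by (rule box_bump_test[OF cd closed_cbox bounded_cbox ab])
  note [measurable] = borel_measurable_test(1)[OF test]
  have "(\<lambda>n. LINT x|lborel. box_bump c d n x *\<^sub>R f x)
      \<longlonglongrightarrow> (LINT x|lborel. indicat_real (box c d) x *\<^sub>R f x)"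
  proof (rule integral_dominated_convergence)
    show "integrable lborel (\<lambda>x. norm (indicat_real (cbox a b) x *\<^sub>R f x))"
      using int unfolding set_integrable_def by (rule integrable_norm)
    show "AE x in lborel. (\<lambda>n. box_bump c d n x *\<^sub>R f x) \<longlonglongrightarrow> indicat_real (box c d) x *\<^sub>R f x"
      by (intro AE_I2 tendsto_scaleR box_bump_tendsto tendsto_const)
    show "AE x in lborel. norm (box_bump c d n x *\<^sub>R f x) \<le> norm (indicat_real (cbox a b) x *\<^sub>R f x)" for n
    proof (rule AE_I2)
      fix x
      show "norm (box_bump c d n x *\<^sub>R f x) \<le> norm (indicat_real (cbox a b) x *\<^sub>R f x)"
      proof (cases "x \<in> box c d")
        case True
        then show ?thesis using cd box_bump_bounds[of c d n x]
          by (auto simp: subset_eq intro!: mult_left_le_one_le)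
      next
        case False
        then have "box_bump c d n x = 0" by (simp add: box_bump_zero_iff)
        then show ?thesis by simp
      qed
    qed
  qed simp_all
  moreover have "(LINT x|lborel. box_bump c d n x *\<^sub>R f x) = 0" for n
  proof -
    have "(\<lambda>x. indicat_real \<Omega> x *\<^sub>R box_bump c d n x *\<^sub>R f x) = (\<lambda>x. box_bump c d n x *\<^sub>R f x)"
    proof
      show "indicat_real \<Omega> x *\<^sub>R box_bump c d n x *\<^sub>R f x = box_bump c d n x *\<^sub>R f x" for x
        using test_outside(1)[OF test[of n], of x] by (cases "x \<in> \<Omega>") auto
    qed
    then show ?thesis using z[OF test[of n]] by (simp only: set_lebesgue_integral_def)
  qed
  ultimately show ?thesis by (simp add: LIMSEQ_const_iff)
qed

text \<open>
  Boxes are stable under intersection and generate the Borel sets, so the integrals of \<open>f\<close> over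
  all Borel subsets of the box vanish.
\<close>

lemma fundamental_lemma_box:
  fixes f :: "'a::euclidean_space \<Rightarrow> 'b::{banach, second_countable_topology}"
  assumes [measurable]: "f \<in> borel_measurable borel"
    and int: "set_integrable lborel (cbox a b) f" and ab: "cbox a b \<subseteq> \<Omega>"
    and z: "\<And>\<phi>. \<phi> \<in> test_functions \<Omega> \<Longrightarrow> (LINT x:\<Omega>|lborel. \<phi> x *\<^sub>R f x) = 0"
  shows "AE x in lborel. x \<in> box a b \<longrightarrow> f x = 0"
proof -
  define h where "h x = indicat_real (box a b) x *\<^sub>R f x" for x
  have inth: "integrable lborel h"
    using set_integrable_subset[OF int, of "box a b"] box_subset_cbox[of a b]
    unfolding set_integrable_def h_def[abs_def] by simp
  have box0: "(LINT x:box c d|lborel. h x) = 0" for c d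
  proof -
    obtain c' d' where e: "box c d \<inter> box a b = box c' d'" using box_Int_box by blast
    have "(LINT x|lborel. indicat_real (box c' d') x *\<^sub>R f x) = 0"
      by (rule integral_box_eq_0[OF assms(1) int ab z]) (use e box_subset_cbox[of a b] in blast)+
    then show ?thesis
      unfolding set_lebesgue_integral_def h_def e[symmetric] by (simp add: indicator_inter_arith)
  qed
  have UN: "(LINT x|lborel. h x) = 0"
    using integral_box_eq_0[OF assms(1) int ab z box_subset_cbox] unfolding h_def by simp
  have sets_eq: "sets (borel :: 'a measure) = sigma_sets UNIV (range (\<lambda>(a, b). box a b))"
    by (subst borel_eq_box) simp
  have "(LINT x:A|lborel. h x) = 0" if "A \<in> sets lborel" for A
  proof -
    have sig: "A \<in> sigma_sets UNIV (range (\<lambda>(a, b). box a b :: 'a set))"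
      using that sets_eq by simp
    have stable: "Int_stable (range (\<lambda>(a, b). box a b :: 'a set))"
      by (auto simp: Int_stable_def box_Int_box)
    have sub: "range (\<lambda>(a, b). box a b :: 'a set) \<subseteq> Pow UNIV" by simp
    have borel: "B \<in> sets borel" if "B \<in> sigma_sets UNIV (range (\<lambda>(a, b). box a b :: 'a set))" for B
      using that sets_eq by simp
    from stable sub sig show ?thesis
    proof (induction rule: sigma_sets_induct_disjoint)
      case (basic A)
      then show ?case using box0 by auto
    next
      case empty
      then show ?case by (simp add: set_lebesgue_integral_def)
    next
      case (compl A)
      have [measurable]: "A \<in> sets borel" using borel[OF compl(1)] .
      have "set_integrable lborel A h"
        unfolding set_integrable_def by (rule integrable_mult_indicator[OF _ inth]) simp
      then have "(LINT x:UNIV - A|lborel. h x) = (LINT x|lborel. h x) - (LINT x:A|lborel. h x)"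
        unfolding set_lebesgue_integral_def set_integrable_def
        by (subst Bochner_Integration.integral_diff[symmetric, OF inth])
          (auto intro!: Bochner_Integration.integral_cong simp: indicator_def)
      then show ?case using UN compl by simp
    next
      case (union A)
      have [measurable]: "A i \<in> sets borel" for i using borel[of "A i"] union by auto
      have "(LINT x:(\<Union>i. A i)|lborel. h x) = (\<Sum>i. LINT x:A i|lborel. h x)"
      proof (rule lebesgue_integral_countable_add)
        show "set_integrable lborel (\<Union>i. A i) h"
          unfolding set_integrable_def by (rule integrable_mult_indicator[OF _ inth]) simp
      qed (use union in \<open>auto simp: disjoint_family_on_def\<close>)
      then show ?case using union by simp
    qed
  qed
  from sigma_finite_measure.density_zero[OF lborel.sigma_finite_measure_axioms inth this] show ?thesis
    by (rule AE_mp) (auto simp: h_def intro!: AE_I2)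
qed

lemma countable_subcover:
  fixes \<F> :: "'a::second_countable_topology set set"
  assumes "\<And>S. S \<in> \<F> \<Longrightarrow> open S"
  shows "\<exists>\<F>'. \<F>' \<subseteq> \<F> \<and> countable \<F>' \<and> \<Union>\<F>' = \<Union>\<F>"
  using Lindelof[OF assms] by metis

lemma open_contains_box_cbox:
  fixes x :: "'a::euclidean_space"
  assumes "open \<Omega>" "x \<in> \<Omega>"
  shows "\<exists>a b. x \<in> box a b \<and> cbox a b \<subseteq> \<Omega>"
  using assms open_contains_cbox[of \<Omega> x] by metis

lemma completion_ex_borel_measurable_euclidean:
  fixes f :: "'a \<Rightarrow> 'b::euclidean_space"
  assumes "f \<in> borel_measurable (completion M)"
  shows "\<exists>g\<in>borel_measurable M. AE x in M. f x = g x"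
proof -
  have "\<exists>g\<in>borel_measurable M. AE x in M. f x \<bullet> b = g x" for b
    using assms by (intro completion_ex_borel_measurable_real) simp
  then obtain g where g: "\<And>b. g b \<in> borel_measurable M" "\<And>b. AE x in M. f x \<bullet> b = g b x"
    by metis
  note [measurable] = g(1)
  have "AE x in M. \<forall>b\<in>Basis. f x \<bullet> b = g b x"
    using g(2) by (simp add: AE_ball_countable countable_finite)
  then have "AE x in M. f x = (\<Sum>b\<in>Basis. g b x *\<^sub>R b)"
  proof (rule AE_mp, intro AE_I2 impI)
    fix x assume "\<forall>b\<in>Basis. f x \<bullet> b = g b x"
    then have "(\<Sum>b\<in>Basis. g b x *\<^sub>R b) = (\<Sum>b\<in>Basis. (f x \<bullet> b) *\<^sub>R b)"
      by (intro sum.cong) auto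
    then show "f x = (\<Sum>b\<in>Basis. g b x *\<^sub>R b)" by (simp add: euclidean_representation)
  qed
  then show ?thesis by (intro bexI[of _ "\<lambda>x. \<Sum>b\<in>Basis. g b x *\<^sub>R b"]) auto
qed

lemma measurable_lebesgue:
  "f \<in> borel_measurable borel \<Longrightarrow> f \<in> borel_measurable lebesgue"
  by (rule measurable_completion) simp

lemma AE_lebesgue_iff: "(AE x in lebesgue. P x) \<longleftrightarrow> (AE x in lborel. P x)"
  by (rule AE_completion_iff)

text \<open>
  Only test functions supported in a single box enter at a time, so a Borel version of \<open>f\<close> is
  needed on compact boxes only, where \<open>f\<close> is integrable.
\<close>

lemma fundamental_lemma:
  fixes f :: "'a::euclidean_space \<Rightarrow> 'b::euclidean_space"
  assumes "open \<Omega>"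
    and int: "\<And>K. compact K \<Longrightarrow> K \<subseteq> \<Omega> \<Longrightarrow> set_integrable lebesgue K f"
    and z: "\<And>\<phi>. \<phi> \<in> test_functions \<Omega> \<Longrightarrow> (LINT x:\<Omega>|lebesgue. \<phi> x *\<^sub>R f x) = 0"
  shows "AE x in lebesgue. x \<in> \<Omega> \<longrightarrow> f x = 0"
proof -
  define \<F> where "\<F> = {box a b | a b. cbox a b \<subseteq> \<Omega>}"
  have "\<exists>\<F>'. \<F>' \<subseteq> \<F> \<and> countable \<F>' \<and> \<Union>\<F>' = \<Union>\<F>"
    by (rule countable_subcover) (auto simp: \<F>_def)
  then obtain \<F>' where F': "\<F>' \<subseteq> \<F>" "countable \<F>'" "\<Union>\<F>' = \<Union>\<F>"
    by auto
  have "\<Omega> \<subseteq> \<Union>\<F>"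
  proof
    fix x assume x: "x \<in> \<Omega>"
    obtain a b where "x \<in> box a b" "cbox a b \<subseteq> \<Omega>"
      using open_contains_box_cbox[OF \<open>open \<Omega>\<close> x] by auto
    then show "x \<in> \<Union>\<F>" by (auto simp: \<F>_def)
  qed
  then have cover: "\<exists>S\<in>\<F>'. x \<in> S" if "x \<in> \<Omega>" for x using F'(3) that by blast
  have box: "AE x in lborel. x \<in> box a b \<longrightarrow> f x = 0" if ab: "cbox a b \<subseteq> \<Omega>" for a b
  proof -
    have intf: "integrable lebesgue (\<lambda>x. indicat_real (cbox a b) x *\<^sub>R f x)"
      using int[OF compact_cbox ab] by (simp add: set_integrable_def)
    have "\<exists>g\<in>borel_measurable lborel. AE x in lborel. indicat_real (cbox a b) x *\<^sub>R f x = g x"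
      by (rule completion_ex_borel_measurable_euclidean[OF borel_measurable_integrable[OF intf]])
    then obtain g where g [measurable]: "g \<in> borel_measurable borel"
      and fg: "AE x in lborel. indicat_real (cbox a b) x *\<^sub>R f x = g x"
      by auto
    have "integrable lebesgue g"
      using intf integrable_cong_AE[OF borel_measurable_integrable[OF intf] measurable_lebesgue[OF g]] fg
      by (simp add: AE_lebesgue_iff)
    then have "integrable lborel g" by (simp add: integrable_completion)
    then have intg: "set_integrable lborel (cbox a b) g"
      unfolding set_integrable_def by (intro integrable_mult_indicator) auto
    have "AE x in lborel. x \<in> box a b \<longrightarrow> g x = 0"
    proof (rule fundamental_lemma_box[OF g intg subset_refl])
      fix \<phi> assume \<phi>: "\<phi> \<in> test_functions (cbox a b)"
      note \<phi>\<Omega> = test_mono[OF ab \<phi>]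
      note [measurable] = borel_measurable_test(1)[OF \<phi>]
      have "(LINT x:cbox a b|lborel. \<phi> x *\<^sub>R g x)
          = (LINT x|lebesgue. indicat_real (cbox a b) x *\<^sub>R \<phi> x *\<^sub>R g x)"
        unfolding set_lebesgue_integral_def by (rule integral_completion[symmetric]) simp
      also have "\<dots> = (LINT x|lebesgue. \<phi> x *\<^sub>R indicat_real (cbox a b) x *\<^sub>R f x)"
      proof (rule integral_cong_AE)
        show "AE x in lebesgue. indicat_real (cbox a b) x *\<^sub>R \<phi> x *\<^sub>R g x
            = \<phi> x *\<^sub>R indicat_real (cbox a b) x *\<^sub>R f x"
          unfolding AE_lebesgue_iff using fg by (rule AE_mp) (auto simp: indicator_def intro!: AE_I2)
        show "(\<lambda>x. \<phi> x *\<^sub>R indicat_real (cbox a b) x *\<^sub>R f x) \<in> borel_measurable lebesgue"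
          by (intro borel_measurable_scaleR measurable_lebesgue borel_measurable_test(1)[OF \<phi>]
              borel_measurable_integrable[OF intf])
      qed (auto intro: measurable_lebesgue)
      also have "\<dots> = (LINT x:\<Omega>|lebesgue. \<phi> x *\<^sub>R f x)"
        unfolding set_lebesgue_integral_def
        by (rule Bochner_Integration.integral_cong)
          (use ab test_outside(1)[OF \<phi>] in \<open>auto simp: indicator_def\<close>)
      finally show "(LINT x:cbox a b|lborel. \<phi> x *\<^sub>R g x) = 0"
        using z[OF \<phi>\<Omega>] by simp
    qed
    with fg have "AE x in lborel. indicat_real (cbox a b) x *\<^sub>R f x = g x \<and> (x \<in> box a b \<longrightarrow> g x = 0)"
      by (rule AE_conjI)
    then show ?thesis
      by (rule AE_mp) (use box_subset_cbox[of a b] in \<open>auto intro!: AE_I2\<close>)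
  qed
  have "AE x in lborel. \<forall>S\<in>\<F>'. x \<in> S \<longrightarrow> f x = 0"
  proof (subst AE_ball_countable[OF F'(2)], intro ballI)
    fix S assume "S \<in> \<F>'"
    then obtain a b where S: "S = box a b" "cbox a b \<subseteq> \<Omega>" using F'(1) by (auto simp: \<F>_def)
    show "AE x in lborel. x \<in> S \<longrightarrow> f x = 0"
      unfolding S(1) by (rule box[OF S(2)])
  qed
  then show ?thesis
    unfolding AE_lebesgue_iff
  proof (rule AE_mp, intro AE_I2 impI)
    fix x assume "\<forall>S\<in>\<F>'. x \<in> S \<longrightarrow> f x = 0" "x \<in> \<Omega>"
    then show "f x = 0" using cover by blast
  qed
qed

lemma test_scaleR_integrable:
  fixes G :: "'a::euclidean_space \<Rightarrow> 'b::euclidean_space"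
  assumes \<phi>: "\<phi> \<in> test_functions \<Omega>"
    and int: "\<And>K. compact K \<Longrightarrow> K \<subseteq> \<Omega> \<Longrightarrow> set_integrable lebesgue K G"
  shows "set_integrable lebesgue \<Omega> (\<lambda>x. \<phi> x *\<^sub>R G x)"
proof -
  obtain K where K: "compact K \<and> K \<subseteq> \<Omega> \<and> (\<forall>x. x \<notin> K \<longrightarrow> \<phi> x = 0 \<and> grad \<phi> x = 0)"
    using test_support[OF \<phi>] by blast
  obtain r C where "test_bounds \<phi> r C" using test_bounded[OF \<phi>] by blast
  note C = test_boundsD[OF this]
  have i: "integrable lebesgue (\<lambda>x. indicat_real K x *\<^sub>R G x)"
    using int K by (simp add: set_integrable_def)
  have "integrable lebesgue (\<lambda>x. \<phi> x *\<^sub>R indicat_real K x *\<^sub>R G x)"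
  proof (rule Bochner_Integration.integrable_bound)
    show "integrable lebesgue (\<lambda>x. C *\<^sub>R indicat_real K x *\<^sub>R G x)"
      by (intro integrable_scaleR_right i)
    show "AE x in lebesgue. norm (\<phi> x *\<^sub>R indicat_real K x *\<^sub>R G x)
        \<le> norm (C *\<^sub>R indicat_real K x *\<^sub>R G x)"
    proof (rule AE_I2)
      fix x
      have "\<bar>\<phi> x\<bar> \<le> \<bar>C\<bar>" using C(3)[of x] by linarith
      then show "norm (\<phi> x *\<^sub>R indicat_real K x *\<^sub>R G x) \<le> norm (C *\<^sub>R indicat_real K x *\<^sub>R G x)"
        unfolding norm_scaleR by (rule mult_right_mono) simp
    qed
  qed (intro borel_measurable_scaleR measurable_lebesgue borel_measurable_test(1)[OF \<phi>]
      borel_measurable_integrable[OF i])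
  moreover have "(\<lambda>x. \<phi> x *\<^sub>R indicat_real K x *\<^sub>R G x) = (\<lambda>x. indicat_real \<Omega> x *\<^sub>R \<phi> x *\<^sub>R G x)"
    using K by (auto simp: fun_eq_iff indicator_def)
  ultimately show ?thesis by (simp only: set_integrable_def)
qed

text \<open>
  The constant \<open>weak_grad\<close> is an arbitrary choice among all weak gradients; uniqueness allows
  it to be exchanged for any gradient at hand.
\<close>

lemma weak_gradient_unique:
  fixes u :: "'a::euclidean_space \<Rightarrow> real"
  assumes "open \<Omega>" and G: "has_weak_gradient \<Omega> u G" and H: "has_weak_gradient \<Omega> u H"
  shows "AE x in lebesgue. x \<in> \<Omega> \<longrightarrow> G x = H x"
proof -
  have "AE x in lebesgue. x \<in> \<Omega> \<longrightarrow> G x - H x = 0"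
  proof (rule fundamental_lemma[OF \<open>open \<Omega>\<close>])
    fix K :: "'a set" assume "compact K" "K \<subseteq> \<Omega>"
    then show "set_integrable lebesgue K (\<lambda>x. G x - H x)"
      using G H by (intro set_integral_diff) (auto simp: has_weak_gradient_def)
  next
    fix \<phi> assume \<phi>: "\<phi> \<in> test_functions \<Omega>"
    have "set_integrable lebesgue \<Omega> (\<lambda>x. \<phi> x *\<^sub>R G x)" "set_integrable lebesgue \<Omega> (\<lambda>x. \<phi> x *\<^sub>R H x)"
      using G H by (intro test_scaleR_integrable[OF \<phi>]; simp add: has_weak_gradient_def)+
    then have "(LINT x:\<Omega>|lebesgue. \<phi> x *\<^sub>R G x - \<phi> x *\<^sub>R H x)
        = (LINT x:\<Omega>|lebesgue. \<phi> x *\<^sub>R G x) - (LINT x:\<Omega>|lebesgue. \<phi> x *\<^sub>R H x)"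
      by (rule set_integral_diff(2))
    moreover have "(LINT x:\<Omega>|lebesgue. \<phi> x *\<^sub>R G x) = (LINT x:\<Omega>|lebesgue. \<phi> x *\<^sub>R H x)"
      using G H \<phi> unfolding has_weak_gradient_def by (metis minus_equation_iff)
    ultimately show "(LINT x:\<Omega>|lebesgue. \<phi> x *\<^sub>R (G x - H x)) = 0"
      by (simp add: scaleR_diff_right)
  qed
  then show ?thesis by simp
qed

section \<open>Convexity of the \<open>p\<close>-th power\<close>

text \<open>
  Young's inequality with the exponents \<open>p\<close> and \<open>p / (p - 1)\<close>. Equivalently, the graph of \<open>x\<^sup>p\<close> lies
  above its tangent at \<open>m\<close>; convexity, Jensen's inequality and the local Picone inequality are all
  read off from this form.
\<close>

lemma Young_powr:
  fixes x m p :: real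
  assumes "p > 1" "x \<ge> 0" "m \<ge> 0"
  shows "p * (m powr (p - 1) * x) \<le> x powr p + (p - 1) * m powr p"
proof -
  let ?q = "p / (p - 1)"
  have "x * m powr (p - 1) \<le> x powr p / p + (m powr (p - 1)) powr ?q / ?q"
    by (rule Youngs_inequality) (use assms in \<open>auto simp: field_simps\<close>)
  also have "(m powr (p - 1)) powr ?q = m powr p"
    using assms by (simp add: powr_powr)
  finally have "p * (x * m powr (p - 1)) \<le> p * (x powr p / p + m powr p / ?q)"
    using assms by (intro mult_left_mono) auto
  also have "\<dots> = x powr p + (p - 1) * m powr p"
    using assms by (simp add: field_simps)
  finally show ?thesis by (simp add: mult.commute mult.left_commute)
qed

text \<open>
  Both \<open>x\<close> and \<open>y\<close> lie above the tangent at the convex combination \<open>m\<close>; the tangents average to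
  the value \<open>m\<^sup>p\<close>.
\<close>

lemma powr_convex_comb:
  fixes x y p t :: real
  assumes "p > 1" "x \<ge> 0" "y \<ge> 0" "0 \<le> t" "t \<le> 1"
  shows "(t * x + (1 - t) * y) powr p \<le> t * x powr p + (1 - t) * y powr p"
proof -
  define m where "m = t * x + (1 - t) * y"
  have m: "m \<ge> 0" using assms by (simp add: m_def)
  have "t * (p * (m powr (p - 1) * x)) + (1 - t) * (p * (m powr (p - 1) * y))
      \<le> t * (x powr p + (p - 1) * m powr p) + (1 - t) * (y powr p + (p - 1) * m powr p)"
    using assms m by (intro add_mono mult_left_mono Young_powr) auto
  also have "t * (x powr p + K) + (1 - t) * (y powr p + K) = t * x powr p + (1 - t) * y powr p + K" for K
    by (simp add: algebra_simps)
  finally have "t * (p * (m powr (p - 1) * x)) + (1 - t) * (p * (m powr (p - 1) * y))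
      \<le> t * x powr p + (1 - t) * y powr p + (p - 1) * m powr p" .
  moreover have "t * (p * (q * x)) + (1 - t) * (p * (q * y)) = p * (q * m)" for q
    by (simp add: m_def algebra_simps)
  moreover have "m powr (p - 1) * m = m powr p"
    using m by (cases "m = 0") (auto simp: powr_diff)
  ultimately have "p * m powr p \<le> t * x powr p + (1 - t) * y powr p + (p - 1) * m powr p"
    by (simp only:)
  then have "m powr p \<le> t * x powr p + (1 - t) * y powr p" by (simp add: algebra_simps)
  then show ?thesis by (simp only: m_def)
qed

text \<open>
  The constant in front of \<open>b\<close> can be taken arbitrarily close to \<open>1\<close>. This replaces the
  triangle inequality for \<open>L\<^sup>p\<close> norms, and is also what the discrete Picone inequality comes
  down to.
\<close>

lemma norm_powr_split:
  fixes a b :: "'b::real_normed_vector"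
  assumes "p > 1" "0 < t" "t < 1"
  shows "norm a powr p \<le> t powr (1 - p) * norm b powr p + (1 - t) powr (1 - p) * norm (a - b) powr p"
proof -
  have "norm a \<le> norm b + norm (a - b)" using norm_triangle_ineq[of b "a - b"] by simp
  then have "norm a powr p \<le> (t * (norm b / t) + (1 - t) * (norm (a - b) / (1 - t))) powr p"
    using assms by (intro powr_mono2) auto
  also have "\<dots> \<le> t * (norm b / t) powr p + (1 - t) * (norm (a - b) / (1 - t)) powr p"
    using assms by (intro powr_convex_comb) auto
  also have "t * (norm b / t) powr p = t powr (1 - p) * norm b powr p"
    using assms by (simp add: powr_divide powr_diff)
  also have "(1 - t) * (norm (a - b) / (1 - t)) powr p = (1 - t) powr (1 - p) * norm (a - b) powr p"
    using assms by (simp add: powr_divide powr_diff)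
  finally show ?thesis .
qed

lemma norm_diff_powr_le:
  fixes a b :: "'b::real_normed_vector"
  assumes "p > 1"
  shows "norm (a - b) powr p \<le> 2 powr p * norm a powr p + 2 powr p * norm b powr p"
proof -
  have "norm (a - b) \<le> 2 * max (norm a) (norm b)"
    using norm_triangle_ineq4[of a b] by linarith
  then have "norm (a - b) powr p \<le> (2 * max (norm a) (norm b)) powr p"
    using assms by (intro powr_mono2) auto
  also have "\<dots> = 2 powr p * max (norm a) (norm b) powr p"
    by (subst powr_mult) auto
  also have "\<dots> \<le> 2 powr p * (norm a powr p + norm b powr p)"
    by (intro mult_left_mono) (auto simp: max_def)
  finally show ?thesis by (simp add: distrib_left)
qed

lemma le_powr_split:
  fixes a \<eta> p :: real
  assumes "p > 1" "\<eta> > 0" "a \<ge> 0"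
  shows "a \<le> \<eta> + \<eta> powr (1 - p) * a powr p"
proof (cases "a \<le> \<eta>")
  case True
  then show ?thesis using assms by (simp add: add_increasing2)
next
  case False
  then have a: "a > 0" using assms by linarith
  have "a = a powr (1 - p) * a powr p" using a by (simp add: powr_add[symmetric])
  also have "\<dots> \<le> \<eta> powr (1 - p) * a powr p"
    using False assms a by (intro mult_right_mono powr_mono2') auto
  finally show ?thesis using assms by linarith
qed

lemma integrable_powr_diff:
  fixes f g :: "'a \<Rightarrow> 'b::{second_countable_topology, real_normed_vector}"
  assumes "p > 1" and [measurable]: "f \<in> borel_measurable M" "g \<in> borel_measurable M"
    and "integrable M (\<lambda>x. norm (f x) powr p)" "integrable M (\<lambda>x. norm (g x) powr p)"
  shows "integrable M (\<lambda>x. norm (f x - g x) powr p)"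
proof (rule Bochner_Integration.integrable_bound)
  show "integrable M (\<lambda>x. 2 powr p * norm (f x) powr p + 2 powr p * norm (g x) powr p)"
    using assms(4,5) by simp
  show "AE x in M. norm (norm (f x - g x) powr p)
      \<le> norm (2 powr p * norm (f x) powr p + 2 powr p * norm (g x) powr p)"
    using norm_diff_powr_le[OF assms(1)] by (intro AE_I2) simp
qed simp

lemma set_integrable_bounded_set:
  fixes f :: "'a::euclidean_space \<Rightarrow> 'b::euclidean_space"
  assumes "p > 1" and [measurable]: "f \<in> borel_measurable borel" "K \<in> sets borel"
    and "bounded K" "integrable lborel (\<lambda>x. norm (f x) powr p)"
  shows "set_integrable lborel K f"
  unfolding set_integrable_def
proof (rule Bochner_Integration.integrable_bound)
  have "emeasure lborel K < \<infinity>"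
    using assms(4) by (rule emeasure_bounded_finite)
  then show "integrable lborel (\<lambda>x. indicat_real K x + norm (f x) powr p)"
    using assms(5) by (intro Bochner_Integration.integrable_add integrable_real_indicator) auto
  show "AE x in lborel. norm (indicat_real K x *\<^sub>R f x) \<le> norm (indicat_real K x + norm (f x) powr p)"
    using le_powr_split[OF assms(1), of 1 "norm (f _)"] by (intro AE_I2) (auto simp: indicator_def)
qed simp

text \<open>
  On a ball, \<open>\<bar>f\<bar> \<le> \<eta> + \<eta>\<^sup>1\<^sup>-\<^sup>p \<bar>f\<bar>\<^sup>p\<close> bounds the integral by \<open>C \<eta>\<close> plus a multiple of
  \<open>\<integral> \<bar>f\<bar>\<^sup>p\<close>, so a small \<open>\<eta>\<close> followed by a large index does the work of Hoelder's inequality. This is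
  what carries integration by parts over from test functions to their limits.
\<close>

lemma powr_integral_tendsto_0_bounded_support:
  fixes f :: "nat \<Rightarrow> 'a::euclidean_space \<Rightarrow> 'b::euclidean_space"
    and g :: "nat \<Rightarrow> 'a \<Rightarrow> 'c::euclidean_space"
  assumes "p > 1" and [measurable]: "\<And>n. f n \<in> borel_measurable borel" "\<And>n. g n \<in> borel_measurable borel"
    and int: "\<And>n. integrable lborel (\<lambda>x. norm (f n x) powr p)"
    and lim: "(\<lambda>n. LINT x|lborel. norm (f n x) powr p) \<longlonglongrightarrow> 0"
    and b: "\<And>n x. norm (g n x) \<le> C * norm (f n x)" "\<And>n x. norm x > r \<Longrightarrow> g n x = 0"
  shows "(\<lambda>n. LINT x|lborel. g n x) \<longlonglongrightarrow> 0"
    and "\<And>n. integrable lborel (g n)"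
proof -
  define m where "m = measure lborel (cball (0::'a) r)"
  define D where "D = max C 1"
  have fin: "integrable lborel (\<lambda>x::'a. indicat_real (cball 0 r) x)"
    using emeasure_lborel_cball_finite[of "0::'a" r] by (intro integrable_real_indicator) auto
  have bd: "norm (g n x) \<le> D * \<eta> * indicat_real (cball 0 r) x + D * \<eta> powr (1 - p) * norm (f n x) powr p"
    if "\<eta> > 0" for n x \<eta>
  proof (cases "norm x > r")
    case True
    then show ?thesis using b(2)[OF True, of n] by (simp add: D_def)
  next
    case False
    have "norm (g n x) \<le> D * norm (f n x)"
      using b(1)[of n x] mult_right_mono[of C D "norm (f n x)"] by (simp add: D_def)
    also have "\<dots> \<le> D * (\<eta> + \<eta> powr (1 - p) * norm (f n x) powr p)"
      using le_powr_split[OF assms(1) that, of "norm (f n x)"] by (intro mult_left_mono) (auto simp: D_def)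
    finally show ?thesis using False by (simp add: distrib_left mult.assoc)
  qed
  have ib: "integrable lborel (\<lambda>x. D * \<eta> * indicat_real (cball 0 r) x + D * \<eta> powr (1 - p) * norm (f n x) powr p)" for n \<eta>
    by (intro Bochner_Integration.integrable_add integrable_mult_right fin int)
  show ig: "integrable lborel (g n)" for n
    by (rule Bochner_Integration.integrable_bound[OF ib[of 1 n]])
      (use bd[of 1 n] in \<open>auto intro!: AE_I2 order_trans[OF bd[of 1 n]]\<close>)
  have le: "norm (LINT x|lborel. g n x) \<le> D * \<eta> * m + D * \<eta> powr (1 - p) * (LINT x|lborel. norm (f n x) powr p)"
    if "\<eta> > 0" for n \<eta>
  proof -
    have "norm (LINT x|lborel. g n x) \<le> (LINT x|lborel. norm (g n x))"
      by (rule integral_norm_bound)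
    also have "\<dots> \<le> (LINT x|lborel. D * \<eta> * indicat_real (cball 0 r) x + D * \<eta> powr (1 - p) * norm (f n x) powr p)"
      by (intro integral_mono integrable_norm ig ib bd that)
    also have "\<dots> = D * \<eta> * m + D * \<eta> powr (1 - p) * (LINT x|lborel. norm (f n x) powr p)"
      by (subst Bochner_Integration.integral_add) (auto intro!: integrable_mult_right fin int simp: m_def)
    finally show ?thesis .
  qed
  show "(\<lambda>n. LINT x|lborel. g n x) \<longlonglongrightarrow> 0"
  proof (rule LIMSEQ_I)
    fix e :: real assume e: "e > 0"
    have m: "m \<ge> 0" "D \<ge> 1" by (auto simp: m_def D_def)
    \<comment> \<open>The \<open>+ 1\<close> covers balls of measure \<open>0\<close>, where \<open>r \<le> 0\<close>.\<close>
    define \<eta> where "\<eta> = e / (2 * D * (m + 1))"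
    have \<eta>: "\<eta> > 0" using e m by (auto simp: \<eta>_def)
    have "D * \<eta> * m \<le> D * \<eta> * (m + 1)" using \<eta> m by (intro mult_left_mono) auto
    also have "\<dots> = e / 2"
    proof -
      have "D * (e / (2 * D * k)) * k = e / 2" if "k > 0" for k
        using m that by (simp add: divide_simps)
      from this[of "m + 1"] show ?thesis using m by (simp add: \<eta>_def)
    qed
    finally have 1: "D * \<eta> * m \<le> e / 2" .
    have "(\<lambda>n. D * \<eta> powr (1 - p) * (LINT x|lborel. norm (f n x) powr p)) \<longlonglongrightarrow> D * \<eta> powr (1 - p) * 0"
      by (intro tendsto_mult tendsto_const lim)
    then have "eventually (\<lambda>n. D * \<eta> powr (1 - p) * (LINT x|lborel. norm (f n x) powr p) < e / 2) sequentially"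
      using order_tendstoD(2)[of _ "0::real" sequentially "e / 2"] e by simp
    then obtain N where N: "\<And>n. n \<ge> N \<Longrightarrow> D * \<eta> powr (1 - p) * (LINT x|lborel. norm (f n x) powr p) < e / 2"
      by (auto simp: eventually_sequentially)
    show "\<exists>no. \<forall>n\<ge>no. norm ((LINT x|lborel. g n x) - 0) < e"
    proof (intro exI allI impI)
      fix n assume "n \<ge> N"
      from le[OF \<eta>, of n] N[OF this] 1 show "norm ((LINT x|lborel. g n x) - 0) < e" by simp
    qed
  qed
qed

section \<open>The space \<open>X_space\<close> as limits of test functions\<close>

definition in_Lp :: "real \<Rightarrow> ('a::euclidean_space \<Rightarrow> 'b::euclidean_space) \<Rightarrow> bool" where
  "in_Lp p f \<longleftrightarrow> f \<in> borel_measurable borel \<and> integrable lborel (\<lambda>x. norm (f x) powr p)"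

abbreviation int_powr :: "real \<Rightarrow> ('a::euclidean_space \<Rightarrow> 'b::euclidean_space) \<Rightarrow> real" where
  "int_powr p f \<equiv> (LINT x|lborel. norm (f x) powr p)"

text \<open>
  A pair of Borel functions, extended by \<open>0\<close> outside \<open>\<Omega>\<close>, that is a limit of test functions and
  their gradients. These pairs represent the elements of \<open>X_space p \<Omega>\<close> together with their
  weak gradients, without any choice of a gradient and without completed measures.
\<close>

definition test_limit ::
    "real \<Rightarrow> 'a::euclidean_space set \<Rightarrow> ('a \<Rightarrow> real) \<Rightarrow> ('a \<Rightarrow> 'a) \<Rightarrow> bool" where
  "test_limit p \<Omega> u G \<longleftrightarrow> in_Lp p u \<and> in_Lp p G \<and> (\<forall>x. x \<notin> \<Omega> \<longrightarrow> u x = 0 \<and> G x = 0) \<and>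
     (\<exists>\<phi>. (\<forall>k. \<phi> k \<in> test_functions \<Omega>) \<and>
       (\<lambda>k. int_powr p (\<lambda>x. \<phi> k x - u x)) \<longlonglongrightarrow> 0 \<and>
       (\<lambda>k. int_powr p (\<lambda>x. grad (\<phi> k) x - G x)) \<longlonglongrightarrow> 0)"

lemma in_LpD:
  assumes "in_Lp p f"
  shows "f \<in> borel_measurable borel" "integrable lborel (\<lambda>x. norm (f x) powr p)"
  using assms by (auto simp: in_Lp_def)

lemma in_Lp_diff: "p > 1 \<Longrightarrow> in_Lp p f \<Longrightarrow> in_Lp p g \<Longrightarrow> in_Lp p (\<lambda>x. f x - g x)"
  unfolding in_Lp_def by (intro conjI integrable_powr_diff) auto

lemma in_Lp_test:
  assumes "\<phi> \<in> test_functions \<Omega>" "p > 1"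
  shows "in_Lp p \<phi>" "in_Lp p (grad \<phi>)"
  using test_integrable(3,4)[OF assms(1), of p] borel_measurable_test[OF assms(1)] assms(2)
  by (auto simp: in_Lp_def)

lemma test_limitD:
  assumes "test_limit p \<Omega> u G"
  shows "in_Lp p u" "in_Lp p G" "\<And>x. x \<notin> \<Omega> \<Longrightarrow> u x = 0" "\<And>x. x \<notin> \<Omega> \<Longrightarrow> G x = 0"
  using assms by (auto simp: test_limit_def)

lemma test_limit_seq:
  assumes "test_limit p \<Omega> u G"
  shows "\<exists>\<phi>. (\<forall>k. \<phi> k \<in> test_functions \<Omega>) \<and>
       (\<lambda>k. int_powr p (\<lambda>x. \<phi> k x - u x)) \<longlonglongrightarrow> 0 \<and>
       (\<lambda>k. int_powr p (\<lambda>x. grad (\<phi> k) x - G x)) \<longlonglongrightarrow> 0"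
  using assms by (simp add: test_limit_def)

lemma integrable_dominated_bounded_support:
  fixes f :: "'a::euclidean_space \<Rightarrow> 'b::euclidean_space" and g :: "'a \<Rightarrow> 'c::euclidean_space"
  assumes "p > 1" "in_Lp p f" and [measurable]: "g \<in> borel_measurable borel"
    and b: "\<And>x. norm (g x) \<le> C * norm (f x)" "\<And>x. norm x > r \<Longrightarrow> g x = 0"
  shows "integrable lborel g"
proof (rule Bochner_Integration.integrable_bound)
  have "set_integrable lborel (cball 0 r) f"
    using in_LpD[OF assms(2)] by (intro set_integrable_bounded_set[OF assms(1)]) auto
  then show "integrable lborel (\<lambda>x. C *\<^sub>R (indicat_real (cball 0 r) x *\<^sub>R f x))"
    unfolding set_integrable_def by (rule integrable_scaleR_right)
  show "AE x in lborel. norm (g x) \<le> norm (C *\<^sub>R (indicat_real (cball 0 r) x *\<^sub>R f x))"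
  proof (rule AE_I2)
    fix x
    have "norm (g x) \<le> \<bar>C\<bar> * norm (f x)"
      using b(1)[of x] mult_right_mono[of C "\<bar>C\<bar>" "norm (f x)"] abs_ge_self[of C] norm_ge_zero[of "f x"]
      by linarith
    then show "norm (g x) \<le> norm (C *\<^sub>R (indicat_real (cball 0 r) x *\<^sub>R f x))"
      using b(2)[of x] by (auto simp: indicator_def)
  qed
qed simp

lemma LINT_lebesgue_borel:
  fixes f :: "'a::euclidean_space \<Rightarrow> 'b::euclidean_space"
  assumes [measurable]: "f \<in> borel_measurable borel" "S \<in> sets borel"
  shows "(LINT x:S|lebesgue. f x) = (LINT x|lborel. indicat_real S x *\<^sub>R f x)"
    and "set_integrable lebesgue S f \<longleftrightarrow> set_integrable lborel S f"
  unfolding set_lebesgue_integral_def set_integrable_def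
  by (auto intro!: integral_completion integrable_completion)

lemma LINT_lebesgue_cong_AE_measurable:
  fixes f g :: "'a::euclidean_space \<Rightarrow> 'b::euclidean_space"
  assumes "set_borel_measurable lebesgue S f" and g[measurable]: "g \<in> borel_measurable borel"
    and z: "\<And>x. x \<notin> S \<Longrightarrow> g x = 0" and ae: "AE x in lborel. x \<in> S \<longrightarrow> f x = g x"
  shows "(LINT x:S|lebesgue. f x) = (LINT x|lborel. g x)"
proof -
  have "(LINT x:S|lebesgue. f x) = (LINT x|lebesgue. g x)"
    unfolding set_lebesgue_integral_def
  proof (rule integral_cong_AE)
    show "AE x in lebesgue. indicat_real S x *\<^sub>R f x = g x"
      unfolding AE_lebesgue_iff using ae by (rule AE_mp) (auto simp: indicator_def z intro!: AE_I2)
  qed (use assms(1) measurable_lebesgue[OF g] in \<open>auto simp: set_borel_measurable_def\<close>)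
  then show ?thesis by (simp add: integral_completion)
qed

text \<open>
  Integration by parts is stable under \<open>L\<^sup>p\<close> limits of the function and its gradient. The set
  \<open>S\<close> is \<open>\<Omega>\<close> or the whole space, since membership in \<open>X_space\<close> asks for both.
\<close>

lemma has_weak_gradient_test_limit:
  fixes v :: "'a::euclidean_space \<Rightarrow> real"
  assumes "p > 1" "\<Omega> \<subseteq> S" and [measurable]: "S \<in> sets borel" and v: "test_limit p \<Omega> v G"
  shows "has_weak_gradient S v G"
  unfolding has_weak_gradient_def
proof (intro conjI allI impI ballI)
  note [measurable] = in_LpD(1)[OF test_limitD(1)[OF v]] in_LpD(1)[OF test_limitD(2)[OF v]]
  note int = in_LpD(2)[OF test_limitD(1)[OF v]] in_LpD(2)[OF test_limitD(2)[OF v]]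
  show "set_integrable lebesgue K v" "set_integrable lebesgue K G" if "compact K \<and> K \<subseteq> S" for K
  proof -
    have K: "K \<in> sets borel" "bounded K"
      using that by (auto intro: borel_compact compact_imp_bounded)
    show "set_integrable lebesgue K v" "set_integrable lebesgue K G"
      by (subst LINT_lebesgue_borel(2); use K in \<open>auto intro!: set_integrable_bounded_set[OF \<open>p > 1\<close>] int\<close>)+
  qed
  fix \<psi> assume \<psi>: "\<psi> \<in> test_functions S"
  note [measurable] = borel_measurable_test[OF \<psi>]
  obtain r C where "test_bounds \<psi> r C" using test_bounded[OF \<psi>] by blast
  note C = test_boundsD[OF this]
  obtain \<phi> where \<phi>: "\<And>k. \<phi> k \<in> test_functions \<Omega>"
      "(\<lambda>k. int_powr p (\<lambda>x. \<phi> k x - v x)) \<longlonglongrightarrow> 0"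
      "(\<lambda>k. int_powr p (\<lambda>x. grad (\<phi> k) x - G x)) \<longlonglongrightarrow> 0"
    using test_limit_seq[OF v] by auto
  note [measurable] = borel_measurable_test[OF \<phi>(1)]
  have d: "integrable lborel (\<lambda>x. norm (\<phi> k x - v x) powr p)"
    "integrable lborel (\<lambda>x. norm (grad (\<phi> k) x - G x) powr p)" for k
    using in_LpD(2)[OF in_Lp_diff[OF \<open>p > 1\<close> in_Lp_test(1)[OF \<phi>(1)[of k] \<open>p > 1\<close>] test_limitD(1)[OF v]]]
      in_LpD(2)[OF in_Lp_diff[OF \<open>p > 1\<close> in_Lp_test(2)[OF \<phi>(1)[of k] \<open>p > 1\<close>] test_limitD(2)[OF v]]]
    by auto
  define a where "a k x = (\<phi> k x - v x) *\<^sub>R grad \<psi> x" for k x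
  define b where "b k x = \<psi> x *\<^sub>R (grad (\<phi> k) x - G x)" for k x
  have [measurable]: "a k \<in> borel_measurable borel" "b k \<in> borel_measurable borel" for k
    unfolding a_def b_def by measurable
  have ab: "norm (a k x) \<le> C * norm (\<phi> k x - v x)" "norm (b k x) \<le> C * norm (grad (\<phi> k) x - G x)" for k x
  proof -
    have "\<bar>\<phi> k x - v x\<bar> * norm (grad \<psi> x) \<le> \<bar>\<phi> k x - v x\<bar> * C"
      by (rule mult_left_mono[OF C(4)]) simp
    then show "norm (a k x) \<le> C * norm (\<phi> k x - v x)" by (simp add: a_def mult.commute)
    show "norm (b k x) \<le> C * norm (grad (\<phi> k) x - G x)"
      unfolding b_def norm_scaleR by (rule mult_right_mono[OF C(3)]) simp
  qed
  have ab0: "a k x = 0" "b k x = 0" if "norm x > r" for k x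
    using C(5,6)[OF that] by (simp_all add: a_def b_def)
  have la: "(\<lambda>k. LINT x|lborel. a k x) \<longlonglongrightarrow> 0" "integrable lborel (a k)" for k
    by (rule powr_integral_tendsto_0_bounded_support[OF \<open>p > 1\<close> _ _ d(1) \<phi>(2) ab(1) ab0(1)]; measurable)+
  have lb: "(\<lambda>k. LINT x|lborel. b k x) \<longlonglongrightarrow> 0" "integrable lborel (b k)" for k
    by (rule powr_integral_tendsto_0_bounded_support[OF \<open>p > 1\<close> _ _ d(2) \<phi>(3) ab(2) ab0(2)]; measurable)+
  have iv: "integrable lborel (\<lambda>x. v x *\<^sub>R grad \<psi> x)"
    by (rule integrable_dominated_bounded_support[OF \<open>p > 1\<close> test_limitD(1)[OF v], where C = C and r = r])
      (use C(6) mult_left_mono[OF C(4), of "\<bar>v _\<bar>"] in \<open>auto simp: mult.commute\<close>)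
  have iG: "integrable lborel (\<lambda>x. \<psi> x *\<^sub>R G x)"
    by (rule integrable_dominated_bounded_support[OF \<open>p > 1\<close> test_limitD(2)[OF v], where C = C and r = r])
      (use C(5) mult_right_mono[OF C(3)] in auto)
  have "(LINT x|lborel. a k x) + (LINT x|lborel. v x *\<^sub>R grad \<psi> x)
      = - ((LINT x|lborel. b k x) + (LINT x|lborel. \<psi> x *\<^sub>R G x))" for k
  proof -
    have "(LINT x|lborel. a k x) + (LINT x|lborel. v x *\<^sub>R grad \<psi> x) = (LINT x|lborel. \<phi> k x *\<^sub>R grad \<psi> x)"
      by (subst Bochner_Integration.integral_add[symmetric, OF la(2) iv])
        (simp add: a_def scaleR_diff_left)
    moreover have "(LINT x|lborel. b k x) + (LINT x|lborel. \<psi> x *\<^sub>R G x) = (LINT x|lborel. \<psi> x *\<^sub>R grad (\<phi> k) x)"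
      by (subst Bochner_Integration.integral_add[symmetric, OF lb(2) iG])
        (simp add: b_def scaleR_diff_right)
    ultimately show ?thesis using integration_by_parts_test[OF \<phi>(1) \<psi>, of k] by simp
  qed
  moreover have "(\<lambda>k. (LINT x|lborel. a k x) + (LINT x|lborel. v x *\<^sub>R grad \<psi> x))
      \<longlonglongrightarrow> 0 + (LINT x|lborel. v x *\<^sub>R grad \<psi> x)"
    by (intro tendsto_add la tendsto_const)
  moreover have "(\<lambda>k. - ((LINT x|lborel. b k x) + (LINT x|lborel. \<psi> x *\<^sub>R G x)))
      \<longlonglongrightarrow> - (0 + (LINT x|lborel. \<psi> x *\<^sub>R G x))"
    by (intro tendsto_minus tendsto_add lb tendsto_const)
  ultimately have "0 + (LINT x|lborel. v x *\<^sub>R grad \<psi> x) = - (0 + (LINT x|lborel. \<psi> x *\<^sub>R G x))"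
    using LIMSEQ_unique by (simp only:)
  then have eq: "(LINT x|lborel. v x *\<^sub>R grad \<psi> x) = - (LINT x|lborel. \<psi> x *\<^sub>R G x)" by simp
  have "indicat_real S x *\<^sub>R v x *\<^sub>R grad \<psi> x = v x *\<^sub>R grad \<psi> x" "indicat_real S x *\<^sub>R \<psi> x *\<^sub>R G x = \<psi> x *\<^sub>R G x" for x
    using test_limitD(3)[OF v, of x] test_limitD(4)[OF v, of x] \<open>\<Omega> \<subseteq> S\<close> by (auto simp: indicator_def)
  then show "(LINT x:S|lebesgue. v x *\<^sub>R grad \<psi> x) = - (LINT x:S|lebesgue. \<psi> x *\<^sub>R G x)"
    by (simp only: LINT_lebesgue_borel(1)[of "\<lambda>x. v x *\<^sub>R grad \<psi> x"] LINT_lebesgue_borel(1)[of "\<lambda>x. \<psi> x *\<^sub>R G x"] eq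
        borel_measurable_scaleR in_LpD(1)[OF test_limitD(1)[OF v]] in_LpD(1)[OF test_limitD(2)[OF v]]
        borel_measurable_test[OF \<psi>] assms(3))
qed

lemma in_Lp_imp_Lp:
  assumes "in_Lp p f" and [measurable]: "S \<in> sets borel"
  shows "f \<in> Lp p S"
proof -
  note [measurable] = in_LpD(1)[OF assms(1)]
  have "set_integrable lborel S (\<lambda>x. norm (f x) powr p)"
    unfolding set_integrable_def by (intro integrable_mult_indicator in_LpD(2)[OF assms(1)]) simp
  then show ?thesis
    unfolding Lp_def set_borel_measurable_def
    by (auto simp: LINT_lebesgue_borel(2) intro!: measurable_lebesgue)
qed

lemma weak_grad_eq:
  assumes "open \<Omega>" "has_weak_gradient \<Omega> u G"
  shows "AE x in lborel. x \<in> \<Omega> \<longrightarrow> weak_grad \<Omega> u x = G x"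
proof -
  have "has_weak_gradient \<Omega> u (weak_grad \<Omega> u)"
    unfolding weak_grad_def by (rule someI[of "has_weak_gradient \<Omega> u", OF assms(2)])
  from weak_gradient_unique[OF assms(1) this assms(2)] show ?thesis by (simp add: AE_lebesgue_iff)
qed

lemma test_limit_weak_grad:
  assumes "p > 1" "open \<Omega>" "test_limit p \<Omega> v G"
  shows "AE x in lborel. x \<in> \<Omega> \<longrightarrow> weak_grad \<Omega> v x = G x"
  by (rule weak_grad_eq[OF assms(2) has_weak_gradient_test_limit[OF assms(1) subset_refl _ assms(3)]])
    (use assms(2) in auto)

lemma LINT_lebesgue_cong_AE:
  fixes f g :: "'a::euclidean_space \<Rightarrow> 'b::euclidean_space"
  assumes g[measurable]: "g \<in> borel_measurable borel"
    and z: "\<And>x. x \<notin> S \<Longrightarrow> g x = 0" and ae: "AE x in lborel. x \<in> S \<longrightarrow> f x = g x"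
  shows "(LINT x:S|lebesgue. f x) = (LINT x|lborel. g x)"
proof (rule LINT_lebesgue_cong_AE_measurable[OF _ g z ae])
  show "set_borel_measurable lebesgue S f"
    unfolding set_borel_measurable_def
  proof (rule borel_measurable_AE[OF measurable_lebesgue[OF g]])
    show "AE x in lebesgue. g x = indicat_real S x *\<^sub>R f x"
      unfolding AE_lebesgue_iff using ae by (rule AE_mp) (auto simp: indicator_def z intro!: AE_I2)
  qed
qed

text \<open>
  The link between an element \<open>u\<close> of \<open>X_space\<close>, which is only Lebesgue measurable, and the Borel
  pair on which the analysis is carried out.
\<close>

definition represents ::
    "real \<Rightarrow> 'a::euclidean_space set \<Rightarrow> ('a \<Rightarrow> real) \<Rightarrow> ('a \<Rightarrow> real) \<Rightarrow> ('a \<Rightarrow> 'a) \<Rightarrow> bool" where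
  "represents p \<Omega> u u0 G \<longleftrightarrow> test_limit p \<Omega> u0 G \<and> (AE x in lborel. u x = u0 x) \<and>
     (AE x in lborel. x \<in> \<Omega> \<longrightarrow> weak_grad \<Omega> u x = G x)"

lemma test_limit_imp_X_space:
  assumes "p > 1" "open \<Omega>" and v: "test_limit p \<Omega> v G"
  shows "v \<in> X_space p \<Omega>"
proof -
  note m [measurable] = in_LpD(1)[OF test_limitD(1)[OF v]] in_LpD(1)[OF test_limitD(2)[OF v]]
  have [measurable]: "\<Omega> \<in> sets borel" using \<open>open \<Omega>\<close> by simp
  have W: "v \<in> W1p p S" if "\<Omega> \<subseteq> S" "S \<in> sets borel" for S
    using in_Lp_imp_Lp[OF test_limitD(1)[OF v] that(2)] in_Lp_imp_Lp[OF test_limitD(2)[OF v] that(2)]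
      has_weak_gradient_test_limit[OF \<open>p > 1\<close> that v]
    unfolding W1p_def by blast
  obtain \<phi> where \<phi>: "\<And>k. \<phi> k \<in> test_functions \<Omega>"
      "(\<lambda>k. int_powr p (\<lambda>x. \<phi> k x - v x)) \<longlonglongrightarrow> 0"
      "(\<lambda>k. int_powr p (\<lambda>x. grad (\<phi> k) x - G x)) \<longlonglongrightarrow> 0"
    using test_limit_seq[OF v] by auto
  note [measurable] = borel_measurable_test[OF \<phi>(1)]
  note wg = test_limit_weak_grad[OF assms]
  have 1: "(LINT x:\<Omega>|lebesgue. norm (grad (\<phi> k) x - weak_grad \<Omega> v x) powr p)
      = int_powr p (\<lambda>x. grad (\<phi> k) x - G x)" for k
  proof (rule LINT_lebesgue_cong_AE)
    show "AE x in lborel. x \<in> \<Omega> \<longrightarrow>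
        norm (grad (\<phi> k) x - weak_grad \<Omega> v x) powr p = norm (grad (\<phi> k) x - G x) powr p"
      using wg by (rule AE_mp) (auto intro!: AE_I2)
  qed (auto simp: test_limitD(4)[OF v] test_outside(2)[OF \<phi>(1)])
  have 2: "(LINT x:\<Omega>|lebesgue. \<bar>\<phi> k x - v x\<bar> powr p) = int_powr p (\<lambda>x. \<phi> k x - v x)" for k
    by (rule LINT_lebesgue_cong_AE) (auto simp: test_limitD(3)[OF v] test_outside(1)[OF \<phi>(1)])
  have "v \<in> W01p p \<Omega>"
    unfolding W01p_def using W[of \<Omega>] \<phi> by (auto intro!: exI[of _ \<phi>] simp: 1 2)
  then show ?thesis
    unfolding X_space_def using W[of UNIV] test_limitD(3)[OF v] by auto
qed

lemma test_limit_represents: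
  assumes "p > 1" "open \<Omega>" "test_limit p \<Omega> v G"
  shows "represents p \<Omega> v v G"
  unfolding represents_def using assms test_limit_weak_grad[OF assms] by simp

lemma borel_version:
  fixes f :: "'a::euclidean_space \<Rightarrow> 'b::euclidean_space"
  assumes S: "S \<in> sets borel" and f: "f \<in> Lp p S"
  shows "\<exists>g. in_Lp p g \<and> (\<forall>x. x \<notin> S \<longrightarrow> g x = 0) \<and> (AE x in lborel. x \<in> S \<longrightarrow> f x = g x)"
proof -
  note [measurable] = S
  have fm: "(\<lambda>x. indicat_real S x *\<^sub>R f x) \<in> borel_measurable lebesgue"
    and fi: "integrable lebesgue (\<lambda>x. indicat_real S x *\<^sub>R norm (f x) powr p)"
    using f by (auto simp: Lp_def set_borel_measurable_def set_integrable_def)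
  have "\<exists>h\<in>borel_measurable lborel. AE x in lborel. indicat_real S x *\<^sub>R f x = h x"
    by (rule completion_ex_borel_measurable_euclidean[OF fm])
  then obtain h where h [measurable]: "h \<in> borel_measurable borel"
    and ae: "AE x in lborel. indicat_real S x *\<^sub>R f x = h x" by auto
  define g where "g x = indicat_real S x *\<^sub>R h x" for x
  have gm [measurable]: "g \<in> borel_measurable borel" unfolding g_def by measurable
  have ae': "AE x in lborel. x \<in> S \<longrightarrow> f x = g x"
    using ae by (rule AE_mp) (auto simp: g_def intro!: AE_I2)
  have "integrable lebesgue (\<lambda>x. norm (g x) powr p)"
  proof (rule integrable_cong_AE_imp[OF fi])
    show "(\<lambda>x. norm (g x) powr p) \<in> borel_measurable lebesgue" by (rule measurable_lebesgue) measurable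
    show "AE x in lebesgue. indicat_real S x *\<^sub>R norm (f x) powr p = norm (g x) powr p"
      unfolding AE_lebesgue_iff using ae' by (rule AE_mp) (auto simp: g_def indicator_def intro!: AE_I2)
  qed
  then have "in_Lp p g" unfolding in_Lp_def by (auto simp: integrable_completion)
  with ae' show ?thesis by (intro exI[of _ g]) (auto simp: g_def)
qed

text \<open>
  The approximating test functions supplied by \<open>W01p\<close> serve unchanged, because uniqueness of the
  weak gradient replaces \<open>weak_grad\<close> in the convergence by a Borel function in \<open>L\<^sup>p\<close>.
\<close>

lemma X_space_represents:
  assumes "p > 1" "open \<Omega>" and u: "u \<in> X_space p \<Omega>"
  shows "\<exists>u0 G. represents p \<Omega> u u0 G"
proof -
  have [measurable]: "\<Omega> \<in> sets borel" using \<open>open \<Omega>\<close> by simp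
  have uW: "u \<in> W01p p \<Omega>" and uz: "AE x in lborel. x \<notin> \<Omega> \<longrightarrow> u x = 0"
    using u by (auto simp: X_space_def AE_lebesgue_iff)
  obtain H where H: "has_weak_gradient \<Omega> u H" "H \<in> Lp p \<Omega>" and uL: "u \<in> Lp p \<Omega>"
    using uW by (auto simp: W01p_def W1p_def)
  obtain u0 where u0: "in_Lp p u0" "\<And>x. x \<notin> \<Omega> \<Longrightarrow> u0 x = 0" "AE x in lborel. x \<in> \<Omega> \<longrightarrow> u x = u0 x"
    using borel_version[OF _ uL] by auto
  obtain G where G: "in_Lp p G" "\<And>x. x \<notin> \<Omega> \<Longrightarrow> G x = 0" "AE x in lborel. x \<in> \<Omega> \<longrightarrow> H x = G x"
    using borel_version[OF _ H(2)] by auto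
  note [measurable] = in_LpD(1)[OF u0(1)] in_LpD(1)[OF G(1)]
  have wg: "AE x in lborel. x \<in> \<Omega> \<longrightarrow> weak_grad \<Omega> u x = G x"
    using weak_grad_eq[OF \<open>open \<Omega>\<close> H(1)] G(3) by eventually_elim auto
  obtain \<phi> where \<phi>: "\<And>k. \<phi> k \<in> test_functions \<Omega>"
     "(\<lambda>k. LINT x:\<Omega>|lebesgue. norm (grad (\<phi> k) x - weak_grad \<Omega> u x) powr p) \<longlonglongrightarrow> 0"
     "(\<lambda>k. LINT x:\<Omega>|lebesgue. \<bar>\<phi> k x - u x\<bar> powr p) \<longlonglongrightarrow> 0"
    using uW by (auto simp: W01p_def)
  note [measurable] = borel_measurable_test[OF \<phi>(1)]
  have 1: "(LINT x:\<Omega>|lebesgue. norm (grad (\<phi> k) x - weak_grad \<Omega> u x) powr p)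
      = int_powr p (\<lambda>x. grad (\<phi> k) x - G x)" for k
  proof (rule LINT_lebesgue_cong_AE)
    show "AE x in lborel. x \<in> \<Omega> \<longrightarrow>
        norm (grad (\<phi> k) x - weak_grad \<Omega> u x) powr p = norm (grad (\<phi> k) x - G x) powr p"
      using wg by (rule AE_mp) (auto intro!: AE_I2)
  qed (auto simp: G(2) test_outside(2)[OF \<phi>(1)])
  have 2: "(LINT x:\<Omega>|lebesgue. \<bar>\<phi> k x - u x\<bar> powr p) = int_powr p (\<lambda>x. \<phi> k x - u0 x)" for k
  proof (rule LINT_lebesgue_cong_AE)
    show "AE x in lborel. x \<in> \<Omega> \<longrightarrow> \<bar>\<phi> k x - u x\<bar> powr p = norm (\<phi> k x - u0 x) powr p"
      using u0(3) by (rule AE_mp) (auto intro!: AE_I2)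
  qed (auto simp: u0(2) test_outside(1)[OF \<phi>(1)])
  have "test_limit p \<Omega> u0 G"
    unfolding test_limit_def using u0 G \<phi>(2,3) unfolding 1 2 by (auto intro!: exI[of _ \<phi>] \<phi>(1))
  moreover have "AE x in lborel. u x = u0 x"
    using u0(3) uz by eventually_elim (use u0(2) in auto)
  ultimately show ?thesis using wg unfolding represents_def by blast
qed

lemma test_limit_test:
  assumes "p > 1" "\<phi> \<in> test_functions \<Omega>"
  shows "test_limit p \<Omega> \<phi> (grad \<phi>)"
  unfolding test_limit_def
  using in_Lp_test[OF assms(2,1)] test_outside[OF assms(2)] assms by (auto intro!: exI[of _ "\<lambda>_. \<phi>"])

lemma test_limit_diff_test:
  assumes p: "p > 1" and u: "test_limit p \<Omega> u G" and \<psi>: "\<psi> \<in> test_functions \<Omega>"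
  shows "test_limit p \<Omega> (\<lambda>x. \<psi> x - u x) (\<lambda>x. grad \<psi> x - G x)"
proof -
  obtain \<phi> where \<phi>: "\<And>k. \<phi> k \<in> test_functions \<Omega>"
      "(\<lambda>k. int_powr p (\<lambda>x. \<phi> k x - u x)) \<longlonglongrightarrow> 0"
      "(\<lambda>k. int_powr p (\<lambda>x. grad (\<phi> k) x - G x)) \<longlonglongrightarrow> 0"
    using test_limit_seq[OF u] by auto
  have "(\<lambda>x. \<psi> x - \<phi> k x) \<in> test_functions \<Omega>" for k by (rule test_diff[OF \<psi> \<phi>(1)])
  moreover have "norm (\<psi> x - \<phi> k x - (\<psi> x - u x)) = norm (\<phi> k x - u x)" for k x
    by (simp add: abs_minus_commute)
  moreover have "norm (grad (\<lambda>x. \<psi> x - \<phi> k x) x - (grad \<psi> x - G x)) = norm (grad (\<phi> k) x - G x)" for k x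
    by (subst grad_diff) (simp_all add: test_differentiable[OF \<psi>] test_differentiable[OF \<phi>(1)] norm_minus_commute)
  ultimately show ?thesis
    unfolding test_limit_def
    using \<phi>(2,3) test_outside[OF \<psi>]
    by (auto intro!: exI[of _ "\<lambda>k x. \<psi> x - \<phi> k x"] in_Lp_diff p in_Lp_test[OF \<psi> p] test_limitD[OF u]
        simp: test_limitD(3,4)[OF u])
qed

lemma test_limit_cmult:
  assumes p: "p > 1" and u: "test_limit p \<Omega> u G"
  shows "test_limit p \<Omega> (\<lambda>x. c * u x) (\<lambda>x. c *\<^sub>R G x)"
proof -
  note [measurable] = in_LpD(1)[OF test_limitD(1)[OF u]] in_LpD(1)[OF test_limitD(2)[OF u]]
  obtain \<phi> where \<phi>: "\<And>k. \<phi> k \<in> test_functions \<Omega>"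
      "(\<lambda>k. int_powr p (\<lambda>x. \<phi> k x - u x)) \<longlonglongrightarrow> 0"
      "(\<lambda>k. int_powr p (\<lambda>x. grad (\<phi> k) x - G x)) \<longlonglongrightarrow> 0"
    using test_limit_seq[OF u] by auto
  have t: "(\<lambda>x. c * \<phi> k x) \<in> test_functions \<Omega>" for k
    by (rule test_I[OF Ck_cmult[OF test_Ck[OF \<phi>(1)[of k]]] \<phi>(1)[of k]]) simp
  have g: "grad (\<lambda>x. c * \<phi> k x) x = c *\<^sub>R grad (\<phi> k) x" for k x
    by (rule grad_chain[OF test_differentiable[OF \<phi>(1)]]) (auto intro!: derivative_eq_intros)
  have 1: "norm (c * \<phi> k x - c * u x) powr p = \<bar>c\<bar> powr p * norm (\<phi> k x - u x) powr p" for k x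
    by (simp add: right_diff_distrib[symmetric] abs_mult powr_mult)
  have 2: "norm (c *\<^sub>R grad (\<phi> k) x - c *\<^sub>R G x) powr p = \<bar>c\<bar> powr p * norm (grad (\<phi> k) x - G x) powr p" for k x
    by (simp add: scaleR_diff_right[symmetric] powr_mult)
  have "(\<lambda>k. int_powr p (\<lambda>x. c * \<phi> k x - c * u x)) \<longlonglongrightarrow> 0"
    unfolding 1 using tendsto_mult[OF tendsto_const \<phi>(2)] by simp
  moreover have "(\<lambda>k. int_powr p (\<lambda>x. grad (\<lambda>x. c * \<phi> k x) x - c *\<^sub>R G x)) \<longlonglongrightarrow> 0"
    unfolding g 2 using tendsto_mult[OF tendsto_const \<phi>(3)] by simp
  moreover have "in_Lp p (\<lambda>x. c * u x)" "in_Lp p (\<lambda>x. c *\<^sub>R G x)"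
    using in_LpD(2)[OF test_limitD(1)[OF u]] in_LpD(2)[OF test_limitD(2)[OF u]]
    by (auto simp: in_Lp_def powr_mult abs_mult)
  ultimately show ?thesis
    unfolding test_limit_def
    by (auto intro!: exI[of _ "\<lambda>k x. c * \<phi> k x"] t simp: test_limitD(3,4)[OF u])
qed

lemma integral_norm_powr_cong_AE:
  assumes "AE x in lborel. f x = g x" "f \<in> borel_measurable borel" "g \<in> borel_measurable borel"
  shows "int_powr p f = int_powr p g"
proof (rule integral_cong_AE)
  show "AE x in lborel. norm (f x) powr p = norm (g x) powr p"
    using assms(1) by (rule AE_mp) (auto intro!: AE_I2)
qed (use assms in auto)

lemma test_limit_cong_AE:
  assumes u: "test_limit p \<Omega> u G" and [measurable]: "u' \<in> borel_measurable borel"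
    and z: "\<And>x. x \<notin> \<Omega> \<Longrightarrow> u' x = 0" and ae: "AE x in lborel. u x = u' x"
  shows "test_limit p \<Omega> u' G"
proof -
  note [measurable] = in_LpD(1)[OF test_limitD(1)[OF u]] in_LpD(1)[OF test_limitD(2)[OF u]]
  obtain \<phi> where \<phi>: "\<And>k. \<phi> k \<in> test_functions \<Omega>"
      "(\<lambda>k. int_powr p (\<lambda>x. \<phi> k x - u x)) \<longlonglongrightarrow> 0"
      "(\<lambda>k. int_powr p (\<lambda>x. grad (\<phi> k) x - G x)) \<longlonglongrightarrow> 0"
    using test_limit_seq[OF u] by auto
  note [measurable] = borel_measurable_test(1)[OF \<phi>(1)]
  have "int_powr p (\<lambda>x. \<phi> k x - u' x) = int_powr p (\<lambda>x. \<phi> k x - u x)" for k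
  proof (rule integral_norm_powr_cong_AE)
    show "AE x in lborel. \<phi> k x - u' x = \<phi> k x - u x"
      using ae by (rule AE_mp) (auto intro!: AE_I2)
  qed simp_all
  moreover have "in_Lp p u'"
    unfolding in_Lp_def
  proof (intro conjI integrable_cong_AE_imp[OF in_LpD(2)[OF test_limitD(1)[OF u]]])
    show "AE x in lborel. norm (u x) powr p = norm (u' x) powr p"
      using ae by (rule AE_mp) (auto intro!: AE_I2)
  qed simp_all
  ultimately show ?thesis
    unfolding test_limit_def using \<phi> z test_limitD[OF u] by (auto intro!: exI[of _ \<phi>])
qed

section \<open>Finiteness of the Gagliardo seminorm\<close>

text \<open>
  Power singularities are estimated by a step function on dyadic balls, whose integral is a
  geometric series.
\<close>

lemma nn_integral_finite_if_le_on_balls: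
  fixes f :: "'a::euclidean_space \<Rightarrow> ennreal" and c r :: "nat \<Rightarrow> real"
  assumes c: "\<And>k. c k \<ge> 0" "\<And>k. r k \<ge> 0" and s: "summable (\<lambda>k. c k * r k ^ DIM('a))"
    and f: "\<And>x. f x = 0 \<or> (\<exists>k. norm x \<le> r k \<and> f x \<le> ennreal (c k))"
  shows "(\<integral>\<^sup>+ x. f x \<partial>lborel) < \<infinity>"
proof -
  have le: "f x \<le> (\<Sum>k. ennreal (c k) * indicator (cball 0 (r k)) x)" for x
  proof (cases "f x = 0")
    case False
    then obtain k where k: "norm x \<le> r k" "f x \<le> ennreal (c k)" using f by blast
    have "f x \<le> (\<Sum>j\<in>{k}. ennreal (c j) * indicator (cball 0 (r j)) x)" using k by simp
    also have "\<dots> \<le> (\<Sum>k. ennreal (c k) * indicator (cball 0 (r k)) x)"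
      by (rule sum_le_suminf) auto
    finally show ?thesis .
  qed simp
  have [measurable]: "cball (0::'a) (r k) \<in> sets borel" for k by simp
  let ?V = "unit_ball_vol (real DIM('a))"
  have "(\<integral>\<^sup>+ x. f x \<partial>lborel) \<le> (\<integral>\<^sup>+ x. (\<Sum>k. ennreal (c k) * indicator (cball (0::'a) (r k)) x) \<partial>lborel)"
    by (rule nn_integral_mono[OF le])
  also have "\<dots> = (\<Sum>k. \<integral>\<^sup>+ x. ennreal (c k) * indicator (cball (0::'a) (r k)) x \<partial>lborel)"
    by (rule nn_integral_suminf) measurable
  also have "\<dots> = (\<Sum>k. ennreal (?V * (c k * r k ^ DIM('a))))"
  proof (rule suminf_cong)
    fix k
    have "(\<integral>\<^sup>+ x. ennreal (c k) * indicator (cball (0::'a) (r k)) x \<partial>lborel)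
        = ennreal (c k) * emeasure lborel (cball (0::'a) (r k))"
      by (rule nn_integral_cmult_indicator) simp
    also have "\<dots> = ennreal (c k) * ennreal (?V * r k ^ DIM('a))"
      by (simp add: emeasure_cball c)
    also have "\<dots> = ennreal (?V * (c k * r k ^ DIM('a)))"
      using c by (simp add: ennreal_mult[symmetric] mult.left_commute)
    finally show "(\<integral>\<^sup>+ x. ennreal (c k) * indicator (cball (0::'a) (r k)) x \<partial>lborel)
        = ennreal (?V * (c k * r k ^ DIM('a)))" .
  qed
  also have "\<dots> < \<infinity>"
  proof -
    have "0 \<le> ?V * (c k * r k ^ DIM('a))" for k
      by (intro mult_nonneg_nonneg zero_le_power c unit_ball_vol_nonneg) simp
    from ennreal_suminf_neq_top[OF summable_mult[OF s, of ?V] this] show ?thesis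
      by (simp only: infinity_ennreal_def less_top)
  qed
  finally show ?thesis .
qed

lemma ex_power_two_interval:
  fixes y :: real
  assumes "y \<ge> 1"
  shows "\<exists>k. 2 ^ k \<le> y \<and> y < 2 ^ Suc k"
proof -
  define n where "n = (LEAST n. y < 2 ^ n)"
  have ex: "\<exists>n. y < 2 ^ n" using real_arch_pow[of 2 y] by simp
  have n: "y < 2 ^ n" unfolding n_def using ex by (rule LeastI_ex)
  then have "n \<noteq> 0" using assms by (cases n) auto
  then obtain k where k: "n = Suc k" by (cases n) auto
  have "\<not> y < 2 ^ k" using not_less_Least[of k "\<lambda>n. y < 2 ^ n"] k by (simp add: n_def)
  then show ?thesis using n k by (intro exI[of _ k]) auto
qed

lemma powr_two_power: "((2::real) ^ k) powr a = (2 powr a) ^ k"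
  by (simp add: powr_realpow[symmetric] powr_powr mult.commute)

lemma nn_integral_powr_inside:
  fixes a R :: real
  assumes a: "0 < a" "a < real DIM('a)" and R: "R > 0"
  shows "(\<integral>\<^sup>+ x. ennreal (indicator (cball (0::'a::euclidean_space) R) x / norm x powr a) \<partial>lborel) < \<infinity>"
proof (rule nn_integral_finite_if_le_on_balls)
  define c where "c k = ((2 powr a) ^ Suc k) / R powr a" for k :: nat
  define r where "r k = R / 2 ^ k" for k :: nat
  show "c k \<ge> 0" "r k \<ge> 0" for k using R by (auto simp: c_def r_def)
  have "c k * r k ^ DIM('a) = (2 powr a / R powr a * R ^ DIM('a)) * (2 powr a / 2 ^ DIM('a)) ^ k" for k
    by (simp add: c_def r_def power_divide power_mult[symmetric] mult.commute[of k])
  moreover have "2 powr a < 2 ^ DIM('a)"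
    using a by (simp add: powr_realpow[symmetric])
  ultimately show "summable (\<lambda>k. c k * r k ^ DIM('a))"
    by (simp add: summable_mult summable_geometric)
  fix x :: 'a
  show "ennreal (indicator (cball 0 R) x / norm x powr a) = 0 \<or>
      (\<exists>k. norm x \<le> r k \<and> ennreal (indicator (cball 0 R) x / norm x powr a) \<le> ennreal (c k))"
  proof (cases "x = 0 \<or> norm x > R")
    case True
    then show ?thesis by auto
  next
    case False
    then have x: "0 < norm x" "norm x \<le> R" by auto
    then have "R / norm x \<ge> 1" by simp
    from ex_power_two_interval[OF this] obtain k where k: "2 ^ k \<le> R / norm x" "R / norm x < 2 ^ Suc k" by blast
    have "norm x \<le> r k" using k(1) x by (simp add: r_def field_simps)
    moreover have "1 / norm x powr a \<le> c k"
    proof -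
      have "1 / norm x \<le> 2 ^ Suc k / R" using k(2) x R by (simp add: field_simps)
      then have "(1 / norm x) powr a \<le> (2 ^ Suc k / R) powr a" using a x by (intro powr_mono2) auto
      then show ?thesis using x R by (simp add: c_def powr_divide powr_two_power powr_mult)
    qed
    ultimately show ?thesis using x by (auto intro!: exI[of _ k] ennreal_leI)
  qed
qed

lemma nn_integral_powr_outside:
  fixes a :: real
  assumes a: "a > real DIM('a)"
  shows "(\<integral>\<^sup>+ x. ennreal (indicator {x::'a::euclidean_space. norm x > 1} x / norm x powr a) \<partial>lborel) < \<infinity>"
proof (rule nn_integral_finite_if_le_on_balls)
  define c where "c k = 1 / (2 powr a) ^ k" for k :: nat
  define r where "r k = (2::real) ^ Suc k" for k :: nat
  show "c k \<ge> 0" "r k \<ge> 0" for k by (auto simp: c_def r_def)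
  have "c k * r k ^ DIM('a) = 2 ^ DIM('a) * (2 ^ DIM('a) / 2 powr a) ^ k" for k
    by (simp add: c_def r_def power_divide power_mult[symmetric] power_mult_distrib mult.commute[of k])
  moreover have "2 powr a > 2 ^ DIM('a)"
    using a by (simp add: powr_realpow[symmetric])
  ultimately show "summable (\<lambda>k. c k * r k ^ DIM('a))"
    by (simp add: summable_mult summable_geometric)
  fix x :: 'a
  show "ennreal (indicator {x. norm x > 1} x / norm x powr a) = 0 \<or>
      (\<exists>k. norm x \<le> r k \<and> ennreal (indicator {x. norm x > 1} x / norm x powr a) \<le> ennreal (c k))"
  proof (cases "norm x > 1")
    case False
    then show ?thesis by auto
  next
    case True
    from ex_power_two_interval[of "norm x"] obtain k where k: "2 ^ k \<le> norm x" "norm x < 2 ^ Suc k"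
      using True by auto
    have "(2 powr a) ^ k \<le> norm x powr a"
      unfolding powr_two_power[symmetric] using k(1) a by (intro powr_mono2) auto
    then have "1 / norm x powr a \<le> c k"
      using True by (simp add: c_def frac_le)
    then show ?thesis using k True by (auto simp: r_def intro!: exI[of _ k] ennreal_leI)
  qed
qed

text \<open>
  Jensen's inequality: integrate the tangent inequality at the mean \<open>m\<close> of \<open>\<bar>a\<bar>\<close>.
\<close>

lemma Jensen_unit_interval:
  fixes a :: "real \<Rightarrow> real"
  assumes "p > 1" and a: "continuous_on {0..1} a"
  shows "\<bar>integral {0..1} a\<bar> powr p \<le> integral {0..1} (\<lambda>t. \<bar>a t\<bar> powr p)"
proof -
  define m where "m = integral {0..1} (\<lambda>t. \<bar>a t\<bar>)"
  have i1: "(\<lambda>t. \<bar>a t\<bar>) integrable_on {0..1}" "a integrable_on {0..1}"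
    by (intro integrable_continuous_interval continuous_intros a)+
  have i2: "(\<lambda>t. \<bar>a t\<bar> powr p) integrable_on {0..1}"
    by (intro integrable_continuous_interval continuous_on_powr' continuous_intros a) (use assms in auto)
  have m: "m \<ge> 0" unfolding m_def by (intro integral_nonneg i1) auto
  have "\<bar>integral {0..1} a\<bar> \<le> m"
    unfolding m_def using integral_norm_bound_integral[OF i1(2) i1(1)] by simp
  then have "\<bar>integral {0..1} a\<bar> powr p \<le> m powr p" using assms by (intro powr_mono2) auto
  also have "m powr p \<le> integral {0..1} (\<lambda>t. \<bar>a t\<bar> powr p)"
  proof -
    have "integral {0..1} (\<lambda>t. p * m powr (p - 1) * \<bar>a t\<bar>)
        \<le> integral {0..1} (\<lambda>t. \<bar>a t\<bar> powr p + (p - 1) * m powr p)"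
      using Young_powr[OF assms(1) _ m]
      by (intro integral_le integrable_add i2 integrable_cmul[OF i1(1), simplified] integrable_on_cmult_left i1)
        (auto simp: mult.assoc)
    also have "\<dots> = integral {0..1} (\<lambda>t. \<bar>a t\<bar> powr p) + (p - 1) * m powr p"
      by (subst Henstock_Kurzweil_Integration.integral_add[OF i2]) auto
    finally have "p * (m powr (p - 1) * m) \<le> integral {0..1} (\<lambda>t. \<bar>a t\<bar> powr p) + (p - 1) * m powr p"
      by (simp add: m_def mult.assoc)
    moreover have "m powr (p - 1) * m = m powr p"
      using m by (cases "m = 0") (auto simp: powr_diff)
    ultimately have "p * m powr p \<le> integral {0..1} (\<lambda>t. \<bar>a t\<bar> powr p) + (p - 1) * m powr p"
      by (simp only:)
    then show ?thesis by (simp add: algebra_simps)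
  qed
  finally show ?thesis .
qed

text \<open>
  The increment is the integral of \<open>\<nabla>\<phi> \<bullet> h\<close> along the segment from \<open>x\<close> to \<open>x + h\<close>. Jensen's
  inequality moves the power inside, and after exchanging the integrals each point of the segment
  contributes the same amount by translation invariance.
\<close>

lemma nn_integral_shift_diff_le:
  fixes \<phi> :: "'a::euclidean_space \<Rightarrow> real"
  assumes "p > 1" and \<phi>: "\<phi> \<in> test_functions \<Omega>"
  shows "(\<integral>\<^sup>+ x. ennreal (\<bar>\<phi> (x + h) - \<phi> x\<bar> powr p) \<partial>lborel)
    \<le> ennreal (norm h powr p) * (\<integral>\<^sup>+ x. ennreal (norm (grad \<phi> x) powr p) \<partial>lborel)"
proof -
  note [measurable] = borel_measurable_test[OF \<phi>]
  note gc = test_grad_continuous[OF \<phi>]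
  let ?g = "\<lambda>t x. ennreal (norm h powr p * norm (grad \<phi> (x + t *\<^sub>R h)) powr p)"
  have pw: "ennreal (\<bar>\<phi> (x + h) - \<phi> x\<bar> powr p) \<le> (\<integral>\<^sup>+ t. indicator {0..1} t * ?g t x \<partial>lborel)" for x
  proof -
    have cg: "continuous_on {0..1} (\<lambda>t::real. grad \<phi> (x + t *\<^sub>R h))"
      by (rule continuous_on_compose2[OF gc]) (auto intro!: continuous_intros)
    have "((\<lambda>t. grad \<phi> (x + t *\<^sub>R h) \<bullet> h) has_integral (\<phi> (x + 1 *\<^sub>R h) - \<phi> (x + 0 *\<^sub>R h))) {0..1}"
      by (rule fundamental_theorem_of_calculus)
        (auto simp: has_real_derivative_iff_has_vector_derivative[symmetric]
          intro!: has_real_derivative_along_line test_differentiable[OF \<phi>])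
    then have "\<phi> (x + h) - \<phi> x = integral {0..1} (\<lambda>t. grad \<phi> (x + t *\<^sub>R h) \<bullet> h)"
      by (simp add: integral_unique)
    then have "\<bar>\<phi> (x + h) - \<phi> x\<bar> powr p \<le> integral {0..1} (\<lambda>t. \<bar>grad \<phi> (x + t *\<^sub>R h) \<bullet> h\<bar> powr p)"
      using Jensen_unit_interval[OF assms(1), of "\<lambda>t. grad \<phi> (x + t *\<^sub>R h) \<bullet> h"]
      by (simp add: continuous_intros cg)
    also have "\<dots> \<le> integral {0..1} (\<lambda>t. norm h powr p * norm (grad \<phi> (x + t *\<^sub>R h)) powr p)"
    proof (rule integral_le)
      show "(\<lambda>t. \<bar>grad \<phi> (x + t *\<^sub>R h) \<bullet> h\<bar> powr p) integrable_on {0..1}"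
        "(\<lambda>t. norm h powr p * norm (grad \<phi> (x + t *\<^sub>R h)) powr p) integrable_on {0..1}"
        by (intro integrable_continuous_interval continuous_on_powr' continuous_intros cg; use assms in auto)+
      show "\<bar>grad \<phi> (x + t *\<^sub>R h) \<bullet> h\<bar> powr p \<le> norm h powr p * norm (grad \<phi> (x + t *\<^sub>R h)) powr p" for t
      proof -
        have "\<bar>grad \<phi> (x + t *\<^sub>R h) \<bullet> h\<bar> powr p \<le> (norm h * norm (grad \<phi> (x + t *\<^sub>R h))) powr p"
          using Cauchy_Schwarz_ineq2[of "grad \<phi> (x + t *\<^sub>R h)" h] assms
          by (intro powr_mono2) (auto simp: mult.commute)
        then show ?thesis by (simp add: powr_mult)
      qed
    qed
    finally have "ennreal (\<bar>\<phi> (x + h) - \<phi> x\<bar> powr p)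
        \<le> ennreal (integral {0..1} (\<lambda>t. norm h powr p * norm (grad \<phi> (x + t *\<^sub>R h)) powr p))"
      by (rule ennreal_leI)
    also have "\<dots> = (\<integral>\<^sup>+ t. ennreal (indicator {0..1} t * (norm h powr p * norm (grad \<phi> (x + t *\<^sub>R h)) powr p)) \<partial>lborel)"
    proof (rule nn_integral_has_integral_lebesgue[symmetric])
      show "((\<lambda>t. norm h powr p * norm (grad \<phi> (x + t *\<^sub>R h)) powr p) has_integral
         integral {0..1} (\<lambda>t. norm h powr p * norm (grad \<phi> (x + t *\<^sub>R h)) powr p)) {0..1}"
        by (intro integrable_integral integrable_continuous_interval continuous_on_powr' continuous_intros cg)
          (use assms in auto)
    qed simp
    also have "\<dots> = (\<integral>\<^sup>+ t. indicator {0..1} t * ?g t x \<partial>lborel)"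
      by (rule nn_integral_cong) (simp add: indicator_def)
    finally show ?thesis .
  qed
  have "(\<integral>\<^sup>+ x. ennreal (\<bar>\<phi> (x + h) - \<phi> x\<bar> powr p) \<partial>lborel)
      \<le> (\<integral>\<^sup>+ x. (\<integral>\<^sup>+ t. indicator {0..1} t * ?g t x \<partial>lborel) \<partial>lborel)"
    by (rule nn_integral_mono[OF pw])
  also have "\<dots> = (\<integral>\<^sup>+ t. (\<integral>\<^sup>+ x. indicator {0..1} t * ?g t x \<partial>lborel) \<partial>lborel)"
    by (rule lborel_pair.Fubini') measurable
  also have "\<dots> = (\<integral>\<^sup>+ t. indicator {0..1::real} t *
      (ennreal (norm h powr p) * (\<integral>\<^sup>+ x. ennreal (norm (grad \<phi> x) powr p) \<partial>lborel)) \<partial>lborel)"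
  proof (rule nn_integral_cong)
    fix t :: real
    have "(\<integral>\<^sup>+ x. ?g t x \<partial>lborel) = ennreal (norm h powr p) *
        (\<integral>\<^sup>+ x. ennreal (norm (grad \<phi> (x + t *\<^sub>R h)) powr p) \<partial>lborel)"
      by (simp add: ennreal_mult' nn_integral_cmult)
    also have "(\<integral>\<^sup>+ x. ennreal (norm (grad \<phi> (x + t *\<^sub>R h)) powr p) \<partial>lborel)
        = (\<integral>\<^sup>+ x. ennreal (norm (grad \<phi> x) powr p) \<partial>lborel)"
      by (rule nn_integral_translate[of "\<lambda>x. ennreal (norm (grad \<phi> x) powr p)"]) measurable
    finally show "(\<integral>\<^sup>+ x. indicator {0..1} t * ?g t x \<partial>lborel) = indicator {0..1::real} t *
      (ennreal (norm h powr p) * (\<integral>\<^sup>+ x. ennreal (norm (grad \<phi> x) powr p) \<partial>lborel))"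
      by (subst nn_integral_cmult) auto
  qed
  also have "\<dots> = ennreal (norm h powr p) * (\<integral>\<^sup>+ x. ennreal (norm (grad \<phi> x) powr p) \<partial>lborel)"
    by (subst nn_integral_multc) (auto simp: nn_integral_indicator)
  finally show ?thesis .
qed

definition Gagliardo_kernel :: "real \<Rightarrow> real \<Rightarrow> ('a::euclidean_space \<Rightarrow> real) \<Rightarrow> 'a \<times> 'a \<Rightarrow> real" where
  "Gagliardo_kernel p s u z = \<bar>u (fst z) - u (snd z)\<bar> powr p / norm (fst z - snd z) powr (real DIM('a) + p * s)"

definition Gagliardo :: "real \<Rightarrow> real \<Rightarrow> ('a::euclidean_space \<Rightarrow> real) \<Rightarrow> ennreal" where
  "Gagliardo p s u = (\<integral>\<^sup>+ z. ennreal (Gagliardo_kernel p s u z) \<partial>lborel)"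

lemma nn_integral_lborel_pair:
  fixes f :: "'a::euclidean_space \<times> 'b::euclidean_space \<Rightarrow> ennreal"
  assumes "f \<in> borel_measurable borel"
  shows "(\<integral>\<^sup>+ z. f z \<partial>lborel) = (\<integral>\<^sup>+ y. (\<integral>\<^sup>+ x. f (x, y) \<partial>lborel) \<partial>lborel)"
  using lborel_pair.nn_integral_snd[of f] assms by (simp add: lborel_prod)

text \<open>
  With \<open>h = x - y\<close>, close pairs are controlled by the gradient and distant pairs by the
  function itself; the two kernels are integrable since \<open>p s < p\<close> and \<open>p s > 0\<close>.
\<close>

lemma Gagliardo_test:
  assumes p: "p > 1" "p < real DIM('a)" and s: "0 < s" "s < 1"
  shows "\<exists>C\<ge>0. \<forall>\<phi>\<in>test_functions (UNIV :: 'a::euclidean_space set).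
    Gagliardo p s \<phi> \<le> ennreal (C * (int_powr p \<phi> + int_powr p (grad \<phi>)))"
proof -
  define K1 where "K1 = (\<integral>\<^sup>+ h. ennreal (indicator (cball (0::'a) 1) h / norm h powr (real DIM('a) + p * s - p)) \<partial>lborel)"
  define K2 where "K2 = (\<integral>\<^sup>+ h. ennreal (indicator {h::'a. norm h > 1} h / norm h powr (real DIM('a) + p * s)) \<partial>lborel)"
  have [measurable]: "cball (0::'a) 1 \<in> sets borel" by simp
  have ps: "0 < p * s" "p * s < p" using p s by auto
  have K: "K1 < \<infinity>" "K2 < \<infinity>"
    unfolding K1_def K2_def using p ps by (intro nn_integral_powr_inside nn_integral_powr_outside; simp)+
  define C where "C = enn2real K1 + 2 * 2 powr p * enn2real K2"
  have C0: "C \<ge> 0" by (simp add: C_def)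
  have "Gagliardo p s \<phi> \<le> ennreal (C * (int_powr p \<phi> + int_powr p (grad \<phi>)))"
    if \<phi>: "\<phi> \<in> test_functions (UNIV :: 'a set)" for \<phi>
  proof -
    note [measurable] = borel_measurable_test[OF \<phi>]
    define A where "A = int_powr p \<phi>"
    define B where "B = int_powr p (grad \<phi>)"
    have A: "A \<ge> 0" "(\<integral>\<^sup>+ x. ennreal (\<bar>\<phi> x\<bar> powr p) \<partial>lborel) = ennreal A"
      using nn_integral_eq_integral[OF test_integrable(3)[OF \<phi>, of p]] p by (auto simp: A_def)
    have B: "B \<ge> 0" "(\<integral>\<^sup>+ x. ennreal (norm (grad \<phi> x) powr p) \<partial>lborel) = ennreal B"
      using nn_integral_eq_integral[OF test_integrable(4)[OF \<phi>, of p]] p by (auto simp: B_def)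
    define D where "D h = (\<integral>\<^sup>+ y. ennreal (\<bar>\<phi> (y + h) - \<phi> y\<bar> powr p) \<partial>lborel)" for h
    have near: "D h \<le> ennreal (norm h powr p) * ennreal B" for h
      unfolding D_def B(2)[symmetric] by (rule nn_integral_shift_diff_le[OF p(1) \<phi>])
    have far: "D h \<le> ennreal (2 * 2 powr p * A)" for h
    proof -
      have "D h \<le> (\<integral>\<^sup>+ y. ennreal (2 powr p) * ennreal (\<bar>\<phi> (y + h)\<bar> powr p)
          + ennreal (2 powr p) * ennreal (\<bar>\<phi> y\<bar> powr p) \<partial>lborel)"
        unfolding D_def
      proof (rule nn_integral_mono)
        fix y
        show "ennreal (\<bar>\<phi> (y + h) - \<phi> y\<bar> powr p) \<le> ennreal (2 powr p) * ennreal (\<bar>\<phi> (y + h)\<bar> powr p)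
          + ennreal (2 powr p) * ennreal (\<bar>\<phi> y\<bar> powr p)"
          using norm_diff_powr_le[OF p(1), of "\<phi> (y + h)" "\<phi> y"]
          by (simp add: ennreal_mult[symmetric] ennreal_plus[symmetric] ennreal_leI del: ennreal_plus)
      qed
      also have "\<dots> = ennreal (2 powr p) * ennreal A + ennreal (2 powr p) * ennreal A"
        using nn_integral_translate[of "\<lambda>x. ennreal (\<bar>\<phi> x\<bar> powr p)" h]
        by (simp add: nn_integral_add nn_integral_cmult A(2))
      also have "\<dots> = ennreal (2 * 2 powr p * A)"
        using A(1) by (simp add: ennreal_mult[symmetric] ennreal_plus[symmetric] del: ennreal_plus)
      finally show ?thesis .
    qed
    have meas: "(\<lambda>z::'a\<times>'a. ennreal (\<bar>\<phi> (fst z) - \<phi> (snd z)\<bar> powr p / norm (fst z - snd z) powr (real DIM('a) + p * s)))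
        \<in> borel_measurable borel" unfolding borel_prod[symmetric] by measurable
    have "Gagliardo p s \<phi> = (\<integral>\<^sup>+ y. (\<integral>\<^sup>+ x. ennreal (\<bar>\<phi> x - \<phi> y\<bar> powr p / norm (x - y) powr (real DIM('a) + p * s)) \<partial>lborel) \<partial>lborel)"
      unfolding Gagliardo_def Gagliardo_kernel_def by (subst nn_integral_lborel_pair[OF meas]) simp
    also have "\<dots> = (\<integral>\<^sup>+ y. (\<integral>\<^sup>+ h. ennreal (\<bar>\<phi> (y + h) - \<phi> y\<bar> powr p / norm h powr (real DIM('a) + p * s)) \<partial>lborel) \<partial>lborel)"
    proof (rule nn_integral_cong)
      fix y
      show "(\<integral>\<^sup>+ x. ennreal (\<bar>\<phi> x - \<phi> y\<bar> powr p / norm (x - y) powr (real DIM('a) + p * s)) \<partial>lborel)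
        = (\<integral>\<^sup>+ h. ennreal (\<bar>\<phi> (y + h) - \<phi> y\<bar> powr p / norm h powr (real DIM('a) + p * s)) \<partial>lborel)"
        using nn_integral_translate[of "\<lambda>x. ennreal (\<bar>\<phi> x - \<phi> y\<bar> powr p / norm (x - y) powr (real DIM('a) + p * s))" y]
        by (simp add: add.commute)
    qed
    also have "\<dots> = (\<integral>\<^sup>+ h. (\<integral>\<^sup>+ y. ennreal (\<bar>\<phi> (y + h) - \<phi> y\<bar> powr p / norm h powr (real DIM('a) + p * s)) \<partial>lborel) \<partial>lborel)"
      by (rule lborel_pair.Fubini') measurable
    also have "\<dots> = (\<integral>\<^sup>+ h. ennreal (1 / norm h powr (real DIM('a) + p * s)) * D h \<partial>lborel)"
    proof (rule nn_integral_cong)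
      fix h :: 'a
      show "(\<integral>\<^sup>+ y. ennreal (\<bar>\<phi> (y + h) - \<phi> y\<bar> powr p / norm h powr (real DIM('a) + p * s)) \<partial>lborel)
        = ennreal (1 / norm h powr (real DIM('a) + p * s)) * D h"
        unfolding D_def by (subst nn_integral_cmult[symmetric]) (auto simp: ennreal_mult[symmetric])
    qed
    also have "\<dots> \<le> (\<integral>\<^sup>+ h. ennreal (indicator (cball (0::'a) 1) h / norm h powr (real DIM('a) + p * s - p)) * ennreal B
        + ennreal (indicator {h. norm h > 1} h / norm h powr (real DIM('a) + p * s)) * ennreal (2 * 2 powr p * A) \<partial>lborel)"
    proof (rule nn_integral_mono)
      fix h :: 'a
      show "ennreal (1 / norm h powr (real DIM('a) + p * s)) * D h
        \<le> ennreal (indicator (cball 0 1) h / norm h powr (real DIM('a) + p * s - p)) * ennreal B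
        + ennreal (indicator {h. norm h > 1} h / norm h powr (real DIM('a) + p * s)) * ennreal (2 * 2 powr p * A)"
      proof (cases "norm h > 1")
        case True
        then show ?thesis using far[of h] by (auto intro!: mult_left_mono)
      next
        case False
        have "ennreal (1 / norm h powr (real DIM('a) + p * s)) * D h
          \<le> ennreal (1 / norm h powr (real DIM('a) + p * s)) * (ennreal (norm h powr p) * ennreal B)"
          by (intro mult_left_mono near) simp
        also have "\<dots> = ennreal (1 / norm h powr (real DIM('a) + p * s) * norm h powr p) * ennreal B"
          by (subst ennreal_mult) (simp_all add: mult.assoc)
        also have "1 / norm h powr (real DIM('a) + p * s) * norm h powr p = 1 / norm h powr (real DIM('a) + p * s - p)"
          by (cases "h = 0") (auto simp: powr_diff)
        finally show ?thesis using False by simp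
      qed
    qed
    also have "\<dots> = K1 * ennreal B + K2 * ennreal (2 * 2 powr p * A)"
      unfolding K1_def K2_def by (subst nn_integral_add) (auto simp: nn_integral_multc)
    also have "\<dots> = ennreal (enn2real K1 * B + enn2real K2 * (2 * 2 powr p * A))"
      using K A(1) B(1) by (simp add: ennreal_mult ennreal_plus less_top)
    also have "\<dots> \<le> ennreal (C * (A + B))"
    proof (rule ennreal_leI)
      have "enn2real K1 * B + enn2real K2 * (2 * 2 powr p * A) \<le>
        enn2real K1 * B + enn2real K2 * (2 * 2 powr p * A) + (enn2real K1 * A + enn2real K2 * (2 * 2 powr p * B))"
        using A(1) B(1) by simp
      also have "\<dots> = C * (A + B)" by (simp add: C_def algebra_simps)
      finally show "enn2real K1 * B + enn2real K2 * (2 * 2 powr p * A) \<le> C * (A + B)" .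
    qed
    finally show ?thesis by (simp add: A_def B_def)
  qed
  then show ?thesis using C0 by blast
qed

lemma Fatou_AE:
  fixes f :: "nat \<Rightarrow> 'x \<Rightarrow> ennreal"
  assumes [measurable]: "\<And>k. f k \<in> borel_measurable M"
    and ae: "AE x in M. (\<lambda>k. f k x) \<longlonglongrightarrow> g x"
    and b: "\<And>k. (\<integral>\<^sup>+ x. f k x \<partial>M) \<le> ennreal (b k)" "b \<longlonglongrightarrow> B"
  shows "(\<integral>\<^sup>+ x. g x \<partial>M) \<le> ennreal B"
proof -
  have "AE x in M. g x = liminf (\<lambda>k. f k x)"
    using ae
  proof (rule AE_mp, intro AE_I2 impI)
    fix x assume "(\<lambda>k. f k x) \<longlonglongrightarrow> g x"
    then show "g x = liminf (\<lambda>k. f k x)"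
      using lim_imp_Liminf[OF trivial_limit_sequentially] by metis
  qed
  then have "(\<integral>\<^sup>+ x. g x \<partial>M) = (\<integral>\<^sup>+ x. liminf (\<lambda>k. f k x) \<partial>M)"
    by (rule nn_integral_cong_AE)
  also have "\<dots> \<le> liminf (\<lambda>k. \<integral>\<^sup>+ x. f k x \<partial>M)"
    by (rule nn_integral_liminf) simp
  also have "\<dots> \<le> liminf (\<lambda>k. ennreal (b k))"
    by (rule Liminf_mono) (simp add: b(1))
  also have "\<dots> = ennreal B"
    by (rule lim_imp_Liminf[OF trivial_limit_sequentially tendsto_ennrealI[OF b(2)]])
  finally show ?thesis .
qed

lemma AE_lborel_pair:
  assumes "AE x in (lborel :: 'a::euclidean_space measure). P x"
  shows "AE z in (lborel :: ('a \<times> 'a) measure). P (fst z) \<and> P (snd z)"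
proof -
  obtain N where N: "N \<in> null_sets (lborel :: 'a measure)" "{x. \<not> P x} \<subseteq> N"
    using assms by (auto simp: eventually_ae_filter)
  have "N \<times> UNIV \<in> null_sets (lborel \<Otimes>\<^sub>M (lborel :: 'a measure))"
    using lborel.times_in_null_sets1[OF N(1), of UNIV] by simp
  moreover have "UNIV \<times> N \<in> null_sets ((lborel :: 'a measure) \<Otimes>\<^sub>M lborel)"
    by (rule lborel.times_in_null_sets2[OF _ N(1)]) simp
  ultimately have "(N \<times> UNIV) \<union> (UNIV \<times> N) \<in> null_sets (lborel :: ('a \<times> 'a) measure)"
    unfolding lborel_prod[symmetric] by (rule null_sets.Un)
  then show ?thesis
    by (rule AE_I') (use N(2) in auto)
qed

lemma int_powr_split:
  fixes f g :: "'a::euclidean_space \<Rightarrow> 'b::euclidean_space"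
  assumes "p > 1" "0 < t" "t < 1" "in_Lp p f" "in_Lp p g"
  shows "int_powr p f \<le> t powr (1 - p) * int_powr p g + (1 - t) powr (1 - p) * int_powr p (\<lambda>x. f x - g x)"
proof -
  note i = in_LpD(2)[OF assms(4)] in_LpD(2)[OF assms(5)] in_LpD(2)[OF in_Lp_diff[OF assms(1,4,5)]]
  have "int_powr p f \<le> (LINT x|lborel. t powr (1 - p) * norm (g x) powr p + (1 - t) powr (1 - p) * norm (f x - g x) powr p)"
    by (intro integral_mono Bochner_Integration.integrable_add integrable_mult_right i norm_powr_split assms)
  also have "\<dots> = t powr (1 - p) * int_powr p g + (1 - t) powr (1 - p) * int_powr p (\<lambda>x. f x - g x)"
    by (subst Bochner_Integration.integral_add) (auto intro!: integrable_mult_right i)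
  finally show ?thesis .
qed

lemma powr_tendsto_0_imp:
  fixes f :: "nat \<Rightarrow> real"
  assumes "p > 1" "(\<lambda>n. \<bar>f n\<bar> powr p) \<longlonglongrightarrow> 0"
  shows "f \<longlonglongrightarrow> 0"
proof -
  have "(\<lambda>n. (\<bar>f n\<bar> powr p) powr (1 / p)) \<longlonglongrightarrow> 0 powr (1 / p)"
    by (rule tendsto_powr'[OF assms(2) tendsto_const]) (use assms(1) in auto)
  then have "(\<lambda>n. \<bar>f n\<bar>) \<longlonglongrightarrow> 0" using assms(1) by (simp add: powr_powr)
  then show ?thesis by (rule tendsto_rabs_zero_cancel)
qed

text \<open>
  Convergence in \<open>L\<^sup>p\<close> gives convergence almost everywhere along a subsequence.
\<close>

lemma test_limit_AE_seq:
  assumes p: "p > 1" and u: "test_limit p \<Omega> u G"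
  shows "\<exists>\<phi>. (\<forall>k. \<phi> k \<in> test_functions \<Omega>) \<and>
       (\<lambda>k. int_powr p (\<lambda>x. \<phi> k x - u x)) \<longlonglongrightarrow> 0 \<and>
       (\<lambda>k. int_powr p (\<lambda>x. grad (\<phi> k) x - G x)) \<longlonglongrightarrow> 0 \<and>
       (AE x in lborel. (\<lambda>k. \<phi> k x) \<longlonglongrightarrow> u x)"
proof -
  obtain \<phi> where \<phi>: "\<And>k. \<phi> k \<in> test_functions \<Omega>"
      "(\<lambda>k. int_powr p (\<lambda>x. \<phi> k x - u x)) \<longlonglongrightarrow> 0"
      "(\<lambda>k. int_powr p (\<lambda>x. grad (\<phi> k) x - G x)) \<longlonglongrightarrow> 0"
    using test_limit_seq[OF u] by auto
  have "\<exists>r. strict_mono r \<and> (AE x in lborel. (\<lambda>n. norm (\<phi> (r n) x - u x) powr p) \<longlonglongrightarrow> 0)"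
  proof (rule tendsto_L1_AE_subseq)
    show "integrable lborel (\<lambda>x. norm (\<phi> n x - u x) powr p)" for n
      using in_LpD(2)[OF in_Lp_diff[OF p in_Lp_test(1)[OF \<phi>(1)[of n] p] test_limitD(1)[OF u]]] .
    show "(\<lambda>n. LINT x|lborel. norm (norm (\<phi> n x - u x) powr p)) \<longlonglongrightarrow> 0"
      using \<phi>(2) by simp
  qed
  then obtain r where rr: "strict_mono r \<and> (AE x in lborel. (\<lambda>n. norm (\<phi> (r n) x - u x) powr p) \<longlonglongrightarrow> 0)"
    by (rule exE)
  note r = conjunct1[OF rr] conjunct2[OF rr]
  have "AE x in lborel. (\<lambda>n. \<phi> (r n) x) \<longlonglongrightarrow> u x"
    using r(2)
  proof (rule AE_mp, intro AE_I2 impI)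
    fix x assume "(\<lambda>n. norm (\<phi> (r n) x - u x) powr p) \<longlonglongrightarrow> 0"
    then have "(\<lambda>n. \<phi> (r n) x - u x) \<longlonglongrightarrow> 0" by (rule powr_tendsto_0_imp[OF p, of "\<lambda>n. \<phi> (r n) x - u x", simplified real_norm_def[symmetric]])
    then show "(\<lambda>n. \<phi> (r n) x) \<longlonglongrightarrow> u x" by (rule LIM_zero_cancel)
  qed
  moreover have "(\<lambda>k. int_powr p (\<lambda>x. \<phi> (r k) x - u x)) \<longlonglongrightarrow> 0"
    "(\<lambda>k. int_powr p (\<lambda>x. grad (\<phi> (r k)) x - G x)) \<longlonglongrightarrow> 0"
    using LIMSEQ_subseq_LIMSEQ[OF \<phi>(2) r(1)] LIMSEQ_subseq_LIMSEQ[OF \<phi>(3) r(1)] by (simp_all add: o_def)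
  ultimately show ?thesis using \<phi>(1) by (intro exI[of _ "\<lambda>k. \<phi> (r k)"]) auto
qed

lemma Gagliardo_kernel_measurable:
  fixes u :: "'a::euclidean_space \<Rightarrow> real"
  assumes [measurable]: "u \<in> borel_measurable borel"
  shows "Gagliardo_kernel p s u \<in> borel_measurable borel"
  unfolding Gagliardo_kernel_def[abs_def] borel_prod[symmetric] by measurable

text \<open>
  The bound for test functions survives the limit by Fatou's lemma along a subsequence that
  converges almost everywhere.
\<close>

lemma Gagliardo_test_limit:
  assumes p: "p > 1" "p < real DIM('a)" and s: "0 < s" "s < 1"
  shows "\<exists>C\<ge>0. \<forall>\<Omega> u G. test_limit p (\<Omega> :: 'a::euclidean_space set) u G \<longrightarrow>
    Gagliardo p s u \<le> ennreal (C * (int_powr p u + int_powr p G))"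
proof -
  obtain C where C: "C \<ge> 0" "\<And>\<phi>. \<phi> \<in> test_functions (UNIV :: 'a set) \<Longrightarrow>
    Gagliardo p s \<phi> \<le> ennreal (C * (int_powr p \<phi> + int_powr p (grad \<phi>)))"
    using Gagliardo_test[OF p s] by blast
  define t where "t = (1 / 2 :: real) powr (1 - p)"
  have "Gagliardo p s u \<le> ennreal (C * (t * int_powr p u + t * 0 + (t * int_powr p G + t * 0)))"
    if u: "test_limit p \<Omega> u G" for \<Omega> :: "'a set" and u G
  proof -
    obtain \<phi> where \<phi>: "\<And>k. \<phi> k \<in> test_functions \<Omega>"
      "(\<lambda>k. int_powr p (\<lambda>x. \<phi> k x - u x)) \<longlonglongrightarrow> 0"
      "(\<lambda>k. int_powr p (\<lambda>x. grad (\<phi> k) x - G x)) \<longlonglongrightarrow> 0"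
      "AE x in lborel. (\<lambda>k. \<phi> k x) \<longlonglongrightarrow> u x"
      using test_limit_AE_seq[OF p(1) u] by auto
    note \<phi>U = test_mono[OF subset_UNIV \<phi>(1)]
    show ?thesis
      unfolding Gagliardo_def
    proof (rule Fatou_AE)
      show "(\<lambda>z. ennreal (Gagliardo_kernel p s (\<phi> k) z))
          \<in> borel_measurable lborel" for k
        using Gagliardo_kernel_measurable[OF borel_measurable_test(1)[OF \<phi>(1)]] by simp
      show "AE z in lborel. (\<lambda>k. ennreal (Gagliardo_kernel p s (\<phi> k) z))
        \<longlonglongrightarrow> ennreal (Gagliardo_kernel p s u z)"
        using AE_lborel_pair[OF \<phi>(4)]
      proof (rule AE_mp, intro AE_I2 impI)
        fix z assume z: "(\<lambda>k. \<phi> k (fst z)) \<longlonglongrightarrow> u (fst z) \<and> (\<lambda>k. \<phi> k (snd z)) \<longlonglongrightarrow> u (snd z)"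
        have "(\<lambda>k. \<bar>\<phi> k (fst z) - \<phi> k (snd z)\<bar> powr p) \<longlonglongrightarrow> \<bar>u (fst z) - u (snd z)\<bar> powr p"
          by (rule tendsto_powr') (use z p in \<open>auto intro!: tendsto_intros\<close>)
        then show "(\<lambda>k. ennreal (Gagliardo_kernel p s (\<phi> k) z))
          \<longlonglongrightarrow> ennreal (Gagliardo_kernel p s u z)"
          unfolding Gagliardo_kernel_def divide_inverse by (intro tendsto_ennrealI tendsto_mult_right)
      qed
      show "(\<integral>\<^sup>+ z. ennreal (Gagliardo_kernel p s (\<phi> k) z) \<partial>lborel)
        \<le> ennreal (C * (t * int_powr p u + t * int_powr p (\<lambda>x. \<phi> k x - u x)
           + (t * int_powr p G + t * int_powr p (\<lambda>x. grad (\<phi> k) x - G x))))" for k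
      proof -
        have "int_powr p (\<phi> k) \<le> t * int_powr p u + t * int_powr p (\<lambda>x. \<phi> k x - u x)"
          using int_powr_split[OF p(1), of "1/2" "\<phi> k" u] in_Lp_test(1)[OF \<phi>(1) p(1)] test_limitD(1)[OF u]
          by (simp add: t_def)
        moreover have "int_powr p (grad (\<phi> k)) \<le> t * int_powr p G + t * int_powr p (\<lambda>x. grad (\<phi> k) x - G x)"
          using int_powr_split[OF p(1), of "1/2" "grad (\<phi> k)" G] in_Lp_test(2)[OF \<phi>(1) p(1)] test_limitD(2)[OF u]
          by (simp add: t_def)
        ultimately have "C * (int_powr p (\<phi> k) + int_powr p (grad (\<phi> k))) \<le>
            C * (t * int_powr p u + t * int_powr p (\<lambda>x. \<phi> k x - u x)
           + (t * int_powr p G + t * int_powr p (\<lambda>x. grad (\<phi> k) x - G x)))"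
          by (intro mult_left_mono C add_mono)
        then show ?thesis
          using C(2)[OF \<phi>U, of k] unfolding Gagliardo_def by (meson ennreal_leI order_trans)
      qed
      show "(\<lambda>k. C * (t * int_powr p u + t * int_powr p (\<lambda>x. \<phi> k x - u x)
           + (t * int_powr p G + t * int_powr p (\<lambda>x. grad (\<phi> k) x - G x))))
        \<longlonglongrightarrow> C * (t * int_powr p u + t * 0 + (t * int_powr p G + t * 0))"
        by (intro tendsto_mult tendsto_add tendsto_const \<phi>)
    qed
  qed
  then have "Gagliardo p s u \<le> ennreal ((C * t) * (int_powr p u + int_powr p G))"
    if "test_limit p \<Omega> u G" for \<Omega> :: "'a set" and u G
    using that by (simp add: distrib_left mult.assoc)
  moreover have "C * t \<ge> 0" using C by (simp add: t_def)
  ultimately show ?thesis by blast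
qed

lemma in_Lp_mono:
  fixes f :: "'a::euclidean_space \<Rightarrow> 'b::euclidean_space" and g :: "'a \<Rightarrow> 'c::euclidean_space"
  assumes "p > 1" "in_Lp p g" and [measurable]: "f \<in> borel_measurable borel"
    and b: "\<And>x. norm (f x) \<le> C * norm (g x)"
  shows "in_Lp p f"
  unfolding in_Lp_def
proof (intro conjI)
  show "integrable lborel (\<lambda>x. norm (f x) powr p)"
  proof (rule Bochner_Integration.integrable_bound)
    show "integrable lborel (\<lambda>x. \<bar>C\<bar> powr p * norm (g x) powr p)"
      by (intro integrable_mult_right in_LpD(2)[OF assms(2)])
    show "AE x in lborel. norm (norm (f x) powr p) \<le> norm (\<bar>C\<bar> powr p * norm (g x) powr p)"
    proof (rule AE_I2)
      fix x
      have "norm (f x) \<le> \<bar>C\<bar> * norm (g x)"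
        using b[of x] mult_right_mono[of C "\<bar>C\<bar>" "norm (g x)"] abs_ge_self[of C] norm_ge_zero[of "g x"]
        by linarith
      then have "norm (f x) powr p \<le> (\<bar>C\<bar> * norm (g x)) powr p" using assms(1) by (intro powr_mono2) auto
      then show "norm (norm (f x) powr p) \<le> norm (\<bar>C\<bar> powr p * norm (g x) powr p)"
        by (simp add: powr_mult)
    qed
  qed simp
qed simp

lemma in_Lp_ball:
  assumes "p > 1"
  shows "in_Lp p (\<lambda>x::'a::euclidean_space. indicat_real (cball 0 r) x)"
proof -
  have [measurable]: "cball (0::'a) r \<in> sets borel" by simp
  show ?thesis
    unfolding in_Lp_def
    by (intro conjI integrable_bounded_support[where C = 1 and r = r])
      (measurable, auto simp: indicator_def)
qed

lemma in_Lp_add: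
  assumes "p > 1" "in_Lp p f" "in_Lp p g"
  shows "in_Lp p (\<lambda>x. f x + g x)"
proof -
  have "in_Lp p (\<lambda>x. - g x)" using assms(3) by (auto simp: in_Lp_def)
  from in_Lp_diff[OF assms(1,2) this] show ?thesis by simp
qed

lemma int_powr_dominated_tendsto_0:
  fixes h :: "nat \<Rightarrow> 'a::euclidean_space \<Rightarrow> 'b::euclidean_space"
    and H :: "'a \<Rightarrow> 'c::euclidean_space"
  assumes "p > 1" and [measurable]: "\<And>k. h k \<in> borel_measurable borel"
    and H: "in_Lp p H" and b: "\<And>k x. norm (h k x) \<le> C * norm (H x)"
    and lim: "AE x in lborel. (\<lambda>k. h k x) \<longlonglongrightarrow> 0"
  shows "(\<lambda>k. int_powr p (h k)) \<longlonglongrightarrow> 0"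
proof -
  have "(\<lambda>k. int_powr p (h k)) \<longlonglongrightarrow> (LINT x|(lborel :: 'a measure). 0)"
  proof (rule integral_dominated_convergence)
    show "integrable lborel (\<lambda>x. \<bar>C\<bar> powr p * norm (H x) powr p)"
      by (intro integrable_mult_right in_LpD(2)[OF H])
    show "AE x in lborel. norm (norm (h k x) powr p) \<le> \<bar>C\<bar> powr p * norm (H x) powr p" for k
    proof (rule AE_I2)
      fix x
      have "norm (h k x) \<le> \<bar>C\<bar> * norm (H x)"
        using b[of k x] mult_right_mono[of C "\<bar>C\<bar>" "norm (H x)"] abs_ge_self[of C] norm_ge_zero[of "H x"]
        by linarith
      then have "norm (h k x) powr p \<le> (\<bar>C\<bar> * norm (H x)) powr p" using assms(1) by (intro powr_mono2) auto
      then show "norm (norm (h k x) powr p) \<le> \<bar>C\<bar> powr p * norm (H x) powr p"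
        by (simp add: powr_mult)
    qed
    show "AE x in lborel. (\<lambda>k. norm (h k x) powr p) \<longlonglongrightarrow> 0"
      using lim
    proof (rule AE_mp, intro AE_I2 impI)
      fix x assume "(\<lambda>k. h k x) \<longlonglongrightarrow> 0"
      then have "(\<lambda>k. norm (h k x) powr p) \<longlonglongrightarrow> 0 powr p"
        by (intro tendsto_powr' tendsto_norm_zero tendsto_const) (use assms(1) in auto)
      then show "(\<lambda>k. norm (h k x) powr p) \<longlonglongrightarrow> 0" by simp
    qed
  qed simp_all
  then show ?thesis by simp
qed

lemma int_powr_add_tendsto_0:
  fixes f g :: "nat \<Rightarrow> 'a::euclidean_space \<Rightarrow> 'b::euclidean_space"
  assumes p: "p > 1" and L: "\<And>k. in_Lp p (f k)" "\<And>k. in_Lp p (g k)"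
    and l: "(\<lambda>k. int_powr p (f k)) \<longlonglongrightarrow> 0" "(\<lambda>k. int_powr p (g k)) \<longlonglongrightarrow> 0"
  shows "(\<lambda>k. int_powr p (\<lambda>x. f k x + g k x)) \<longlonglongrightarrow> 0"
proof (rule tendsto_sandwich[OF _ _ tendsto_const])
  have "(\<lambda>k. 2 powr p * int_powr p (f k) + 2 powr p * int_powr p (g k)) \<longlonglongrightarrow> 2 powr p * 0 + 2 powr p * 0"
    by (intro tendsto_intros l)
  then show "(\<lambda>k. 2 powr p * int_powr p (f k) + 2 powr p * int_powr p (g k)) \<longlonglongrightarrow> 0" by simp
  have "int_powr p (\<lambda>x. f k x + g k x) \<le> 2 powr p * int_powr p (f k) + 2 powr p * int_powr p (g k)" for k
  proof -
    note i = in_LpD(2)[OF L(1)[of k]] in_LpD(2)[OF L(2)[of k]]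
    have "int_powr p (\<lambda>x. f k x + g k x) \<le> (LINT x|lborel. 2 powr p * norm (f k x) powr p + 2 powr p * norm (g k x) powr p)"
    proof (rule integral_mono)
      show "integrable lborel (\<lambda>x. norm (f k x + g k x) powr p)"
        by (rule in_LpD(2)[OF in_Lp_add[OF p L]])
      show "norm (f k x + g k x) powr p \<le> 2 powr p * norm (f k x) powr p + 2 powr p * norm (g k x) powr p" for x
        using norm_diff_powr_le[OF p, of "f k x" "- g k x"] by simp
    qed (intro Bochner_Integration.integrable_add integrable_mult_right i)
    also have "\<dots> = 2 powr p * int_powr p (f k) + 2 powr p * int_powr p (g k)"
      by (subst Bochner_Integration.integral_add) (auto intro!: integrable_mult_right i)
    finally show ?thesis .
  qed
  then show "\<forall>\<^sub>F k in sequentially. int_powr p (\<lambda>x. f k x + g k x) \<le> 2 powr p * int_powr p (f k) + 2 powr p * int_powr p (g k)"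
    by simp
  show "\<forall>\<^sub>F k in sequentially. 0 \<le> int_powr p (\<lambda>x. f k x + g k x)" by simp
qed

section \<open>A chain rule for limits of test functions\<close>

text \<open>
  A smooth approximation of \<open>\<bar>t\<bar>\<^sup>p\<close>. The constant is subtracted so that it vanishes at \<open>t = 0\<close> and
  the composition with a test function is again a test function.
\<close>

definition smooth_abs_powr :: "real \<Rightarrow> real \<Rightarrow> real \<Rightarrow> real" where
  "smooth_abs_powr p \<delta> t = (t * t + \<delta>) powr (p / 2) - \<delta> powr (p / 2)"

definition smooth_abs_powr_deriv :: "real \<Rightarrow> real \<Rightarrow> real \<Rightarrow> real" where
  "smooth_abs_powr_deriv p \<delta> t = p * t * (t * t + \<delta>) powr (p / 2 - 1)"

lemma smooth_abs_powr_has_derivative: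
  assumes "\<delta> > 0"
  shows "(smooth_abs_powr p \<delta> has_real_derivative smooth_abs_powr_deriv p \<delta> t) (at t)"
proof -
  have pos: "t * t + \<delta> > 0" using assms by (simp add: add_nonneg_pos)
  have "((\<lambda>t. (t * t + \<delta>) powr (p / 2)) has_real_derivative
      (p / 2) * (t * t + \<delta>) powr (p / 2 - 1) * (t + t)) (at t)"
    by (rule DERIV_fun_powr[where g = "\<lambda>t. t * t + \<delta>", simplified]) (use pos in \<open>auto intro!: derivative_eq_intros\<close>)
  then have "((\<lambda>t. (t * t + \<delta>) powr (p / 2) - \<delta> powr (p / 2)) has_real_derivative
      (p / 2) * (t * t + \<delta>) powr (p / 2 - 1) * (t + t) - 0) (at t)"
    by (rule DERIV_diff[OF _ DERIV_const])
  then show ?thesis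
    by (simp add: smooth_abs_powr_def[abs_def] smooth_abs_powr_deriv_def algebra_simps)
qed

lemma Ck_smooth_abs_powr:
  fixes f :: "'a::euclidean_space \<Rightarrow> real"
  assumes "Ck k f" "\<delta> > 0"
  shows "Ck k (\<lambda>x. smooth_abs_powr p \<delta> (f x))"
proof -
  have "Ck k (\<lambda>x. (f x * f x + \<delta>) powr (p / 2))"
    by (rule Ck_powr[OF Ck_add[OF Ck_mult[OF assms(1,1)] Ck_const]])
      (use assms(2) in \<open>simp add: add_nonneg_pos\<close>)
  from Ck_diff[OF this Ck_const] show ?thesis by (simp add: smooth_abs_powr_def)
qed

lemma square_powr_half: "(t * t) powr (a / 2) = \<bar>t\<bar> powr a" for t a :: real
proof -
  have "(t * t) powr (a / 2) = (\<bar>t\<bar> powr 2) powr (a / 2)"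
    by (cases "t = 0") (auto simp: powr_numeral power2_eq_square)
  then show ?thesis by (simp only: powr_powr) simp
qed

lemma smooth_abs_powr_bounds:
  assumes p: "p > 1" and d: "0 < \<delta>" "\<delta> \<le> 1" and t: "\<bar>t\<bar> \<le> C"
  shows "\<bar>smooth_abs_powr p \<delta> t\<bar> \<le> (C * C + 1) powr (p / 2)"
    and "\<bar>smooth_abs_powr_deriv p \<delta> t\<bar> \<le> p * (C * C + 1) powr ((p - 1) / 2)"
proof -
  have "\<bar>t\<bar> * \<bar>t\<bar> \<le> C * C"
    by (rule mult_mono[OF t t]) (use t in auto)
  then have tt: "t * t \<le> C * C" by (simp only: abs_mult_self_eq)
  have pos: "t * t + \<delta> > 0" using d by (simp add: add_nonneg_pos)
  have le: "(t * t + \<delta>) powr a \<le> (C * C + 1) powr a" if "a \<ge> 0" for a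
    using tt d pos that by (intro powr_mono2) auto
  have "\<delta> powr (p / 2) \<le> (t * t + \<delta>) powr (p / 2)" using p d by (intro powr_mono2) auto
  then show "\<bar>smooth_abs_powr p \<delta> t\<bar> \<le> (C * C + 1) powr (p / 2)"
    unfolding smooth_abs_powr_def
    using le[of "p / 2"] p powr_ge_zero[of \<delta> "p / 2"] by linarith
  have "\<bar>t\<bar> = (t * t) powr (1 / 2)" by (simp add: square_powr_half[of t 1])
  also have "\<dots> \<le> (t * t + \<delta>) powr (1 / 2)" using d by (intro powr_mono2) auto
  finally have "\<bar>t\<bar> * (t * t + \<delta>) powr (p / 2 - 1) \<le> (t * t + \<delta>) powr (1 / 2) * (t * t + \<delta>) powr (p / 2 - 1)"
    by (rule mult_right_mono) simp
  also have "\<dots> = (t * t + \<delta>) powr ((p - 1) / 2)"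
    by (simp add: powr_add[symmetric] diff_divide_distrib)
  also have "\<dots> \<le> (C * C + 1) powr ((p - 1) / 2)" using le[of "(p - 1) / 2"] p by simp
  finally have "\<bar>t\<bar> * (t * t + \<delta>) powr (p / 2 - 1) \<le> (C * C + 1) powr ((p - 1) / 2)" .
  then have "p * (\<bar>t\<bar> * (t * t + \<delta>) powr (p / 2 - 1)) \<le> p * (C * C + 1) powr ((p - 1) / 2)"
    using p by (intro mult_left_mono) auto
  then show "\<bar>smooth_abs_powr_deriv p \<delta> t\<bar> \<le> p * (C * C + 1) powr ((p - 1) / 2)"
    using p by (simp add: smooth_abs_powr_deriv_def abs_mult mult.assoc)
qed

lemma smooth_abs_powr_tendsto:
  assumes p: "p > 1" and d: "\<And>k. \<delta> k > 0" "\<delta> \<longlonglongrightarrow> 0"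
  shows "(\<lambda>k. smooth_abs_powr p (\<delta> k) t) \<longlonglongrightarrow> \<bar>t\<bar> powr p"
    and "(\<lambda>k. smooth_abs_powr_deriv p (\<delta> k) t) \<longlonglongrightarrow> p * F p t"
proof -
  have 1: "(\<lambda>k. t * t + \<delta> k) \<longlonglongrightarrow> t * t" using tendsto_add[OF tendsto_const d(2), of "t * t"] by simp
  have nn: "\<forall>\<^sub>F k in sequentially. 0 \<le> t * t + \<delta> k"
    by (rule always_eventually, rule allI, rule add_nonneg_nonneg) (auto intro: less_imp_le d)
  have nn': "\<forall>\<^sub>F k in sequentially. 0 \<le> \<delta> k"
    by (rule always_eventually) (auto intro: less_imp_le d)
  have "(\<lambda>k. (t * t + \<delta> k) powr (p / 2) - \<delta> k powr (p / 2)) \<longlonglongrightarrow> (t * t) powr (p / 2) - 0 powr (p / 2)"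
    by (intro tendsto_diff tendsto_powr'[OF 1 tendsto_const] tendsto_powr'[OF d(2) tendsto_const])
      (use p nn nn' in auto)
  then show "(\<lambda>k. smooth_abs_powr p (\<delta> k) t) \<longlonglongrightarrow> \<bar>t\<bar> powr p"
    by (simp add: smooth_abs_powr_def square_powr_half)
  show "(\<lambda>k. smooth_abs_powr_deriv p (\<delta> k) t) \<longlonglongrightarrow> p * F p t"
  proof (cases "t = 0")
    case True
    then show ?thesis by (simp add: smooth_abs_powr_deriv_def F_def)
  next
    case False
    then have "(\<lambda>k. p * t * (t * t + \<delta> k) powr (p / 2 - 1)) \<longlonglongrightarrow> p * t * (t * t) powr (p / 2 - 1)"
      by (intro tendsto_mult tendsto_const tendsto_powr 1) auto
    moreover have "(t * t) powr (p / 2 - 1) = \<bar>t\<bar> powr (p - 2)"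
      using square_powr_half[of t "p - 2"] by (simp add: diff_divide_distrib)
    ultimately show ?thesis by (simp add: smooth_abs_powr_deriv_def F_def mult_ac)
  qed
qed

text \<open>
  If \<open>\<psi>\<^sub>k\<close> are test functions tending to \<open>w\<close>, then \<open>smooth_abs_powr p \<delta>\<^sub>k \<phi> * R \<psi>\<^sub>k\<close> are test
  functions: the first factor keeps the support inside that of \<open>\<phi>\<close>, and both factors are smooth.
  Their values and gradients converge in \<open>L\<^sup>p\<close>, because all coefficients are bounded and converge
  almost everywhere along a subsequence.
\<close>

lemma test_limit_abs_powr_mult:
  fixes w :: "'a::euclidean_space \<Rightarrow> real"
  assumes p: "p > 1" and w: "test_limit p \<Omega> w G" and \<phi>: "\<phi> \<in> test_functions \<Omega>"
    and smooth: "\<And>k (f :: 'a \<Rightarrow> real). Ck k f \<Longrightarrow> Ck k (\<lambda>x. R (f x))"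
    and R: "\<And>t. (R has_real_derivative R' t) (at t)" "continuous_on UNIV R'"
    and M: "\<And>t. \<bar>R t\<bar> \<le> M" "\<And>t. \<bar>R' t\<bar> \<le> M"
  shows "test_limit p \<Omega> (\<lambda>x. \<bar>\<phi> x\<bar> powr p * R (w x))
    (\<lambda>x. (p * F p (\<phi> x) * R (w x)) *\<^sub>R grad \<phi> x + (\<bar>\<phi> x\<bar> powr p * R' (w x)) *\<^sub>R G x)"
proof -
  obtain \<psi> where \<psi>: "\<And>k. \<psi> k \<in> test_functions \<Omega>"
      "(\<lambda>k. int_powr p (\<lambda>x. \<psi> k x - w x)) \<longlonglongrightarrow> 0"
      "(\<lambda>k. int_powr p (\<lambda>x. grad (\<psi> k) x - G x)) \<longlonglongrightarrow> 0"
      "AE x in lborel. (\<lambda>k. \<psi> k x) \<longlonglongrightarrow> w x"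
    using test_limit_AE_seq[OF p w] by auto
  obtain r C where "test_bounds \<phi> r C" using test_bounded[OF \<phi>] by blast
  note C = test_boundsD[OF this]
  have contR: "continuous_on UNIV R"
    using R(1) by (meson DERIV_isCont continuous_at_imp_continuous_on)
  note [measurable] = in_LpD(1)[OF test_limitD(1)[OF w]] in_LpD(1)[OF test_limitD(2)[OF w]]
    borel_measurable_test[OF \<phi>] borel_measurable_test[OF \<psi>(1)]
    borel_measurable_continuous_onI[OF contR] borel_measurable_continuous_onI[OF R(2)]
  have [measurable]: "F p \<in> borel_measurable borel" unfolding F_def by measurable
  define \<delta> where "\<delta> k = inverse (real (Suc k))" for k
  have \<delta>: "\<delta> k > 0" "\<delta> k \<le> 1" for k by (auto simp: \<delta>_def inverse_le_1_iff)
  have \<delta>lim: "\<delta> \<longlonglongrightarrow> 0" unfolding \<delta>_def by (rule LIMSEQ_inverse_real_of_nat)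
  define Q where "Q k x = smooth_abs_powr p (\<delta> k) (\<phi> x)" for k x
  define Q' where "Q' k x = smooth_abs_powr_deriv p (\<delta> k) (\<phi> x)" for k x
  have [measurable]: "Q k \<in> borel_measurable borel" "Q' k \<in> borel_measurable borel" for k
    unfolding Q_def Q'_def smooth_abs_powr_def smooth_abs_powr_deriv_def by measurable
  define q where "q x = \<bar>\<phi> x\<bar> powr p" for x
  define q' where "q' x = p * F p (\<phi> x)" for x
  have [measurable]: "q \<in> borel_measurable borel" "q' \<in> borel_measurable borel"
    unfolding q_def q'_def by measurable
  define B where "B = (C * C + 1) powr (p / 2)"
  define B' where "B' = p * (C * C + 1) powr ((p - 1) / 2)"
  have Qb: "\<bar>Q k x\<bar> \<le> B" "\<bar>Q' k x\<bar> \<le> B'" for k x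
    unfolding Q_def Q'_def B_def B'_def by (rule smooth_abs_powr_bounds[OF p \<delta> C(3)])+
  have Ql: "(\<lambda>k. Q k x) \<longlonglongrightarrow> q x" "(\<lambda>k. Q' k x) \<longlonglongrightarrow> q' x" for x
    unfolding Q_def Q'_def q_def q'_def by (rule smooth_abs_powr_tendsto[OF p \<delta>(1) \<delta>lim])+
  have qb: "\<bar>q x\<bar> \<le> B" "\<bar>q' x\<bar> \<le> B'" for x
    using LIMSEQ_le_const2[OF tendsto_rabs[OF Ql(1)[of x]], of B] Qb(1)
      LIMSEQ_le_const2[OF tendsto_rabs[OF Ql(2)[of x]], of B'] Qb(2) by blast+
  have BM: "B \<ge> 0" "B' \<ge> 0" "M \<ge> 0"
    using qb[of 0] M(1)[of 0] by linarith+
  have Q0: "Q k x = 0" "q x = 0" if "\<phi> x = 0" for k x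
    using that p \<delta>(1)[of k] by (auto simp: Q_def q_def smooth_abs_powr_def)
  have prodb: "\<bar>a * b\<bar> \<le> A * M" if "\<bar>a\<bar> \<le> A" "\<bar>b\<bar> \<le> M" "A \<ge> 0" for a b A :: real
    unfolding abs_mult using that BM by (intro mult_mono) auto
  define v where "v x = q x * R (w x)" for x
  define H where "H x = (q' x * R (w x)) *\<^sub>R grad \<phi> x + (q x * R' (w x)) *\<^sub>R G x" for x
  define V where "V k x = Q k x * R (\<psi> k x)" for k x
  have Rl: "AE x in lborel. (\<lambda>k. R (\<psi> k x)) \<longlonglongrightarrow> R (w x) \<and> (\<lambda>k. R' (\<psi> k x)) \<longlonglongrightarrow> R' (w x)"
    using \<psi>(4)
  proof (rule AE_mp, intro AE_I2 impI conjI)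
    fix x assume l: "(\<lambda>k. \<psi> k x) \<longlonglongrightarrow> w x"
    show "(\<lambda>k. R (\<psi> k x)) \<longlonglongrightarrow> R (w x)"
      by (rule isCont_tendsto_compose[OF _ l]) (use contR in \<open>simp add: continuous_on_eq_continuous_at\<close>)
    show "(\<lambda>k. R' (\<psi> k x)) \<longlonglongrightarrow> R' (w x)"
      by (rule isCont_tendsto_compose[OF _ l]) (use R(2) in \<open>simp add: continuous_on_eq_continuous_at\<close>)
  qed
  have Ck_V: "Ck j (V k)" for j k
    unfolding V_def[abs_def] Q_def
    by (intro Ck_mult Ck_smooth_abs_powr smooth test_Ck[OF \<phi>] test_Ck[OF \<psi>(1)] \<delta>(1))
  have V_test: "V k \<in> test_functions \<Omega>" for k
    by (rule test_I[OF Ck_V \<phi>]) (simp add: V_def Q0)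
  note [measurable] = borel_measurable_test[OF V_test]
  have [measurable]: "v \<in> borel_measurable borel" "H \<in> borel_measurable borel"
    unfolding v_def H_def by measurable
  have grad_V: "grad (V k) x = (Q k x * R' (\<psi> k x)) *\<^sub>R grad (\<psi> k) x + (R (\<psi> k x) * Q' k x) *\<^sub>R grad \<phi> x" for k x
  proof -
    have dQ: "Q k differentiable (at x)"
      using Ck_SucD(1)[OF Ck_smooth_abs_powr[OF test_Ck[OF \<phi>, of "Suc 0"] \<delta>(1)[of k], of p], of x]
      unfolding Q_def[abs_def] differentiable_def by blast
    have dR: "(\<lambda>x. R (\<psi> k x)) differentiable (at x)"
      using Ck_SucD(1)[OF smooth[OF test_Ck[OF \<psi>(1)[of k], of "Suc 0"]], of x]
      unfolding differentiable_def by blast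
    have "grad (V k) x = Q k x *\<^sub>R grad (\<lambda>x. R (\<psi> k x)) x + R (\<psi> k x) *\<^sub>R grad (Q k) x"
      unfolding V_def[abs_def] by (rule grad_mult[OF dQ dR])
    also have "grad (\<lambda>x. R (\<psi> k x)) x = R' (\<psi> k x) *\<^sub>R grad (\<psi> k) x"
      by (rule grad_chain[OF test_differentiable[OF \<psi>(1)] R(1)])
    also have "grad (Q k) x = Q' k x *\<^sub>R grad \<phi> x"
      unfolding Q_def[abs_def] Q'_def
      by (rule grad_chain[OF test_differentiable[OF \<phi>] smooth_abs_powr_has_derivative[OF \<delta>(1)]])
    finally show ?thesis by simp
  qed
  note LB = in_Lp_ball[OF p, of r, where 'a = 'a]
  have vL: "in_Lp p v"
  proof (rule in_Lp_mono[OF p LB])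
    show "norm (v x) \<le> (B * M) * norm (indicat_real (cball 0 r) x)" for x
      using prodb[OF qb(1) M(1) BM(1), of x "w x"] C(5)[of x] Q0(2)[of x]
      by (cases "norm x > r") (auto simp: v_def)
  qed simp
  have HL: "in_Lp p H"
    unfolding H_def
  proof (rule in_Lp_add[OF p])
    show "in_Lp p (\<lambda>x. (q' x * R (w x)) *\<^sub>R grad \<phi> x)"
    proof (rule in_Lp_mono[OF p in_Lp_test(2)[OF \<phi> p]])
      show "norm ((q' x * R (w x)) *\<^sub>R grad \<phi> x) \<le> (B' * M) * norm (grad \<phi> x)" for x
        unfolding norm_scaleR by (intro mult_right_mono prodb qb M BM) simp
    qed simp
    show "in_Lp p (\<lambda>x. (q x * R' (w x)) *\<^sub>R G x)"
    proof (rule in_Lp_mono[OF p test_limitD(2)[OF w]])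
      show "norm ((q x * R' (w x)) *\<^sub>R G x) \<le> (B * M) * norm (G x)" for x
        unfolding norm_scaleR by (intro mult_right_mono prodb qb M BM) simp
    qed simp
  qed
  have lim1: "(\<lambda>k. int_powr p (\<lambda>x. V k x - v x)) \<longlonglongrightarrow> 0"
  proof (rule int_powr_dominated_tendsto_0[OF p _ LB])
    show "norm (V k x - v x) \<le> (2 * (B * M)) * norm (indicat_real (cball 0 r) x)" for k x
    proof (cases "norm x > r")
      case True
      then show ?thesis using C(5)[of x] Q0[of x] by (simp add: V_def v_def)
    next
      case False
      then show ?thesis
        using prodb[OF qb(1)[of x] M(1)[of "w x"] BM(1)] prodb[OF Qb(1)[of k x] M(1)[of "\<psi> k x"] BM(1)]
        by (simp add: V_def v_def)
    qed
    show "AE x in lborel. (\<lambda>k. V k x - v x) \<longlonglongrightarrow> 0"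
      using Rl
    proof (rule AE_mp, intro AE_I2 impI)
      fix x assume "(\<lambda>k. R (\<psi> k x)) \<longlonglongrightarrow> R (w x) \<and> (\<lambda>k. R' (\<psi> k x)) \<longlonglongrightarrow> R' (w x)"
      then have "(\<lambda>k. V k x) \<longlonglongrightarrow> v x" unfolding V_def v_def by (intro tendsto_mult Ql) auto
      then show "(\<lambda>k. V k x - v x) \<longlonglongrightarrow> 0" by (rule LIM_zero)
    qed
  qed simp
  \<comment> \<open>The error of the gradients splits into three parts: the coefficients of \<open>grad \<phi>\<close>, the error
    \<open>grad (\<psi> k) - G\<close> with a bounded coefficient, and the coefficients of \<open>G\<close>.\<close>
  define e1 where "e1 k x = (R (\<psi> k x) * Q' k x - R (w x) * q' x) *\<^sub>R grad \<phi> x" for k x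
  define e2 where "e2 k x = (Q k x * R' (\<psi> k x)) *\<^sub>R (grad (\<psi> k) x - G x)" for k x
  define e3 where "e3 k x = (Q k x * R' (\<psi> k x) - q x * R' (w x)) *\<^sub>R G x" for k x
  have [measurable]: "e1 k \<in> borel_measurable borel" "e2 k \<in> borel_measurable borel" "e3 k \<in> borel_measurable borel" for k
    unfolding e1_def e2_def e3_def by measurable
  have b1: "norm (e1 k x) \<le> (2 * (B' * M)) * norm (grad \<phi> x)" for k x
    unfolding e1_def norm_scaleR
    using prodb[OF qb(2)[of x] M(1)[of "w x"] BM(2)] prodb[OF Qb(2)[of k x] M(1)[of "\<psi> k x"] BM(2)]
    by (intro mult_right_mono) (simp_all add: mult.commute[of "R _"])
  have b2: "norm (e2 k x) \<le> (B * M) * norm (grad (\<psi> k) x - G x)" for k x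
    unfolding e2_def norm_scaleR by (intro mult_right_mono prodb Qb M BM) simp
  have b3: "norm (e3 k x) \<le> (2 * (B * M)) * norm (G x)" for k x
    unfolding e3_def norm_scaleR
    using prodb[OF qb(1)[of x] M(2)[of "w x"] BM(1)] prodb[OF Qb(1)[of k x] M(2)[of "\<psi> k x"] BM(1)]
    by (intro mult_right_mono) simp_all
  have ed: "in_Lp p (\<lambda>x. grad (\<psi> k) x - G x)" for k
    by (rule in_Lp_diff[OF p in_Lp_test(2)[OF \<psi>(1) p] test_limitD(2)[OF w]])
  have L1: "in_Lp p (e1 k)" for k by (rule in_Lp_mono[OF p in_Lp_test(2)[OF \<phi> p] _ b1]) simp
  have L2: "in_Lp p (e2 k)" for k by (rule in_Lp_mono[OF p ed _ b2]) simp
  have L3: "in_Lp p (e3 k)" for k by (rule in_Lp_mono[OF p test_limitD(2)[OF w] _ b3]) simp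
  have l1: "(\<lambda>k. int_powr p (e1 k)) \<longlonglongrightarrow> 0"
  proof (rule int_powr_dominated_tendsto_0[OF p _ in_Lp_test(2)[OF \<phi> p] b1])
    show "AE x in lborel. (\<lambda>k. e1 k x) \<longlonglongrightarrow> 0"
      using Rl
    proof (rule AE_mp, intro AE_I2 impI)
      fix x assume "(\<lambda>k. R (\<psi> k x)) \<longlonglongrightarrow> R (w x) \<and> (\<lambda>k. R' (\<psi> k x)) \<longlonglongrightarrow> R' (w x)"
      then have "(\<lambda>k. e1 k x) \<longlonglongrightarrow> (R (w x) * q' x - R (w x) * q' x) *\<^sub>R grad \<phi> x"
        unfolding e1_def by (intro tendsto_intros Ql) auto
      then show "(\<lambda>k. e1 k x) \<longlonglongrightarrow> 0" by simp
    qed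
  qed simp
  have l3: "(\<lambda>k. int_powr p (e3 k)) \<longlonglongrightarrow> 0"
  proof (rule int_powr_dominated_tendsto_0[OF p _ test_limitD(2)[OF w] b3])
    show "AE x in lborel. (\<lambda>k. e3 k x) \<longlonglongrightarrow> 0"
      using Rl
    proof (rule AE_mp, intro AE_I2 impI)
      fix x assume "(\<lambda>k. R (\<psi> k x)) \<longlonglongrightarrow> R (w x) \<and> (\<lambda>k. R' (\<psi> k x)) \<longlonglongrightarrow> R' (w x)"
      then have "(\<lambda>k. e3 k x) \<longlonglongrightarrow> (q x * R' (w x) - q x * R' (w x)) *\<^sub>R G x"
        unfolding e3_def by (intro tendsto_intros Ql) auto
      then show "(\<lambda>k. e3 k x) \<longlonglongrightarrow> 0" by simp
    qed
  qed simp
  have l2: "(\<lambda>k. int_powr p (e2 k)) \<longlonglongrightarrow> 0"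
  proof (rule tendsto_sandwich[OF _ _ tendsto_const])
    have "(\<lambda>k. (B * M) powr p * int_powr p (\<lambda>x. grad (\<psi> k) x - G x)) \<longlonglongrightarrow> (B * M) powr p * 0"
      by (intro tendsto_mult tendsto_const \<psi>(3))
    then show "(\<lambda>k. (B * M) powr p * int_powr p (\<lambda>x. grad (\<psi> k) x - G x)) \<longlonglongrightarrow> 0" by simp
    have "int_powr p (e2 k) \<le> (LINT x|lborel. (B * M) powr p * norm (grad (\<psi> k) x - G x) powr p)" for k
    proof (rule integral_mono)
      show "norm (e2 k x) powr p \<le> (B * M) powr p * norm (grad (\<psi> k) x - G x) powr p" for x
      proof -
        have "norm (e2 k x) powr p \<le> ((B * M) * norm (grad (\<psi> k) x - G x)) powr p"
          using b2 p by (intro powr_mono2) auto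
        then show ?thesis by (simp add: powr_mult)
      qed
    qed (intro in_LpD(2)[OF L2] integrable_mult_right in_LpD(2)[OF ed])+
    then show "\<forall>\<^sub>F k in sequentially. int_powr p (e2 k) \<le> (B * M) powr p * int_powr p (\<lambda>x. grad (\<psi> k) x - G x)"
      by simp
    show "\<forall>\<^sub>F k in sequentially. 0 \<le> int_powr p (e2 k)" by simp
  qed
  have "(\<lambda>k. int_powr p (\<lambda>x. e1 k x + (e2 k x + e3 k x))) \<longlonglongrightarrow> 0"
    by (rule int_powr_add_tendsto_0[OF p L1 in_Lp_add[OF p L2 L3] l1 int_powr_add_tendsto_0[OF p L2 L3 l2 l3]])
  moreover have "e1 k x + (e2 k x + e3 k x) = grad (V k) x - H x" for k x
    unfolding grad_V H_def e1_def e2_def e3_def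
    by (simp add: algebra_simps)
  ultimately have lim2: "(\<lambda>k. int_powr p (\<lambda>x. grad (V k) x - H x)) \<longlonglongrightarrow> 0" by simp
  have zero: "v x = 0 \<and> H x = 0" if "x \<notin> \<Omega>" for x
    using test_outside[OF \<phi> that] Q0(2)[of x] by (simp add: v_def H_def)
  have "test_limit p \<Omega> v H"
    unfolding test_limit_def
    using vL HL zero V_test lim1 lim2 by (intro conjI exI[of _ V]) auto
  then show ?thesis
    unfolding v_def[abs_def] H_def[abs_def] q_def q'_def .
qed

section \<open>The weak form on Borel representatives\<close>

definition nonlocal_kernel ::
    "real \<Rightarrow> real \<Rightarrow> ('a::euclidean_space \<Rightarrow> real) \<Rightarrow> ('a \<Rightarrow> real) \<Rightarrow> 'a \<times> 'a \<Rightarrow> real" where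
  "nonlocal_kernel p s u v z = F p (u (fst z) - u (snd z)) * (v (fst z) - v (snd z)) /
     norm (fst z - snd z) powr (real DIM('a) + p * s)"

definition Borel_form ::
    "real \<Rightarrow> real \<Rightarrow> real \<Rightarrow> real \<Rightarrow> ('a::euclidean_space \<Rightarrow> real) \<Rightarrow> ('a \<Rightarrow> 'a) \<Rightarrow>
      ('a \<Rightarrow> real) \<Rightarrow> ('a \<Rightarrow> 'a) \<Rightarrow> real" where
  "Borel_form p s \<theta> \<mu> u G v H =
     (LINT x|lborel. norm (G x) powr (p - 2) * (G x \<bullet> H x)) + (LINT z|lborel. nonlocal_kernel p s u v z)
     - \<mu> * (LINT x|lborel. F p (u x) * v x / norm x powr (p * \<theta>))"

lemma F_measurable [measurable]: "F p \<in> borel_measurable borel"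
  unfolding F_def by measurable

lemma F_abs: "\<bar>F p t\<bar> = \<bar>t\<bar> powr (p - 1)"
  by (cases "t = 0") (auto simp: F_def abs_mult powr_diff field_simps power2_eq_square powr_numeral)

lemma F_nonneg: "t \<ge> 0 \<Longrightarrow> F p t = t powr (p - 1)"
  using F_abs[of p t] by (simp add: F_def)

lemma F_minus: "F p (- t) = - F p t"
  by (simp add: F_def)

lemma F_mult_self: "F p t * t = \<bar>t\<bar> powr p"
  by (cases "t = 0") (auto simp: F_def powr_diff field_simps power2_eq_square powr_numeral)

lemma F_mult_le:
  assumes "p > 1"
  shows "\<bar>F p a * b\<bar> \<le> \<bar>a\<bar> powr p + \<bar>b\<bar> powr p"
proof -
  have "p * (\<bar>a\<bar> powr (p - 1) * \<bar>b\<bar>) \<le> \<bar>b\<bar> powr p + (p - 1) * \<bar>a\<bar> powr p"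
    by (rule Young_powr[OF assms]) auto
  also have "\<dots> \<le> p * \<bar>b\<bar> powr p + p * \<bar>a\<bar> powr p"
    using assms by (intro add_mono mult_right_mono) (auto simp: mult_le_cancel_right1)
  also have "\<dots> = p * (\<bar>a\<bar> powr p + \<bar>b\<bar> powr p)" by (simp add: algebra_simps)
  finally show ?thesis using assms by (simp add: abs_mult F_abs)
qed

lemma nonlocal_kernel_measurable:
  fixes u v :: "'a::euclidean_space \<Rightarrow> real"
  assumes [measurable]: "u \<in> borel_measurable borel" "v \<in> borel_measurable borel"
  shows "nonlocal_kernel p s u v \<in> borel_measurable borel"
  unfolding nonlocal_kernel_def[abs_def] borel_prod[symmetric] by measurable

lemma Gagliardo_kernel_nonneg: "Gagliardo_kernel p s u z \<ge> 0"
  by (simp add: Gagliardo_kernel_def)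

lemma Gagliardo_kernel_integrable:
  fixes u :: "'a::euclidean_space \<Rightarrow> real"
  assumes p: "p > 1" "p < real DIM('a)" and s: "0 < s" "s < 1" and u: "test_limit p \<Omega> u G"
  shows "integrable lborel (Gagliardo_kernel p s u)"
proof (rule integrableI_nonneg)
  show "Gagliardo_kernel p s u \<in> borel_measurable lborel"
    using Gagliardo_kernel_measurable[OF in_LpD(1)[OF test_limitD(1)[OF u]]] by simp
  obtain C where C: "\<forall>\<Omega> u G. test_limit p (\<Omega> :: 'a::euclidean_space set) u G \<longrightarrow>
    Gagliardo p s u \<le> ennreal (C * (int_powr p u + int_powr p G))"
    using Gagliardo_test_limit[OF p s] by blast
  then have "Gagliardo p s u \<le> ennreal (C * (int_powr p u + int_powr p G))" using u by blast
  then show "(\<integral>\<^sup>+ x. ennreal (Gagliardo_kernel p s u x) \<partial>lborel) < \<infinity>"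
    unfolding Gagliardo_def by (rule order_le_less_trans) simp
qed (simp add: Gagliardo_kernel_nonneg)

lemma nonlocal_kernel_bound:
  assumes "p > 1"
  shows "\<bar>nonlocal_kernel p s u v z\<bar> \<le> Gagliardo_kernel p s u z + Gagliardo_kernel p s v z"
  using F_mult_le[OF assms, of "u (fst z) - u (snd z)" "v (fst z) - v (snd z)"]
  by (simp add: nonlocal_kernel_def Gagliardo_kernel_def abs_divide add_divide_distrib[symmetric] divide_right_mono)

lemma nonlocal_kernel_integrable:
  fixes u v :: "'a::euclidean_space \<Rightarrow> real"
  assumes p: "p > 1" "p < real DIM('a)" and s: "0 < s" "s < 1"
    and u: "test_limit p \<Omega> u G" and v: "test_limit p \<Omega> v H"
  shows "integrable lborel (nonlocal_kernel p s u v)"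
proof (rule Bochner_Integration.integrable_bound)
  show "integrable lborel (\<lambda>z. Gagliardo_kernel p s u z + Gagliardo_kernel p s v z)"
    by (intro Bochner_Integration.integrable_add Gagliardo_kernel_integrable[OF p s u] Gagliardo_kernel_integrable[OF p s v])
  show "nonlocal_kernel p s u v \<in> borel_measurable lborel"
    using nonlocal_kernel_measurable[OF in_LpD(1)[OF test_limitD(1)[OF u]] in_LpD(1)[OF test_limitD(1)[OF v]]] by simp
  show "AE z in lborel. norm (nonlocal_kernel p s u v z) \<le> norm (Gagliardo_kernel p s u z + Gagliardo_kernel p s v z)"
    using nonlocal_kernel_bound[OF p(1), of s u v] Gagliardo_kernel_nonneg[of p s u] Gagliardo_kernel_nonneg[of p s v]
    by (intro AE_I2) simp
qed

lemma LINT_lebesgue_AE: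
  fixes f g :: "'a::euclidean_space \<Rightarrow> real"
  assumes "g \<in> borel_measurable borel" "AE x in lborel. f x = g x"
  shows "(LINT x|lebesgue. f x) = (LINT x|lborel. g x)"
  using LINT_lebesgue_cong_AE[of g UNIV f] assms by (simp add: set_lebesgue_integral_def)

text \<open>
  Changing \<open>u\<close> and \<open>v\<close> on null sets changes the iterated integral only through null sets of \<open>y\<close>
  and, for each other \<open>y\<close>, null sets of \<open>x\<close>. Once the functions are Borel, finiteness of
  the Gagliardo seminorms permits Fubini's theorem.
\<close>

lemma T_form_represents:
  fixes u v :: "'a::euclidean_space \<Rightarrow> real"
  assumes p: "p > 1" "p < real DIM('a)" and s: "0 < s" "s < 1"
    and u: "represents p \<Omega> u u0 G" and v: "represents p \<Omega> v v0 H"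
  shows "T_form p s \<theta> \<mu> \<Omega> u v = Borel_form p s \<theta> \<mu> u0 G v0 H"
    and "(LINT x:\<Omega>|lebesgue. F p (u x) * v x) = (LINT x|lborel. F p (u0 x) * v0 x)"
proof -
  have tu: "test_limit p \<Omega> u0 G" and tv: "test_limit p \<Omega> v0 H"
    and ae: "AE x in lborel. u x = u0 x" "AE x in lborel. v x = v0 x"
      "AE x in lborel. x \<in> \<Omega> \<longrightarrow> weak_grad \<Omega> u x = G x" "AE x in lborel. x \<in> \<Omega> \<longrightarrow> weak_grad \<Omega> v x = H x"
    using u v by (auto simp: represents_def)
  note [measurable] = in_LpD(1)[OF test_limitD(1)[OF tu]] in_LpD(1)[OF test_limitD(2)[OF tu]]
    in_LpD(1)[OF test_limitD(1)[OF tv]] in_LpD(1)[OF test_limitD(2)[OF tv]]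
  note zero = test_limitD(3,4)[OF tu] test_limitD(3,4)[OF tv]
  have F0: "F p 0 = 0" by (simp add: F_def)
  have 1: "(LINT x:\<Omega>|lebesgue. norm (weak_grad \<Omega> u x) powr (p - 2) * (weak_grad \<Omega> u x \<bullet> weak_grad \<Omega> v x))
      = (LINT x|lborel. norm (G x) powr (p - 2) * (G x \<bullet> H x))"
  proof (rule LINT_lebesgue_cong_AE)
    show "AE x in lborel. x \<in> \<Omega> \<longrightarrow> norm (weak_grad \<Omega> u x) powr (p - 2) * (weak_grad \<Omega> u x \<bullet> weak_grad \<Omega> v x)
        = norm (G x) powr (p - 2) * (G x \<bullet> H x)"
      using ae(3,4) by eventually_elim simp
  qed (simp_all add: zero)
  have 2: "(LINT x:\<Omega>|lebesgue. F p (u x) * v x / norm x powr (p * \<theta>))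
      = (LINT x|lborel. F p (u0 x) * v0 x / norm x powr (p * \<theta>))"
  proof (rule LINT_lebesgue_cong_AE)
    show "AE x in lborel. x \<in> \<Omega> \<longrightarrow> F p (u x) * v x / norm x powr (p * \<theta>) = F p (u0 x) * v0 x / norm x powr (p * \<theta>)"
      using ae(1,2) by eventually_elim simp
  qed (simp_all add: zero)
  show "(LINT x:\<Omega>|lebesgue. F p (u x) * v x) = (LINT x|lborel. F p (u0 x) * v0 x)"
  proof (rule LINT_lebesgue_cong_AE)
    show "AE x in lborel. x \<in> \<Omega> \<longrightarrow> F p (u x) * v x = F p (u0 x) * v0 x"
      using ae(1,2) by eventually_elim simp
  qed (simp_all add: zero)
  define k where "k x y = F p (u0 x - u0 y) * (v0 x - v0 y) / norm (x - y) powr (real DIM('a) + p * s)" for x y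
  have km [measurable]: "case_prod k \<in> borel_measurable (borel \<Otimes>\<^sub>M borel)" unfolding k_def by measurable
  have kk: "case_prod k = nonlocal_kernel p s u0 v0"
    by (auto simp: k_def nonlocal_kernel_def fun_eq_iff)
  have "(LINT y|lebesgue. LINT x|lebesgue. F p (u x - u y) * (v x - v y) / norm (x - y) powr (real DIM('a) + p * s))
      = (LINT y|lborel. LINT x|lborel. k x y)"
  proof (rule LINT_lebesgue_AE)
    show "(\<lambda>y. LINT x|lborel. k x y) \<in> borel_measurable borel"
      using lborel.borel_measurable_lebesgue_integral[of "\<lambda>y x. k x y" borel] by measurable
    show "AE y in lborel. (LINT x|lebesgue. F p (u x - u y) * (v x - v y) / norm (x - y) powr (real DIM('a) + p * s))
        = (LINT x|lborel. k x y)"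
      using ae(1,2)
    proof eventually_elim
      fix y assume y: "u y = u0 y" "v y = v0 y"
      show "(LINT x|lebesgue. F p (u x - u y) * (v x - v y) / norm (x - y) powr (real DIM('a) + p * s))
        = (LINT x|lborel. k x y)"
      proof (rule LINT_lebesgue_AE)
        show "(\<lambda>x. k x y) \<in> borel_measurable borel" unfolding k_def by measurable
        show "AE x in lborel. F p (u x - u y) * (v x - v y) / norm (x - y) powr (real DIM('a) + p * s) = k x y"
          using ae(1,2) by eventually_elim (simp add: y k_def)
      qed
    qed
  qed
  also have "\<dots> = (LINT z|lborel. nonlocal_kernel p s u0 v0 z)"
    using lborel_pair.integral_snd[of k] nonlocal_kernel_integrable[OF p s tu tv]
    by (simp add: kk lborel_prod)
  finally show "T_form p s \<theta> \<mu> \<Omega> u v = Borel_form p s \<theta> \<mu> u0 G v0 H"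
    unfolding T_form_def Borel_form_def 1 2 by simp
qed

lemma energy_eq_T_form: "energy p s \<theta> \<mu> \<Omega> u = T_form p s \<theta> \<mu> \<Omega> u u"
proof -
  have 1: "norm x powr (p - 2) * (x \<bullet> x) = norm x powr p" for x :: 'a
    by (cases "x = 0") (auto simp: powr_diff dot_square_norm powr_numeral)
  show ?thesis
    unfolding energy_def T_form_def by (simp add: 1 F_mult_self mult.commute[of s p])
qed

section \<open>Picone inequalities\<close>

text \<open>
  In the applications \<open>A = g a\<close> and \<open>B = g b\<close> for a regularised identity \<open>g\<close> that does not contract
  distances. If the second factor is positive, \<open>a - b\<close> may be replaced by the larger \<open>A - B\<close>, and
  division by \<open>A\<^sup>p\<^sup>-\<^sup>1\<close> turns the claim into the convexity inequality
  \<open>U\<^sup>p \<le> t\<^sup>1\<^sup>-\<^sup>p V\<^sup>p + (1 - t)\<^sup>1\<^sup>-\<^sup>p \<bar>U - V\<bar>\<^sup>p\<close> with \<open>t = B / A\<close>.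
\<close>

lemma Picone_discrete_ordered:
  fixes a b A B U V :: real
  assumes p: "p > 1" and ab: "b \<le> a" and AB: "A > 0" "B > 0" "a - b \<le> A - B" and UV: "U \<ge> 0" "V \<ge> 0"
  shows "F p (a - b) * (U powr p * A powr (1 - p) - V powr p * B powr (1 - p)) \<le> \<bar>U - V\<bar> powr p"
proof -
  define X where "X = U powr p * A powr (1 - p) - V powr p * B powr (1 - p)"
  have F: "F p (a - b) = (a - b) powr (p - 1)" using ab by (simp add: F_nonneg)
  show ?thesis
  proof (cases "X \<le> 0 \<or> A = B")
    case True
    then have "F p (a - b) * X \<le> 0"
    proof
      assume "X \<le> 0"
      then show ?thesis unfolding F by (intro mult_nonneg_nonpos) auto
    next
      assume "A = B"
      then have "a - b = 0" using ab AB by simp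
      then show ?thesis by (simp add: F_def)
    qed
    then show ?thesis unfolding X_def[symmetric] by (rule order_trans) simp
  next
    case False
    then have AltB: "B < A" and X: "X > 0" using AB ab by auto
    define t where "t = B / A"
    have t: "0 < t" "t < 1" using AB AltB by (auto simp: t_def)
    have e1: "(A - B) powr (p - 1) * A powr (1 - p) = (1 - t) powr (p - 1)"
    proof -
      have "A - B = A * (1 - t)" using AB by (simp add: t_def field_simps)
      then have "(A - B) powr (p - 1) = A powr (p - 1) * (1 - t) powr (p - 1)"
        using AB t by (simp add: powr_mult)
      moreover have "A powr (p - 1) * A powr (1 - p) = 1"
        using AB by (simp add: powr_add[symmetric])
      ultimately show ?thesis by (simp add: mult.assoc mult.left_commute)
    qed
    have e2: "B powr (1 - p) = t powr (1 - p) * A powr (1 - p)"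
      using AB t by (simp add: t_def powr_divide)
    have e3: "(1 - t) powr (p - 1) * (1 - t) powr (1 - p) = 1"
      using t by (simp add: powr_add[symmetric])
    have U: "U powr p \<le> t powr (1 - p) * V powr p + (1 - t) powr (1 - p) * \<bar>U - V\<bar> powr p"
      using norm_powr_split[OF p t, of U V] UV by simp
    have "F p (a - b) * X \<le> (A - B) powr (p - 1) * X"
      unfolding F using ab AB X p by (intro mult_right_mono powr_mono2) auto
    also have "\<dots> = ((A - B) powr (p - 1) * A powr (1 - p)) * (U powr p - t powr (1 - p) * V powr p)"
      unfolding X_def e2 by (simp add: algebra_simps)
    also have "\<dots> = (1 - t) powr (p - 1) * (U powr p - t powr (1 - p) * V powr p)"
      unfolding e1 ..
    also have "\<dots> \<le> (1 - t) powr (p - 1) * ((1 - t) powr (1 - p) * \<bar>U - V\<bar> powr p)"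
      using U by (intro mult_left_mono) auto
    also have "\<dots> = \<bar>U - V\<bar> powr p"
      by (simp only: mult.assoc[symmetric] e3 mult_1_left)
    finally show ?thesis unfolding X_def .
  qed
qed

lemma Picone_discrete:
  fixes a b A B U V :: real
  assumes p: "p > 1" and AB: "A > 0" "B > 0" and UV: "U \<ge> 0" "V \<ge> 0"
    and le: "b \<le> a \<Longrightarrow> a - b \<le> A - B" "a \<le> b \<Longrightarrow> b - a \<le> B - A"
  shows "F p (a - b) * (U powr p * A powr (1 - p) - V powr p * B powr (1 - p)) \<le> \<bar>U - V\<bar> powr p"
proof (cases "b \<le> a")
  case True
  then show ?thesis by (intro Picone_discrete_ordered p AB UV le)
next
  case False
  then have ba: "a \<le> b" by simp
  have "F p (b - a) * (V powr p * B powr (1 - p) - U powr p * A powr (1 - p)) \<le> \<bar>V - U\<bar> powr p"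
    by (intro Picone_discrete_ordered p AB UV le ba)
  moreover have "F p (b - a) = - F p (a - b)" using F_minus[of p "a - b"] by simp
  ultimately show ?thesis by (simp add: abs_minus_commute algebra_simps)
qed

text \<open>
  Here \<open>g\<close>, \<open>h\<close>, \<open>f\<close> and \<open>A\<close> stand for \<open>\<nabla>w\<close>, \<open>\<nabla>\<phi>\<close>, \<open>\<phi>\<close> and a regularisation of \<open>w\<close> with slope
  \<open>d\<close>. The claim is Young's inequality with \<open>m = \<bar>f\<bar> \<bar>g\<bar> / A\<close>; a slope \<open>d \<ge> 1\<close> only makes the
  negative term larger in absolute value.
\<close>

lemma Picone_local:
  fixes g h :: "'a::euclidean_space"
  assumes p: "p > 1" and A: "A > 0" and d: "d \<ge> 1"
  shows "norm g powr (p - 2) * (g \<bullet> ((p * F p f * A powr (1 - p)) *\<^sub>R h + (\<bar>f\<bar> powr p * ((1 - p) * A powr (- p) * d)) *\<^sub>R g))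
    \<le> norm h powr p"
proof -
  define m where "m = \<bar>f\<bar> * norm g / A"
  have m: "m \<ge> 0" using A by (simp add: m_def)
  have m1: "m powr (p - 1) = \<bar>f\<bar> powr (p - 1) * norm g powr (p - 1) * A powr (1 - p)"
    using A by (simp add: m_def powr_divide powr_mult powr_minus_divide[of A "p - 1", simplified])
  have mp: "m powr p = \<bar>f\<bar> powr p * norm g powr p * A powr (- p)"
    using A by (simp add: m_def powr_divide powr_mult powr_minus_divide)
  have g1: "norm g powr (p - 2) * norm g = norm g powr (p - 1)"
    by (cases "g = 0") (auto simp: powr_diff powr_numeral power2_eq_square field_simps)
  have g2: "norm g powr (p - 2) * (g \<bullet> g) = norm g powr p"
    by (cases "g = 0") (auto simp: powr_diff dot_square_norm powr_numeral)
  have first: "norm g powr (p - 2) * (p * F p f * A powr (1 - p)) * (g \<bullet> h) \<le> p * (m powr (p - 1) * norm h)"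
  proof -
    have "norm g powr (p - 2) * (p * F p f * A powr (1 - p)) * (g \<bullet> h)
        \<le> \<bar>norm g powr (p - 2) * (p * F p f * A powr (1 - p)) * (g \<bullet> h)\<bar>" by simp
    also have "\<dots> = norm g powr (p - 2) * (p * \<bar>f\<bar> powr (p - 1) * A powr (1 - p)) * \<bar>g \<bullet> h\<bar>"
      using p by (simp add: abs_mult F_abs)
    also have "\<dots> \<le> norm g powr (p - 2) * (p * \<bar>f\<bar> powr (p - 1) * A powr (1 - p)) * (norm g * norm h)"
      using p by (intro mult_left_mono Cauchy_Schwarz_ineq2) auto
    also have "\<dots> = p * (\<bar>f\<bar> powr (p - 1) * (norm g powr (p - 2) * norm g) * A powr (1 - p) * norm h)"
      by (simp add: mult_ac)
    also have "\<dots> = p * (m powr (p - 1) * norm h)" unfolding g1 m1 ..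
    finally show ?thesis .
  qed
  have second: "norm g powr (p - 2) * (\<bar>f\<bar> powr p * ((1 - p) * A powr (- p) * d)) * (g \<bullet> g) \<le> (1 - p) * m powr p"
  proof -
    have "norm g powr (p - 2) * (\<bar>f\<bar> powr p * ((1 - p) * A powr (- p) * d)) * (g \<bullet> g)
       = (1 - p) * (\<bar>f\<bar> powr p * (norm g powr (p - 2) * (g \<bullet> g)) * A powr (- p)) * d" by (simp add: mult_ac)
    also have "\<dots> = (1 - p) * m powr p * d" unfolding g2 mp ..
    also have "\<dots> \<le> (1 - p) * m powr p * 1"
      using p d by (intro mult_left_mono_neg mult_nonpos_nonneg) auto
    finally show ?thesis by simp
  qed
  have "norm g powr (p - 2) * (g \<bullet> ((p * F p f * A powr (1 - p)) *\<^sub>R h + (\<bar>f\<bar> powr p * ((1 - p) * A powr (- p) * d)) *\<^sub>R g))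
    = norm g powr (p - 2) * (p * F p f * A powr (1 - p)) * (g \<bullet> h)
      + norm g powr (p - 2) * (\<bar>f\<bar> powr p * ((1 - p) * A powr (- p) * d)) * (g \<bullet> g)"
    by (simp add: inner_add_right distrib_left mult.assoc)
  also have "\<dots> \<le> p * (m powr (p - 1) * norm h) + (1 - p) * m powr p"
    by (rule add_mono[OF first second])
  also have "\<dots> \<le> norm h powr p"
    using Young_powr[OF p norm_ge_zero[of h] m] by (simp add: algebra_simps)
  finally show ?thesis .
qed

section \<open>Regularised denominators\<close>

text \<open>
  The denominators \<open>w\<^sup>p\<^sup>-\<^sup>1\<close> are replaced by \<open>g w powr (p - 1)\<close> with \<open>g = pos_shift e\<close>. The simpler choice
  \<open>w + e\<close> is not enough: the test functions approximating \<open>w\<close> may be negative, so \<open>g\<close> has to be smooth and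
  bounded below by a positive constant on the whole line. The two Picone inequalities ask for slope
  at least \<open>1\<close> on \<open>[0, \<infinity>)\<close>, and the limit \<open>e \<rightarrow> 0\<close> for \<open>g t \<rightarrow> t\<close> there. The function
  \<open>(x + sqrt (x\<^sup>2 + e\<^sup>4)) / 2\<close> is a smooth positive part of \<open>x = t + e\<close>; its slope is slightly less than
  \<open>1\<close>, which the factor \<open>sqrt (1 + e\<^sup>2)\<close> makes good. The square root is written as a power because
  smoothness of powers is at hand.
\<close>

definition shift_root :: "real \<Rightarrow> real \<Rightarrow> real" where
  "shift_root e t = ((t + e) * (t + e) + e ^ 4) powr (1 / 2)"

definition pos_shift :: "real \<Rightarrow> real \<Rightarrow> real" where
  "pos_shift e t = sqrt (1 + e\<^sup>2) * (e + ((t + e) + shift_root e t) / 2)"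

definition pos_shift_deriv :: "real \<Rightarrow> real \<Rightarrow> real" where
  "pos_shift_deriv e t = sqrt (1 + e\<^sup>2) * ((1 + (t + e) / shift_root e t) / 2)"

lemma shift_root_arg_pos: "e > 0 \<Longrightarrow> (t + e) * (t + e) + e ^ 4 > (0::real)"
  by (simp add: add_nonneg_pos)

lemma shift_root_eq: "e > 0 \<Longrightarrow> shift_root e t = sqrt ((t + e)\<^sup>2 + e ^ 4)"
  using shift_root_arg_pos[of e t] unfolding shift_root_def
  by (simp add: powr_half_sqrt power2_eq_square less_imp_le)

lemma shift_root_props:
  assumes "e > 0"
  shows "shift_root e t > 0" "\<bar>t + e\<bar> \<le> shift_root e t"
proof -
  show "shift_root e t > 0" unfolding shift_root_def using shift_root_arg_pos[OF assms, of t] by simp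
  show "\<bar>t + e\<bar> \<le> shift_root e t"
    unfolding shift_root_eq[OF assms] by (rule real_le_rsqrt) simp
qed

lemma pos_shift_has_derivative:
  assumes e: "e > 0"
  shows "(pos_shift e has_real_derivative pos_shift_deriv e t) (at t)"
proof -
  note pos = shift_root_arg_pos[OF e, of t]
  have 1: "((\<lambda>t. (t + e) * (t + e) + e ^ 4) has_real_derivative 2 * (t + e)) (at t)"
    by (auto intro!: derivative_eq_intros)
  have "((\<lambda>t. ((t + e) * (t + e) + e ^ 4) powr (1 / 2)) has_real_derivative
      (1 / 2) * ((t + e) * (t + e) + e ^ 4) powr (1 / 2 - real (Suc 0)) * (2 * (t + e))) (at t)"
    using DERIV_fun_powr[OF 1 pos, of "1 / 2"] by simp
  also have "((t + e) * (t + e) + e ^ 4) powr (1 / 2 - real (Suc 0)) = 1 / shift_root e t"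
  proof -
    have "(1 / 2 - real (Suc 0)) = - (1 / 2)" by simp
    then show ?thesis unfolding shift_root_def by (simp only: powr_minus_divide)
  qed
  finally have 2: "((\<lambda>t. shift_root e t) has_real_derivative (t + e) / shift_root e t) (at t)"
    unfolding shift_root_def[abs_def] by (simp add: add_divide_distrib)
  show ?thesis
    unfolding pos_shift_def[abs_def] pos_shift_deriv_def
    by (auto intro!: derivative_eq_intros 2)
qed

lemma pos_shift_lower:
  assumes e: "e > 0"
  shows "e \<le> pos_shift e t"
proof -
  have "0 \<le> (t + e) + shift_root e t" using shift_root_props(2)[OF e, of t] by linarith
  then have "e \<le> 1 * (e + ((t + e) + shift_root e t) / 2)" by simp
  also have "\<dots> \<le> pos_shift e t"
    unfolding pos_shift_def using e \<open>0 \<le> (t + e) + shift_root e t\<close> by (intro mult_right_mono) auto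
  finally show ?thesis .
qed

lemma pos_shift_deriv_bounds:
  assumes e: "e > 0"
  shows "0 \<le> pos_shift_deriv e t" "pos_shift_deriv e t \<le> sqrt (1 + e\<^sup>2)"
    and "t \<ge> 0 \<Longrightarrow> 1 \<le> pos_shift_deriv e t"
proof -
  let ?K = "sqrt (1 + e\<^sup>2)" and ?q = "(t + e) / shift_root e t"
  have q: "\<bar>?q\<bar> \<le> 1" using shift_root_props[OF e, of t] by (simp add: abs_divide)
  then have q': "- 1 \<le> ?q" "?q \<le> 1" unfolding abs_le_iff by linarith+
  show "0 \<le> pos_shift_deriv e t" unfolding pos_shift_deriv_def using q' by (intro mult_nonneg_nonneg) auto
  have "?K * ((1 + ?q) / 2) \<le> ?K * 1" using q' by (intro mult_left_mono) auto
  then show "pos_shift_deriv e t \<le> ?K" unfolding pos_shift_deriv_def by simp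
  assume t: "t \<ge> 0"
  \<comment> \<open>This is where the factor \<open>sqrt (1 + e\<^sup>2)\<close> and the exponent \<open>4\<close> come from: \<open>e\<^sup>4 \<le> e\<^sup>2 (t + e)\<^sup>2\<close>.\<close>
  have "(t + e)\<^sup>2 + e ^ 4 \<le> (1 + e\<^sup>2) * (t + e)\<^sup>2"
  proof -
    have "e\<^sup>2 * e\<^sup>2 \<le> e\<^sup>2 * (t + e)\<^sup>2" using e t by (intro mult_left_mono power_mono) auto
    then show ?thesis by (simp add: algebra_simps power4_eq_xxxx power2_eq_square)
  qed
  then have "shift_root e t \<le> sqrt ((1 + e\<^sup>2) * (t + e)\<^sup>2)"
    unfolding shift_root_eq[OF e] by (rule real_sqrt_le_mono)
  also have "\<dots> = ?K * (t + e)" using e t by (simp add: real_sqrt_mult)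
  finally have "1 \<le> ?K * ?q" using shift_root_props(1)[OF e, of t] by (simp add: le_divide_eq)
  moreover have "1 \<le> ?K" by simp
  moreover have "1 \<le> (x + y) / 2" if "1 \<le> y" "1 \<le> x" for x y :: real using that by simp
  ultimately have "1 \<le> (?K + ?K * ?q) / 2" by blast
  then show "1 \<le> pos_shift_deriv e t" unfolding pos_shift_deriv_def by (simp add: distrib_left)
qed

lemma pos_shift_expand:
  assumes e: "e > 0" and ba: "0 \<le> b" "b \<le> a"
  shows "a - b \<le> pos_shift e a - pos_shift e b"
proof -
  have "pos_shift e b - b \<le> pos_shift e a - a"
  proof (rule DERIV_nonneg_imp_nondecreasing[OF ba(2)])
    fix x assume "b \<le> x" "x \<le> a"
    then show "\<exists>y. ((\<lambda>x. pos_shift e x - x) has_real_derivative y) (at x) \<and> 0 \<le> y"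
      using pos_shift_deriv_bounds(3)[OF e, of x] ba
      by (intro exI[of _ "pos_shift_deriv e x - 1"] conjI DERIV_diff pos_shift_has_derivative[OF e] DERIV_ident) auto
  qed
  then show ?thesis by linarith
qed

lemma pos_shift_ge:
  assumes e: "e > 0" and t: "0 \<le> t"
  shows "t \<le> pos_shift e t"
  using pos_shift_expand[OF e order_refl t] pos_shift_lower[OF e, of 0] e by linarith

lemma pos_shift_tendsto:
  assumes e: "\<And>k. e k > 0" "e \<longlonglongrightarrow> 0" and t: "t \<ge> 0"
  shows "(\<lambda>k. pos_shift (e k) t) \<longlonglongrightarrow> t"
proof -
  have "(\<lambda>k. sqrt (1 + (e k)\<^sup>2) * (e k + ((t + e k) + sqrt ((t + e k)\<^sup>2 + (e k) ^ 4)) / 2))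
      \<longlonglongrightarrow> sqrt (1 + 0\<^sup>2) * (0 + ((t + 0) + sqrt ((t + 0)\<^sup>2 + 0 ^ 4)) / 2)"
    by (intro tendsto_intros e(2)) simp
  then show ?thesis using t by (simp add: pos_shift_def shift_root_eq[OF e(1)])
qed

definition damp :: "real \<Rightarrow> real \<Rightarrow> real \<Rightarrow> real" where
  "damp p e t = pos_shift e t powr (1 - p)"

definition damp_deriv :: "real \<Rightarrow> real \<Rightarrow> real \<Rightarrow> real" where
  "damp_deriv p e t = (1 - p) * pos_shift e t powr (- p) * pos_shift_deriv e t"

lemma pos_shift_pos: "e > 0 \<Longrightarrow> pos_shift e t > 0"
  using pos_shift_lower[of e t] by linarith

lemma Ck_damp:
  fixes f :: "'a::euclidean_space \<Rightarrow> real"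
  assumes e: "e > 0" and f: "Ck k f"
  shows "Ck k (\<lambda>x. damp p e (f x))"
proof -
  have fe: "Ck k (\<lambda>x. f x + e)" by (rule Ck_add[OF f Ck_const])
  have r: "Ck k (\<lambda>x. shift_root e (f x))"
    unfolding shift_root_def
    by (rule Ck_powr[OF Ck_add[OF Ck_mult[OF fe fe] Ck_const]]) (rule shift_root_arg_pos[OF e])
  have "Ck k (\<lambda>x. sqrt (1 + e\<^sup>2) * (e + (1 / 2) * ((f x + e) + shift_root e (f x))))"
    by (intro Ck_cmult Ck_add Ck_const f r)
  then have "Ck k (\<lambda>x. pos_shift e (f x))" by (simp add: pos_shift_def)
  then show ?thesis unfolding damp_def by (rule Ck_powr) (rule pos_shift_pos[OF e])
qed

lemma damp_has_derivative:
  assumes e: "e > 0"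
  shows "(damp p e has_real_derivative damp_deriv p e t) (at t)"
proof -
  have "((\<lambda>t. pos_shift e t powr (1 - p)) has_real_derivative
      (1 - p) * pos_shift e t powr (1 - p - real (Suc 0)) * pos_shift_deriv e t) (at t)"
    using DERIV_fun_powr[OF pos_shift_has_derivative[OF e] pos_shift_pos[OF e], of "1 - p" t] by simp
  moreover have "1 - p - real (Suc 0) = - p" by simp
  ultimately show ?thesis by (simp only: damp_def[abs_def] damp_deriv_def)
qed

lemma damp_deriv_continuous:
  assumes e: "e > 0"
  shows "continuous_on UNIV (damp_deriv p e)"
proof -
  have c1: "continuous_on UNIV (pos_shift e)"
    using pos_shift_has_derivative[OF e] by (meson DERIV_isCont continuous_at_imp_continuous_on)
  have c2: "continuous_on UNIV (shift_root e)"
  proof -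
    have "shift_root e = (\<lambda>t. sqrt ((t + e)\<^sup>2 + e ^ 4))" using shift_root_eq[OF e] by auto
    then show ?thesis by (auto intro!: continuous_intros)
  qed
  show ?thesis
    unfolding damp_deriv_def[abs_def] pos_shift_deriv_def[abs_def]
    by (intro continuous_intros c1 c2)
      (use shift_root_props(1)[OF e] pos_shift_pos[OF e] in \<open>auto simp: less_imp_neq[THEN not_sym]\<close>)
qed

lemma damp_bounds:
  assumes p: "p > 1" and e: "e > 0"
  shows "\<exists>M. \<forall>t. \<bar>damp p e t\<bar> \<le> M \<and> \<bar>damp_deriv p e t\<bar> \<le> M"
proof -
  define M where "M = e powr (1 - p) + (p - 1) * e powr (- p) * sqrt (1 + e\<^sup>2)"
  have M: "e powr (1 - p) \<le> M" "(p - 1) * e powr (- p) * sqrt (1 + e\<^sup>2) \<le> M"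
    using p by (auto simp: M_def)
  have "\<bar>damp p e t\<bar> \<le> M" for t
  proof -
    have "damp p e t \<le> e powr (1 - p)"
      unfolding damp_def using p e pos_shift_lower[OF e, of t] by (intro powr_mono2') auto
    then show ?thesis using M(1) by (simp add: damp_def)
  qed
  moreover have "\<bar>damp_deriv p e t\<bar> \<le> M" for t
  proof -
    have "\<bar>damp_deriv p e t\<bar> = (p - 1) * pos_shift e t powr (- p) * pos_shift_deriv e t"
      using p pos_shift_deriv_bounds(1)[OF e, of t] by (simp add: damp_deriv_def abs_mult)
    also have "\<dots> \<le> (p - 1) * e powr (- p) * sqrt (1 + e\<^sup>2)"
      using p e pos_shift_lower[OF e, of t] pos_shift_deriv_bounds(1,2)[OF e, of t]
      by (intro mult_mono powr_mono2' mult_nonneg_nonneg) auto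
    finally show ?thesis using M(2) by linarith
  qed
  ultimately show ?thesis by blast
qed

text \<open>
  A regularised version of \<open>\<bar>\<phi>\<bar>\<^sup>p / w\<^sup>p\<^sup>-\<^sup>1\<close>, the test function that Picone's inequality asks for, and
  its weak gradient.
\<close>

definition Picone_test :: "real \<Rightarrow> real \<Rightarrow> ('a \<Rightarrow> real) \<Rightarrow> ('a \<Rightarrow> real) \<Rightarrow> 'a \<Rightarrow> real" where
  "Picone_test p e w \<phi> x = \<bar>\<phi> x\<bar> powr p * damp p e (w x)"

definition Picone_grad ::
    "real \<Rightarrow> real \<Rightarrow> ('a::euclidean_space \<Rightarrow> real) \<Rightarrow> ('a \<Rightarrow> 'a) \<Rightarrow> ('a \<Rightarrow> real) \<Rightarrow> 'a \<Rightarrow> 'a" where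
  "Picone_grad p e w G \<phi> x = (p * F p (\<phi> x) * damp p e (w x)) *\<^sub>R grad \<phi> x
     + (\<bar>\<phi> x\<bar> powr p * damp_deriv p e (w x)) *\<^sub>R G x"

lemma Picone_test_limit:
  assumes p: "p > 1" and e: "e > 0" and w: "test_limit p \<Omega> w G" and \<phi>: "\<phi> \<in> test_functions \<Omega>"
  shows "test_limit p \<Omega> (Picone_test p e w \<phi>) (Picone_grad p e w G \<phi>)"
proof -
  obtain M where M: "\<And>t. \<bar>damp p e t\<bar> \<le> M" "\<And>t. \<bar>damp_deriv p e t\<bar> \<le> M"
    using damp_bounds[OF p e] by blast
  show ?thesis
    unfolding Picone_test_def[abs_def] Picone_grad_def[abs_def]
    by (rule test_limit_abs_powr_mult[OF p w \<phi> Ck_damp[OF e] damp_has_derivative[OF e]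
          damp_deriv_continuous[OF e] M])
qed

lemma Picone_local_pointwise:
  assumes p: "p > 1" and e: "e > 0" and w: "w x \<ge> 0"
  shows "norm (G x) powr (p - 2) * (G x \<bullet> Picone_grad p e w G \<phi> x) \<le> norm (grad \<phi> x) powr p"
  unfolding Picone_grad_def damp_def damp_deriv_def
  by (rule Picone_local[OF p pos_shift_pos[OF e] pos_shift_deriv_bounds(3)[OF e w]])

lemma Picone_nonlocal_pointwise:
  fixes w \<phi> :: "'a::euclidean_space \<Rightarrow> real"
  assumes p: "p > 1" and e: "e > 0" and w: "\<And>x. w x \<ge> 0"
  shows "nonlocal_kernel p s w (Picone_test p e w \<phi>) z \<le> Gagliardo_kernel p s \<phi> z"
proof -
  obtain x y where z: "z = (x, y)" by (cases z)
  have "F p (w x - w y) * (\<bar>\<phi> x\<bar> powr p * pos_shift e (w x) powr (1 - p) - \<bar>\<phi> y\<bar> powr p * pos_shift e (w y) powr (1 - p))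
      \<le> \<bar>\<bar>\<phi> x\<bar> - \<bar>\<phi> y\<bar>\<bar> powr p"
    by (rule Picone_discrete[OF p pos_shift_pos[OF e] pos_shift_pos[OF e]])
      (auto intro: pos_shift_expand[OF e w])
  also have "\<dots> \<le> \<bar>\<phi> x - \<phi> y\<bar> powr p"
    using p by (intro powr_mono2) auto
  finally show ?thesis
    unfolding nonlocal_kernel_def Gagliardo_kernel_def z Picone_test_def damp_def
    by (intro divide_right_mono) simp_all
qed

text \<open>
  For \<open>z = (x, y)\<close> with \<open>w x = 0\<close>, the difference \<open>w x - w y\<close> is a fixed negative number, whereas the
  test function at \<open>x\<close> has the denominator \<open>pos_shift \<epsilon> 0 \<rightarrow> 0\<close>. The product of the two therefore
  tends to \<open>-\<infinity>\<close>, while the contribution of \<open>y\<close> stays bounded. This replaces the strong maximum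
  principle.
\<close>

lemma Picone_defect_blowup:
  fixes w \<phi> :: "'a::euclidean_space \<Rightarrow> real"
  assumes p: "p > 1" and e: "\<And>k. e k > 0" "e \<longlonglongrightarrow> 0"
    and z: "w (fst z) = 0" "\<phi> (fst z) \<noteq> 0" "w (snd z) > 0"
  shows "filterlim (\<lambda>k. Gagliardo_kernel p s \<phi> z - nonlocal_kernel p s w (Picone_test p (e k) w \<phi>) z) at_top sequentially"
proof -
  obtain x y where xy: "z = (x, y)" by (cases z)
  note z = z[unfolded xy fst_conv snd_conv]
  have "x \<noteq> y" using z by auto
  define D where "D = norm (x - y) powr (real DIM('a) + p * s)"
  have D: "D > 0" using \<open>x \<noteq> y\<close> by (simp add: D_def)
  define c where "c = w y powr (p - 1) * \<bar>\<phi> x\<bar> powr p / D"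
  have c: "c > 0" using z D by (simp add: c_def)
  have g0: "filterlim (\<lambda>k. pos_shift (e k) 0) (at_right 0) sequentially"
    unfolding filterlim_at
    using pos_shift_tendsto[OF e, of 0] pos_shift_pos[OF e(1)] by (auto simp: less_imp_neq[THEN not_sym])
  have "filterlim (\<lambda>k. - ln (pos_shift (e k) 0)) at_top sequentially"
    using filterlim_compose[OF ln_at_0 g0] by (simp only: filterlim_uminus_at_bot)
  then have "filterlim (\<lambda>k. exp ((p - 1) * (- ln (pos_shift (e k) 0)))) at_top sequentially"
    using p by (intro filterlim_compose[OF exp_at_top] filterlim_tendsto_pos_mult_at_top[OF tendsto_const]) auto
  moreover have "exp ((p - 1) * (- ln (pos_shift (e k) 0))) = pos_shift (e k) 0 powr (1 - p)" for k
    using pos_shift_pos[OF e(1)[of k], of 0] by (simp add: powr_def algebra_simps)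
  ultimately have "filterlim (\<lambda>k. pos_shift (e k) 0 powr (1 - p)) at_top sequentially" by simp
  then have "filterlim (\<lambda>k. c * pos_shift (e k) 0 powr (1 - p)) at_top sequentially"
    using c by (intro filterlim_tendsto_pos_mult_at_top[OF tendsto_const])
  then have "filterlim (\<lambda>k. - (\<bar>\<phi> y\<bar> powr p / D) + c * pos_shift (e k) 0 powr (1 - p)) at_top sequentially"
    by (rule filterlim_tendsto_add_at_top[OF tendsto_const])
  moreover have "- (\<bar>\<phi> y\<bar> powr p / D) + c * pos_shift (e k) 0 powr (1 - p)
      \<le> Gagliardo_kernel p s \<phi> z - nonlocal_kernel p s w (Picone_test p (e k) w \<phi>) z" for k
  proof -
    have F: "F p (w x - w y) = - (w y powr (p - 1))"
      using z F_minus[of p "w y"] by (simp add: F_nonneg)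
    have "w y powr (p - 1) * pos_shift (e k) (w y) powr (1 - p) \<le> pos_shift (e k) (w y) powr (p - 1) * pos_shift (e k) (w y) powr (1 - p)"
      using z p pos_shift_ge[OF e(1), of "w y" k] by (intro mult_right_mono powr_mono2) auto
    also have "\<dots> = 1" using pos_shift_pos[OF e(1)[of k], of "w y"] by (simp add: powr_add[symmetric])
    finally have "\<bar>\<phi> y\<bar> powr p * (w y powr (p - 1) * pos_shift (e k) (w y) powr (1 - p)) \<le> \<bar>\<phi> y\<bar> powr p * 1"
      by (intro mult_left_mono) auto
    then have "- (\<bar>\<phi> y\<bar> powr p) + w y powr (p - 1) * \<bar>\<phi> x\<bar> powr p * pos_shift (e k) 0 powr (1 - p)
      \<le> \<bar>\<phi> x - \<phi> y\<bar> powr p - F p (w x - w y) * (\<bar>\<phi> x\<bar> powr p * pos_shift (e k) (w x) powr (1 - p)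
          - \<bar>\<phi> y\<bar> powr p * pos_shift (e k) (w y) powr (1 - p))"
      unfolding F unfolding z(1) by (simp add: algebra_simps add_increasing2)
    then have "(- (\<bar>\<phi> y\<bar> powr p) + w y powr (p - 1) * \<bar>\<phi> x\<bar> powr p * pos_shift (e k) 0 powr (1 - p)) / D
      \<le> (\<bar>\<phi> x - \<phi> y\<bar> powr p - F p (w x - w y) * (\<bar>\<phi> x\<bar> powr p * pos_shift (e k) (w x) powr (1 - p)
          - \<bar>\<phi> y\<bar> powr p * pos_shift (e k) (w y) powr (1 - p))) / D"
      using D by (intro divide_right_mono) auto
    then show ?thesis
      unfolding Gagliardo_kernel_def nonlocal_kernel_def Picone_test_def damp_def xy c_def D_def[symmetric] fst_conv snd_conv
      by (simp add: add_divide_distrib diff_divide_distrib)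
  qed
  ultimately show ?thesis
    by (rule filterlim_at_top_mono[OF _ always_eventually[OF allI]])
qed

section \<open>The Picone inequality for a nonnegative eigenfunction\<close>

lemma singular_weight_integrable:
  fixes \<phi> :: "'a::euclidean_space \<Rightarrow> real"
  assumes p: "p > 1" and a: "0 < a" "a < real DIM('a)" and \<phi>: "\<phi> \<in> test_functions \<Omega>"
  shows "integrable lborel (\<lambda>x. \<bar>\<phi> x\<bar> powr p / norm x powr a)"
proof -
  obtain r C where "test_bounds \<phi> r C" using test_bounded[OF \<phi>] by blast
  note C = test_boundsD[OF this]
  note [measurable] = borel_measurable_test[OF \<phi>]
  have [measurable]: "cball (0::'a) r \<in> sets borel" by simp
  have "integrable lborel (\<lambda>x::'a. indicat_real (cball 0 r) x / norm x powr a)"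
    by (rule integrableI_nonneg) (use nn_integral_powr_inside[OF a C(1)] in auto)
  then have bound: "integrable lborel (\<lambda>x::'a. C powr p * (indicat_real (cball 0 r) x / norm x powr a))"
    by (rule integrable_mult_right)
  have le: "AE x in lborel. norm (\<bar>\<phi> x\<bar> powr p / norm x powr a)
      \<le> norm (C powr p * (indicat_real (cball 0 r) x / norm x powr a))"
  proof (rule AE_I2)
    fix x
    have "\<bar>\<phi> x\<bar> powr p \<le> C powr p" using C(3)[of x] p by (intro powr_mono2) auto
    then show "norm (\<bar>\<phi> x\<bar> powr p / norm x powr a) \<le> norm (C powr p * (indicat_real (cball 0 r) x / norm x powr a))"
      using C(5)[of x] by (cases "norm x \<le> r") (auto intro!: divide_right_mono)
  qed
  have meas: "(\<lambda>x. \<bar>\<phi> x\<bar> powr p / norm x powr a) \<in> borel_measurable lborel" by simp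
  show ?thesis by (rule Bochner_Integration.integrable_bound[OF bound meas le])
qed

lemma damp_ratio:
  assumes p: "p > 1" and e: "e > 0" and t: "t \<ge> 0"
  shows "0 \<le> t powr (p - 1) * damp p e t" "t powr (p - 1) * damp p e t \<le> 1"
proof -
  show "0 \<le> t powr (p - 1) * damp p e t" by (simp add: damp_def)
  have "t powr (p - 1) * damp p e t \<le> pos_shift e t powr (p - 1) * damp p e t"
    using t p pos_shift_ge[OF e t] by (intro mult_right_mono powr_mono2) (auto simp: damp_def)
  also have "\<dots> = 1" using pos_shift_pos[OF e, of t] by (simp add: damp_def powr_add[symmetric])
  finally show "t powr (p - 1) * damp p e t \<le> 1" .
qed

lemma damp_ratio_tendsto:
  assumes e: "\<And>k. e k > 0" "e \<longlonglongrightarrow> 0" and t: "t > 0"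
  shows "(\<lambda>k. t powr (p - 1) * damp p (e k) t) \<longlonglongrightarrow> 1"
proof -
  have "(\<lambda>k. t powr (p - 1) * pos_shift (e k) t powr (1 - p)) \<longlonglongrightarrow> t powr (p - 1) * t powr (1 - p)"
    by (intro tendsto_mult tendsto_const tendsto_powr pos_shift_tendsto e) (use t in auto)
  then show ?thesis using t by (simp add: damp_def powr_add[symmetric])
qed

lemma AE_zero_or_AE_zero_of_product:
  fixes A B :: "'a::euclidean_space set"
  assumes [measurable]: "A \<in> sets borel" "B \<in> sets borel"
    and ae: "AE z in (lborel :: ('a \<times> 'a) measure). \<not> (fst z \<in> A \<and> snd z \<in> B)"
  shows "(AE x in lborel. x \<notin> A) \<or> (AE x in lborel. x \<notin> B)"
proof -
  have AB: "A \<times> B \<in> sets (lborel :: ('a \<times> 'a) measure)"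
    unfolding lborel_prod[symmetric] by measurable
  have "AE z in (lborel :: ('a \<times> 'a) measure). z \<notin> A \<times> B"
    using ae by (rule AE_mp) (auto intro!: AE_I2)
  then have "emeasure (lborel :: ('a \<times> 'a) measure) (A \<times> B) = 0"
    using AB by (subst (asm) AE_iff_measurable[OF AB]) auto
  then have "emeasure lborel A * emeasure lborel B = 0"
    unfolding lborel_prod[symmetric] by (subst (asm) lborel.emeasure_pair_measure_Times) auto
  then have "emeasure lborel A = 0 \<or> emeasure lborel B = 0" by simp
  then have "A \<in> null_sets lborel \<or> B \<in> null_sets lborel" by (auto intro: null_setsI)
  then show ?thesis by (blast intro: AE_not_in)
qed

text \<open>
  The equation is tested with the regularised \<open>\<bar>\<phi>\<bar>\<^sup>p / w\<^sup>p\<^sup>-\<^sup>1\<close>. The nonlocal Picone inequality has a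
  nonnegative defect whose integral stays bounded as the regularisation is removed. Fatou's lemma
  and the blow-up of the defect then show that \<open>w\<close> cannot vanish on a subset of
  \<open>{x. \<phi> x \<noteq> 0}\<close> of positive measure. Hence \<open>ratio\<close>, the quotient of \<open>w\<^sup>p\<^sup>-\<^sup>1\<close> and its
  regularisation, tends to \<open>1\<close> almost everywhere on \<open>{x. \<phi> x \<noteq> 0}\<close>, and the equation passes to the limit.
\<close>

lemma Picone_inequality:
  fixes w \<phi> :: "'a::euclidean_space \<Rightarrow> real"
  assumes p: "p > 1" "p < real DIM('a)" and s: "0 < s" "s < 1"
    and \<mu>: "\<mu> \<ge> 0" and \<theta>: "0 < p * \<theta>" "p * \<theta> < real DIM('a)"
    and w: "test_limit p \<Omega> w G" and w0: "\<And>x. w x \<ge> 0" and wn: "\<not> (AE x in lborel. w x = 0)"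
    and eigen: "\<And>v H. test_limit p \<Omega> v H \<Longrightarrow>
      Borel_form p s \<theta> \<mu> w G v H = lam * (LINT x|lborel. F p (w x) * v x)"
    and \<phi>: "\<phi> \<in> test_functions \<Omega>"
  shows "lam * int_powr p \<phi> + \<mu> * (LINT x|lborel. \<bar>\<phi> x\<bar> powr p / norm x powr (p * \<theta>))
    \<le> int_powr p (grad \<phi>) + (LINT z|lborel. Gagliardo_kernel p s \<phi> z)"
proof -
  note [measurable] = borel_measurable_test[OF \<phi>] in_LpD(1)[OF test_limitD(1)[OF w]] in_LpD(1)[OF test_limitD(2)[OF w]]
  define e where "e k = inverse (real (Suc k))" for k
  have e: "e k > 0" for k by (simp add: e_def)
  have elim: "e \<longlonglongrightarrow> 0" unfolding e_def by (rule LIMSEQ_inverse_real_of_nat)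
  define v where "v k = Picone_test p (e k) w \<phi>" for k
  define H where "H k = Picone_grad p (e k) w G \<phi>" for k
  have v: "test_limit p \<Omega> (v k) (H k)" for k
    unfolding v_def H_def by (rule Picone_test_limit[OF p(1) e w \<phi>])
  define ratio where "ratio k x = w x powr (p - 1) * damp p (e k) (w x)" for k x
  have ratio: "0 \<le> ratio k x" "ratio k x \<le> 1" for k x
    unfolding ratio_def by (rule damp_ratio[OF p(1) e w0])+
  have ratio_lim: "(\<lambda>k. ratio k x) \<longlonglongrightarrow> 1" if "w x > 0" for x
    unfolding ratio_def by (rule damp_ratio_tendsto[OF e elim that])
  have Fv: "F p (w x) * v k x = ratio k x * \<bar>\<phi> x\<bar> powr p" for k x
    by (simp add: F_nonneg[OF w0] v_def Picone_test_def ratio_def mult_ac)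
  have damp_meas: "damp p (e k) \<in> borel_measurable borel" for k
    using damp_has_derivative[OF e[of k]]
    by (intro borel_measurable_continuous_onI continuous_at_imp_continuous_on ballI DERIV_isCont)
  note [measurable] = damp_meas
  have [measurable]: "ratio k \<in> borel_measurable borel" for k unfolding ratio_def by measurable
  have i\<phi>: "integrable lborel (\<lambda>x. \<bar>\<phi> x\<bar> powr p)" "integrable lborel (\<lambda>x. \<bar>\<phi> x\<bar> powr p / norm x powr (p * \<theta>))"
    using test_integrable(3)[OF \<phi>, of p] p(1) singular_weight_integrable[OF p(1) \<theta> \<phi>] by auto
  define A where "A = int_powr p (grad \<phi>)"
  define \<Gamma> where "\<Gamma> = (LINT z|lborel. Gagliardo_kernel p s \<phi> z)"
  define L where "L k = (LINT x|lborel. norm (G x) powr (p - 2) * (G x \<bullet> H k x))" for k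
  define N where "N k = (LINT z|lborel. nonlocal_kernel p s w (v k) z)" for k
  define E where "E k = (LINT x|lborel. ratio k x * \<bar>\<phi> x\<bar> powr p)" for k
  define P where "P k = (LINT x|lborel. ratio k x * (\<bar>\<phi> x\<bar> powr p / norm x powr (p * \<theta>)))" for k
  have eq: "L k + N k - \<mu> * P k = lam * E k" for k
  proof -
    have "(LINT x|lborel. F p (w x) * v k x / norm x powr (p * \<theta>)) = P k"
      unfolding P_def Fv by (simp add: mult.commute)
    then show ?thesis
      using eigen[OF v[of k]] unfolding Borel_form_def L_def N_def E_def Fv by simp
  qed
  have LA: "L k \<le> A" for k
  proof (cases "integrable lborel (\<lambda>x. norm (G x) powr (p - 2) * (G x \<bullet> H k x))")
    case True
    have "norm (G x) powr (p - 2) * (G x \<bullet> H k x) \<le> norm (grad \<phi> x) powr p" for x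
      unfolding H_def by (rule Picone_local_pointwise[OF p(1)]) (rule e, rule w0)
    with True show ?thesis
      unfolding L_def A_def
      by (intro integral_mono test_integrable(4)[OF \<phi>]) (use p in auto)
  next
    case False
    then have "L k = 0" unfolding L_def by (rule not_integrable_integral_eq)
    then show ?thesis by (simp add: A_def)
  qed
  define defect where "defect k z = Gagliardo_kernel p s \<phi> z - nonlocal_kernel p s w (v k) z" for k z
  have defect_nonneg: "0 \<le> defect k z" for k z
    using Picone_nonlocal_pointwise[OF p(1) e w0, where s = s] by (simp add: defect_def v_def)
  note iG = Gagliardo_kernel_integrable[OF p s test_limit_test[OF p(1) \<phi>]]
  note iN = nonlocal_kernel_integrable[OF p s w v]
  have i_defect: "integrable lborel (defect k)" for k
    unfolding defect_def[abs_def] by (intro Bochner_Integration.integrable_diff iG iN)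
  have int_defect: "(LINT z|lborel. defect k z) = \<Gamma> - N k" for k
    unfolding defect_def \<Gamma>_def N_def by (rule Bochner_Integration.integral_diff[OF iG iN])
  have defect_le: "(LINT z|lborel. defect k z) \<le> \<Gamma> + A - \<mu> * P k - lam * E k" for k
    using LA[of k] eq[of k] unfolding int_defect by linarith
  have iE: "integrable lborel (\<lambda>x. ratio k x * \<bar>\<phi> x\<bar> powr p)" for k
    by (rule Bochner_Integration.integrable_bound[OF i\<phi>(1)])
      (use ratio in \<open>auto simp: abs_mult mult_left_le_one_le intro!: AE_I2\<close>)
  have P0: "0 \<le> P k" for k
    unfolding P_def using ratio by (intro integral_nonneg_AE AE_I2) auto
  have E0: "0 \<le> E k" "E k \<le> int_powr p \<phi>" for k
  proof -
    show "0 \<le> E k" unfolding E_def using ratio by (intro integral_nonneg_AE AE_I2) auto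
    show "E k \<le> int_powr p \<phi>"
      unfolding E_def by (rule integral_mono[OF iE]) (use i\<phi> ratio in \<open>auto simp: mult_left_le_one_le\<close>)
  qed
  define B where "B = \<Gamma> + A + \<bar>lam\<bar> * int_powr p \<phi>"
  have defect_B: "(LINT z|lborel. defect k z) \<le> B" for k
  proof -
    have "- (lam * E k) \<le> \<bar>lam\<bar> * E k"
      using mult_right_mono[OF abs_ge_minus_self[of lam] E0(1)[of k]] by simp
    also have "\<dots> \<le> \<bar>lam\<bar> * int_powr p \<phi>" by (intro mult_left_mono E0) simp
    finally have "- (lam * E k) \<le> \<bar>lam\<bar> * int_powr p \<phi>" .
    moreover have "0 \<le> \<mu> * P k" using \<mu> P0 by simp
    ultimately show ?thesis using defect_le[of k] unfolding B_def by linarith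
  qed
  have dm: "(\<lambda>z. ennreal (defect k z)) \<in> borel_measurable lborel" for k
    using borel_measurable_integrable[OF i_defect[of k]] by simp
  have "(\<integral>\<^sup>+ z. liminf (\<lambda>k. ennreal (defect k z)) \<partial>lborel) \<le> liminf (\<lambda>k. \<integral>\<^sup>+ z. ennreal (defect k z) \<partial>lborel)"
    by (rule nn_integral_liminf[OF dm])
  also have "\<dots> \<le> liminf (\<lambda>k. ennreal B)"
  proof (rule Liminf_mono, rule always_eventually, rule allI)
    fix k
    have "(\<integral>\<^sup>+ z. ennreal (defect k z) \<partial>lborel) = ennreal (LINT z|lborel. defect k z)"
      by (rule nn_integral_eq_integral[OF i_defect]) (simp add: defect_nonneg)
    then show "(\<integral>\<^sup>+ z. ennreal (defect k z) \<partial>lborel) \<le> ennreal B"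
      using defect_B[of k] by (simp add: ennreal_leI)
  qed
  also have "\<dots> < \<infinity>" by (simp add: Liminf_const)
  finally have "AE z in lborel. liminf (\<lambda>k. ennreal (defect k z)) \<noteq> \<infinity>"
    by (intro nn_integral_PInf_AE) (use dm in auto)
  then have "AE z in lborel. \<not> (fst z \<in> {x. w x = 0 \<and> \<phi> x \<noteq> 0} \<and> snd z \<in> {x. w x > 0})"
  proof (rule AE_mp, intro AE_I2 impI notI)
    fix z assume fin: "liminf (\<lambda>k. ennreal (defect k z)) \<noteq> \<infinity>"
      and z: "fst z \<in> {x. w x = 0 \<and> \<phi> x \<noteq> 0} \<and> snd z \<in> {x. w x > 0}"
    have "filterlim (\<lambda>k. defect k z) at_top sequentially"
      unfolding defect_def v_def by (rule Picone_defect_blowup[OF p(1) e elim]) (use z in auto)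
    then have "(\<lambda>k. ennreal (defect k z)) \<longlonglongrightarrow> top"
      by (simp add: ennreal_tendsto_top_eq_at_top)
    then have "liminf (\<lambda>k. ennreal (defect k z)) = top"
      by (rule lim_imp_Liminf[OF trivial_limit_sequentially])
    with fin show False by simp
  qed
  then have either: "(AE x in lborel. x \<notin> {x. w x = 0 \<and> \<phi> x \<noteq> 0}) \<or> (AE x in lborel. x \<notin> {x. w x > 0})"
    by (rule AE_zero_or_AE_zero_of_product[rotated 2]) measurable
  have not_right: "\<not> (AE x in lborel. x \<notin> {x. w x > 0})"
  proof
    assume "AE x in lborel. x \<notin> {x. w x > 0}"
    then have "AE x in lborel. w x = 0"
      by (rule AE_mp) (use w0 in \<open>auto intro!: AE_I2 simp: not_less intro: antisym\<close>)
    then show False using wn by simp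
  qed
  have "AE x in lborel. x \<notin> {x. w x = 0 \<and> \<phi> x \<noteq> 0}"
    by (rule disjE[OF either], assumption, erule notE[OF not_right])
  then have pos: "AE x in lborel. \<phi> x \<noteq> 0 \<longrightarrow> w x > 0"
  proof (rule AE_mp, intro AE_I2 impI)
    fix x assume "x \<notin> {x. w x = 0 \<and> \<phi> x \<noteq> 0}" "\<phi> x \<noteq> 0"
    then show "w x > 0" using w0[of x] by simp
  qed
  have lim: "(\<lambda>k. LINT x|lborel. ratio k x * h x) \<longlonglongrightarrow> (LINT x|lborel. h x)"
    if h: "integrable lborel h" "\<And>x. \<phi> x = 0 \<Longrightarrow> h x = 0" for h :: "'a \<Rightarrow> real"
  proof (rule integral_dominated_convergence[OF _ _ integrable_norm[OF h(1)]])
    show "AE x in lborel. (\<lambda>k. ratio k x * h x) \<longlonglongrightarrow> h x"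
      using pos
    proof (rule AE_mp, intro AE_I2 impI)
      fix x assume x: "\<phi> x \<noteq> 0 \<longrightarrow> w x > 0"
      show "(\<lambda>k. ratio k x * h x) \<longlonglongrightarrow> h x"
      proof (cases "\<phi> x = 0")
        case True
        then show ?thesis using h(2) by simp
      next
        case False
        then have "(\<lambda>k. ratio k x * h x) \<longlonglongrightarrow> 1 * h x"
          using x by (intro tendsto_mult ratio_lim tendsto_const) simp
        then show ?thesis by simp
      qed
    qed
    show "AE x in lborel. norm (ratio k x * h x) \<le> norm (h x)" for k
      using ratio by (auto simp: abs_mult mult_left_le_one_le intro!: AE_I2)
    show "h \<in> borel_measurable lborel" by (rule borel_measurable_integrable[OF h(1)])
    then show "(\<lambda>x. ratio k x * h x) \<in> borel_measurable lborel" for k by measurable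
  qed
  have "(\<lambda>k. lam * E k + \<mu> * P k) \<longlonglongrightarrow>
      lam * int_powr p \<phi> + \<mu> * (LINT x|lborel. \<bar>\<phi> x\<bar> powr p / norm x powr (p * \<theta>))"
    unfolding E_def P_def real_norm_def using p(1) by (intro tendsto_add tendsto_mult tendsto_const lim i\<phi>) auto
  moreover have "lam * E k + \<mu> * P k \<le> A + \<Gamma>" for k
  proof -
    have "0 \<le> (LINT z|lborel. defect k z)" by (intro integral_nonneg_AE AE_I2 defect_nonneg)
    then show ?thesis using defect_le[of k] by linarith
  qed
  ultimately show ?thesis
    unfolding A_def \<Gamma>_def by (intro LIMSEQ_le_const2) auto
qed

section \<open>Comparison with the first eigenvalue\<close>

text \<open>
  Continuity of the \<open>p\<close>-th power of a norm, derived from \<open>norm_powr_split\<close>: \<open>a\<close>, \<open>b\<close> and \<open>d\<close> are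
  the \<open>p\<close>-th powers of the norms of \<open>f\<^sub>k\<close>, \<open>f\<close> and \<open>f\<^sub>k - f\<close>. For \<open>t\<close> close to \<open>1\<close> the constant
  in front of \<open>b\<close> or \<open>a\<close> is close to \<open>1\<close>, and the other one is multiplied by \<open>d \<rightarrow> 0\<close>.
\<close>

lemma tendsto_of_powr_splits:
  fixes a d :: "nat \<Rightarrow> real" and b :: real
  assumes b: "b \<ge> 0" and d: "d \<longlonglongrightarrow> 0"
    and le: "\<And>t k. 0 < t \<Longrightarrow> t < 1 \<Longrightarrow> a k \<le> t powr (1 - p) * b + (1 - t) powr (1 - p) * d k"
    and ge: "\<And>t k. 0 < t \<Longrightarrow> t < 1 \<Longrightarrow> b \<le> t powr (1 - p) * a k + (1 - t) powr (1 - p) * d k"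
    and p: "p > 1"
  shows "a \<longlonglongrightarrow> b"
proof (rule LIMSEQ_I)
  fix \<epsilon> :: real assume \<epsilon>: "\<epsilon> > 0"
  define t where "t k = 1 - inverse (real (k + 2))" for k
  have t: "0 < t k" "t k < 1" for k by (auto simp: t_def inverse_less_1_iff)
  have "(\<lambda>k. inverse (real (k + 2))) \<longlonglongrightarrow> 0"
    by (rule LIMSEQ_ignore_initial_segment[OF lim_inverse_n])
  then have "t \<longlonglongrightarrow> 1 - 0" unfolding t_def by (intro tendsto_diff tendsto_const)
  then have tp: "(\<lambda>k. t k powr (1 - p)) \<longlonglongrightarrow> 1 powr (1 - p)"
    by (intro tendsto_powr tendsto_const) auto
  have "(\<lambda>k. (t k powr (1 - p) - 1) * t k powr (1 - p) * b) \<longlonglongrightarrow> (1 powr (1 - p) - 1) * 1 powr (1 - p) * b"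
    by (intro tendsto_mult tendsto_diff tendsto_const tp)
  then have "(\<lambda>k. (t k powr (1 - p) - 1) * t k powr (1 - p) * b) \<longlonglongrightarrow> 0" by simp
  then have "\<forall>\<^sub>F k in sequentially. (t k powr (1 - p) - 1) * t k powr (1 - p) * b < \<epsilon> / 2"
    using \<epsilon> by (intro order_tendstoD(2)) auto
  then obtain m where m: "(t m powr (1 - p) - 1) * t m powr (1 - p) * b < \<epsilon> / 2"
    using eventually_happens[of _ sequentially] by auto
  define c where "c = t m powr (1 - p)"
  define C where "C = (1 - t m) powr (1 - p)"
  have c: "c \<ge> 1" unfolding c_def using powr_mono2'[of "1 - p" "t m" 1] t[of m] p by simp
  have C: "C \<ge> 0" by (simp add: C_def)
  have "(\<lambda>k. c * C * \<bar>d k\<bar>) \<longlonglongrightarrow> c * C * \<bar>0\<bar>" by (intro tendsto_intros d)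
  then have "\<forall>\<^sub>F k in sequentially. c * C * \<bar>d k\<bar> < \<epsilon> / 2"
    using \<epsilon> by (intro order_tendstoD(2)) auto
  then obtain N where N: "\<And>k. k \<ge> N \<Longrightarrow> c * C * \<bar>d k\<bar> < \<epsilon> / 2"
    by (auto simp: eventually_sequentially)
  show "\<exists>no. \<forall>k\<ge>no. norm (a k - b) < \<epsilon>"
  proof (intro exI allI impI)
    fix k assume k: "k \<ge> N"
    have D: "C * d k \<le> C * \<bar>d k\<bar>" "0 \<le> C * \<bar>d k\<bar>" using C by (auto intro: mult_left_mono)
    have 1: "a k \<le> c * b + C * \<bar>d k\<bar>" using le[OF t, of k m] D unfolding c_def C_def by linarith
    have 2: "b \<le> c * a k + C * \<bar>d k\<bar>" using ge[OF t, of m k] D unfolding c_def C_def by linarith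
    have "b - a k \<le> (c - 1) * a k + C * \<bar>d k\<bar>" using 2 by (simp add: algebra_simps)
    also have "\<dots> \<le> (c - 1) * (c * b + C * \<bar>d k\<bar>) + C * \<bar>d k\<bar>"
      using c 1 by (intro add_right_mono mult_left_mono) auto
    also have "\<dots> = (c - 1) * c * b + c * C * \<bar>d k\<bar>" by (simp add: algebra_simps)
    finally have l: "b - a k < \<epsilon>" using m N[OF k] unfolding c_def by linarith
    have "a k - b \<le> (c - 1) * b + C * \<bar>d k\<bar>" using 1 by (simp add: algebra_simps)
    also have "\<dots> \<le> c * ((c - 1) * b + C * \<bar>d k\<bar>)"
      using mult_right_mono[OF c, of "(c - 1) * b + C * \<bar>d k\<bar>"] c b D(2) by simp
    also have "\<dots> = (c - 1) * c * b + c * C * \<bar>d k\<bar>" by (simp add: algebra_simps)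
    finally have "a k - b < \<epsilon>" using m N[OF k] unfolding c_def by linarith
    with l show "norm (a k - b) < \<epsilon>" by (simp add: abs_less_iff)
  qed
qed

lemma int_powr_tendsto:
  fixes f :: "nat \<Rightarrow> 'a::euclidean_space \<Rightarrow> 'b::euclidean_space"
  assumes p: "p > 1" and f: "\<And>k. in_Lp p (f k)" and g: "in_Lp p g"
    and l: "(\<lambda>k. int_powr p (\<lambda>x. f k x - g x)) \<longlonglongrightarrow> 0"
  shows "(\<lambda>k. int_powr p (f k)) \<longlonglongrightarrow> int_powr p g"
proof (rule tendsto_of_powr_splits[OF _ l _ _ p])
  fix t :: real and k assume t: "0 < t" "t < 1"
  show "int_powr p (f k) \<le> t powr (1 - p) * int_powr p g + (1 - t) powr (1 - p) * int_powr p (\<lambda>x. f k x - g x)"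
    by (rule int_powr_split[OF p t f g])
  show "int_powr p g \<le> t powr (1 - p) * int_powr p (f k) + (1 - t) powr (1 - p) * int_powr p (\<lambda>x. f k x - g x)"
    using int_powr_split[OF p t g f, of k] by (simp add: norm_minus_commute)
qed simp

text \<open>
  The inequality for test functions passes to their limits: the gradient and Gagliardo terms and
  the \<open>L\<^sup>p\<close> norm are continuous, and Fatou's lemma bounds the potential term, which stands on the
  smaller side. The Bochner integral of a nonnegative function that is not integrable is \<open>0\<close>, and
  this value obeys the same bound.
\<close>

lemma eigenvalue_le_energy:
  fixes w u :: "'a::euclidean_space \<Rightarrow> real"
  assumes p: "p > 1" "p < real DIM('a)" and s: "0 < s" "s < 1"
    and \<mu>: "\<mu> > 0" and \<theta>: "0 < p * \<theta>" "p * \<theta> < real DIM('a)"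
    and w: "test_limit p \<Omega> w G" and w0: "\<And>x. w x \<ge> 0" and wn: "\<not> (AE x in lborel. w x = 0)"
    and eigen: "\<And>v H. test_limit p \<Omega> v H \<Longrightarrow>
      Borel_form p s \<theta> \<mu> w G v H = lam * (LINT x|lborel. F p (w x) * v x)"
    and u: "test_limit p \<Omega> u Gu"
  shows "lam * int_powr p u \<le> Borel_form p s \<theta> \<mu> u Gu u Gu"
proof -
  define W where "W u = (LINT x|lborel. \<bar>u x\<bar> powr p / norm x powr (p * \<theta>))" for u :: "'a \<Rightarrow> real"
  define \<Gamma> where "\<Gamma> u = (LINT z|lborel. Gagliardo_kernel p s u z)" for u :: "'a \<Rightarrow> real"
  have form: "Borel_form p s \<theta> \<mu> u Gu u Gu = int_powr p Gu + \<Gamma> u - \<mu> * W u"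
  proof -
    have 1: "norm x powr (p - 2) * (x \<bullet> x) = norm x powr p" for x :: 'a
      by (cases "x = 0") (auto simp: powr_diff dot_square_norm powr_numeral)
    have "nonlocal_kernel p s u u = Gagliardo_kernel p s u"
      by (auto simp: nonlocal_kernel_def Gagliardo_kernel_def F_mult_self)
    then show ?thesis
      unfolding Borel_form_def 1 \<Gamma>_def W_def F_mult_self by simp
  qed
  obtain \<phi> where \<phi>: "\<And>k. \<phi> k \<in> test_functions \<Omega>"
      "(\<lambda>k. int_powr p (\<lambda>x. \<phi> k x - u x)) \<longlonglongrightarrow> 0"
      "(\<lambda>k. int_powr p (\<lambda>x. grad (\<phi> k) x - Gu x)) \<longlonglongrightarrow> 0"
      "AE x in lborel. (\<lambda>k. \<phi> k x) \<longlonglongrightarrow> u x"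
    using test_limit_AE_seq[OF p(1) u] by auto
  note [measurable] = borel_measurable_test[OF \<phi>(1)] in_LpD(1)[OF test_limitD(1)[OF u]] in_LpD(1)[OF test_limitD(2)[OF u]]
  have Lp: "in_Lp p (\<phi> k)" "in_Lp p (grad (\<phi> k))" for k
    using in_Lp_test[OF \<phi>(1) p(1)] by auto
  define d where "d k = int_powr p (\<lambda>x. \<phi> k x - u x)" for k
  define d' where "d' k = int_powr p (\<lambda>x. grad (\<phi> k) x - Gu x)" for k
  define \<delta> where "\<delta> k = \<Gamma> (\<lambda>x. \<phi> k x - u x)" for k
  have dl: "d \<longlonglongrightarrow> 0" "d' \<longlonglongrightarrow> 0" using \<phi>(2,3) by (simp_all add: d_def[abs_def] d'_def[abs_def])
  have \<Gamma>nn: "\<Gamma> u \<ge> 0" for u unfolding \<Gamma>_def by (intro integral_nonneg_AE AE_I2 Gagliardo_kernel_nonneg)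
  have Wnn: "W u \<ge> 0" for u unfolding W_def by (intro integral_nonneg_AE AE_I2) simp
  note diff = test_limit_diff_test[OF p(1) u \<phi>(1)]
  have \<delta>l: "\<delta> \<longlonglongrightarrow> 0"
  proof -
    obtain C where C: "C \<ge> 0" "\<forall>\<Omega> u G. test_limit p (\<Omega> :: 'a set) u G \<longrightarrow>
      Gagliardo p s u \<le> ennreal (C * (int_powr p u + int_powr p G))"
      using Gagliardo_test_limit[OF p s] by blast
    have "\<delta> k \<le> C * (d k + d' k)" for k
    proof -
      have "ennreal (\<delta> k) = Gagliardo p s (\<lambda>x. \<phi> k x - u x)"
        unfolding \<delta>_def \<Gamma>_def Gagliardo_def
        by (rule nn_integral_eq_integral[symmetric, OF Gagliardo_kernel_integrable[OF p s diff]])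
          (simp add: Gagliardo_kernel_nonneg)
      also have "\<dots> \<le> ennreal (C * (d k + d' k))" using C(2) diff[of k] unfolding d_def d'_def by blast
      finally show ?thesis
        using C(1) by (subst (asm) ennreal_le_iff) (auto simp: d_def d'_def)
    qed
    then have le: "\<forall>\<^sub>F k in sequentially. \<delta> k \<le> C * (d k + d' k)" by simp
    have "(\<lambda>k. C * (d k + d' k)) \<longlonglongrightarrow> C * (0 + 0)" by (intro tendsto_intros dl)
    then have "(\<lambda>k. C * (d k + d' k)) \<longlonglongrightarrow> 0" by simp
    moreover have "\<forall>\<^sub>F k in sequentially. 0 \<le> \<delta> k" by (simp add: \<delta>_def \<Gamma>nn)
    ultimately show ?thesis using tendsto_sandwich[OF _ le tendsto_const] by blast
  qed
  have \<Gamma>_split: "\<Gamma> f \<le> t powr (1 - p) * \<Gamma> g + (1 - t) powr (1 - p) * \<Gamma> (\<lambda>x. f x - g x)"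
    if t: "0 < t" "t < 1" and i: "integrable lborel (Gagliardo_kernel p s f)" "integrable lborel (Gagliardo_kernel p s g)"
      "integrable lborel (Gagliardo_kernel p s (\<lambda>x. f x - g x))" for t and f g :: "'a \<Rightarrow> real"
  proof -
    have "\<Gamma> f \<le> (LINT z|lborel. t powr (1 - p) * Gagliardo_kernel p s g z
        + (1 - t) powr (1 - p) * Gagliardo_kernel p s (\<lambda>x. f x - g x) z)"
      unfolding \<Gamma>_def
    proof (rule integral_mono[OF i(1)])
      show "integrable lborel (\<lambda>z. t powr (1 - p) * Gagliardo_kernel p s g z
        + (1 - t) powr (1 - p) * Gagliardo_kernel p s (\<lambda>x. f x - g x) z)"
        by (intro Bochner_Integration.integrable_add integrable_mult_right i)
      fix z :: "'a \<times> 'a"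
      have e: "f (fst z) - f (snd z) - (g (fst z) - g (snd z)) = f (fst z) - g (fst z) - (f (snd z) - g (snd z))"
        by simp
      show "Gagliardo_kernel p s f z \<le> t powr (1 - p) * Gagliardo_kernel p s g z
        + (1 - t) powr (1 - p) * Gagliardo_kernel p s (\<lambda>x. f x - g x) z"
        using norm_powr_split[OF p(1) t, of "f (fst z) - f (snd z)" "g (fst z) - g (snd z)"]
        unfolding Gagliardo_kernel_def e real_norm_def
        by (simp add: add_divide_distrib[symmetric] divide_right_mono)
    qed
    also have "\<dots> = t powr (1 - p) * \<Gamma> g + (1 - t) powr (1 - p) * \<Gamma> (\<lambda>x. f x - g x)"
      unfolding \<Gamma>_def
      by (subst Bochner_Integration.integral_add) (auto intro!: integrable_mult_right i)
    finally show ?thesis .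
  qed
  note iu = Gagliardo_kernel_integrable[OF p s u]
  note i\<phi> = Gagliardo_kernel_integrable[OF p s test_limit_test[OF p(1) \<phi>(1)]]
  note i\<delta> = Gagliardo_kernel_integrable[OF p s diff]
  have \<Gamma>_lim: "(\<lambda>k. \<Gamma> (\<phi> k)) \<longlonglongrightarrow> \<Gamma> u"
  proof (rule tendsto_of_powr_splits[OF \<Gamma>nn \<delta>l _ _ p(1)])
    fix t :: real and k assume t: "0 < t" "t < 1"
    show "\<Gamma> (\<phi> k) \<le> t powr (1 - p) * \<Gamma> u + (1 - t) powr (1 - p) * \<delta> k"
      unfolding \<delta>_def by (rule \<Gamma>_split[OF t i\<phi> iu i\<delta>])
    have sym: "Gagliardo_kernel p s (\<lambda>x. u x - \<phi> k x) = Gagliardo_kernel p s (\<lambda>x. \<phi> k x - u x)"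
    proof
      fix z :: "'a \<times> 'a"
      have "\<bar>u (fst z) - \<phi> k (fst z) - (u (snd z) - \<phi> k (snd z))\<bar> = \<bar>\<phi> k (fst z) - u (fst z) - (\<phi> k (snd z) - u (snd z))\<bar>"
        by linarith
      then show "Gagliardo_kernel p s (\<lambda>x. u x - \<phi> k x) z = Gagliardo_kernel p s (\<lambda>x. \<phi> k x - u x) z"
        by (simp only: Gagliardo_kernel_def)
    qed
    have "\<Gamma> u \<le> t powr (1 - p) * \<Gamma> (\<phi> k) + (1 - t) powr (1 - p) * \<Gamma> (\<lambda>x. u x - \<phi> k x)"
      by (rule \<Gamma>_split[OF t iu i\<phi>]) (simp only: sym i\<delta>)
    then show "\<Gamma> u \<le> t powr (1 - p) * \<Gamma> (\<phi> k) + (1 - t) powr (1 - p) * \<delta> k"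
      by (simp only: \<delta>_def \<Gamma>_def sym)
  qed
  define b where "b k = (int_powr p (grad (\<phi> k)) + \<Gamma> (\<phi> k) - lam * int_powr p (\<phi> k)) / \<mu>" for k
  define B where "B = (int_powr p Gu + \<Gamma> u - lam * int_powr p u) / \<mu>"
  have bB: "b \<longlonglongrightarrow> B"
    unfolding b_def B_def divide_inverse
    by (intro tendsto_mult tendsto_diff tendsto_add tendsto_const \<Gamma>_lim
        int_powr_tendsto[OF p(1) Lp(1) test_limitD(1)[OF u] \<phi>(2)]
        int_powr_tendsto[OF p(1) Lp(2) test_limitD(2)[OF u] \<phi>(3)])
  have key: "W (\<phi> k) \<le> b k" for k
  proof -
    have "lam * int_powr p (\<phi> k) + \<mu> * W (\<phi> k) \<le> int_powr p (grad (\<phi> k)) + \<Gamma> (\<phi> k)"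
      unfolding W_def \<Gamma>_def by (rule Picone_inequality[OF p s less_imp_le[OF \<mu>] \<theta> w w0 wn eigen \<phi>(1)])
    then show ?thesis using \<mu> by (simp add: b_def le_divide_eq mult.commute)
  qed
  have B0: "B \<ge> 0"
    by (rule LIMSEQ_le_const[OF bB]) (use order_trans[OF Wnn key] in auto)
  have fatou: "(\<integral>\<^sup>+ x. ennreal (\<bar>u x\<bar> powr p / norm x powr (p * \<theta>)) \<partial>lborel) \<le> ennreal B"
  proof (rule Fatou_AE[OF _ _ _ bB])
    show "(\<lambda>x. ennreal (\<bar>\<phi> k x\<bar> powr p / norm x powr (p * \<theta>))) \<in> borel_measurable lborel" for k by simp
    show "AE x in lborel. (\<lambda>k. ennreal (\<bar>\<phi> k x\<bar> powr p / norm x powr (p * \<theta>)))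
        \<longlonglongrightarrow> ennreal (\<bar>u x\<bar> powr p / norm x powr (p * \<theta>))"
      using \<phi>(4)
    proof (rule AE_mp, intro AE_I2 impI)
      fix x assume l: "(\<lambda>k. \<phi> k x) \<longlonglongrightarrow> u x"
      have "(\<lambda>k. \<bar>\<phi> k x\<bar> powr p) \<longlonglongrightarrow> \<bar>u x\<bar> powr p"
        by (rule tendsto_powr'[OF tendsto_rabs[OF l] tendsto_const]) (use p in auto)
      then show "(\<lambda>k. ennreal (\<bar>\<phi> k x\<bar> powr p / norm x powr (p * \<theta>)))
        \<longlonglongrightarrow> ennreal (\<bar>u x\<bar> powr p / norm x powr (p * \<theta>))"
        unfolding divide_inverse by (intro tendsto_ennrealI tendsto_mult_right)
    qed
    show "(\<integral>\<^sup>+ x. ennreal (\<bar>\<phi> k x\<bar> powr p / norm x powr (p * \<theta>)) \<partial>lborel) \<le> ennreal (b k)" for k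
    proof -
      have "(\<integral>\<^sup>+ x. ennreal (\<bar>\<phi> k x\<bar> powr p / norm x powr (p * \<theta>)) \<partial>lborel) = ennreal (W (\<phi> k))"
        unfolding W_def
        by (rule nn_integral_eq_integral[OF singular_weight_integrable[OF p(1) \<theta> \<phi>(1)]]) simp
      then show ?thesis using key[of k] by (simp add: ennreal_leI)
    qed
  qed
  have "W u \<le> B"
  proof (cases "integrable lborel (\<lambda>x. \<bar>u x\<bar> powr p / norm x powr (p * \<theta>))")
    case True
    then have "ennreal (W u) \<le> ennreal B"
      unfolding W_def using fatou by (subst nn_integral_eq_integral[symmetric]) auto
    then show ?thesis using B0 by (simp add: ennreal_le_iff)
  next
    case False
    then have "W u = 0" unfolding W_def by (rule not_integrable_integral_eq)
    then show ?thesis using B0 by simp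
  qed
  then have "\<mu> * W u \<le> \<mu> * B" using \<mu> by (intro mult_left_mono) auto
  also have "\<mu> * B = int_powr p Gu + \<Gamma> u - lam * int_powr p u" using \<mu> by (simp add: B_def)
  finally show ?thesis unfolding form by linarith
qed

lemma Borel_form_scale:
  fixes u v :: "'a::euclidean_space \<Rightarrow> real"
  assumes a: "a > 0"
  shows "Borel_form p s \<theta> \<mu> (\<lambda>x. a * u x) (\<lambda>x. a *\<^sub>R G x) (\<lambda>x. a * v x) (\<lambda>x. a *\<^sub>R H x)
    = a powr p * Borel_form p s \<theta> \<mu> u G v H"
proof -
  have ap: "a powr (p - 2) * (a * a) = a powr p"
    using a by (simp add: powr_diff powr_numeral power2_eq_square)
  have 1: "norm (a *\<^sub>R G x) powr (p - 2) * ((a *\<^sub>R G x) \<bullet> (a *\<^sub>R H x)) = a powr p * (norm (G x) powr (p - 2) * (G x \<bullet> H x))" for x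
    unfolding ap[symmetric] using a by (simp add: powr_mult)
  have FF: "F p (a * b) * (a * c) = a powr p * (F p b * c)" for b c
    unfolding ap[symmetric] F_def using a by (simp add: abs_mult powr_mult)
  have 2: "nonlocal_kernel p s (\<lambda>x. a * u x) (\<lambda>x. a * v x) z = a powr p * nonlocal_kernel p s u v z" for z
    unfolding nonlocal_kernel_def right_diff_distrib[symmetric] FF by simp
  have 3: "F p (a * u x) * (a * v x) / norm x powr (p * \<theta>) = a powr p * (F p (u x) * v x / norm x powr (p * \<theta>))" for x
    unfolding FF by simp
  show ?thesis
    unfolding Borel_form_def 1 2 3 integral_mult_right_zero by (simp add: distrib_left right_diff_distrib)
qed

lemma Borel_form_minus:
  "Borel_form p s \<theta> \<mu> (\<lambda>x. - u x) (\<lambda>x. - G x) v H = - Borel_form p s \<theta> \<mu> u G v H"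
proof -
  have 1: "nonlocal_kernel p s (\<lambda>x. - u x) v z = - nonlocal_kernel p s u v z" for z
  proof -
    have "- u (fst z) - - u (snd z) = - (u (fst z) - u (snd z))" by simp
    then show ?thesis unfolding nonlocal_kernel_def by (simp only: F_minus mult_minus_left minus_divide_left)
  qed
  show ?thesis unfolding Borel_form_def 1 by (simp add: F_minus)
qed

lemma int_powr_pos:
  fixes f :: "'a::euclidean_space \<Rightarrow> real"
  assumes "in_Lp p f" "\<not> (AE x in lborel. f x = 0)"
  shows "int_powr p f > 0"
proof (rule ccontr)
  assume "\<not> int_powr p f > 0"
  moreover have "int_powr p f \<ge> 0" by simp
  ultimately have "int_powr p f = 0" by linarith
  then have "AE x in lborel. norm (f x) powr p = 0"
    by (subst (asm) integral_nonneg_eq_0_iff_AE) (use in_LpD(2)[OF assms(1)] in auto)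
  then have "AE x in lborel. f x = 0" by (rule AE_mp) (auto intro!: AE_I2)
  with assms(2) show False ..
qed

text \<open>
  The normalised eigenfunction has energy \<open>lam\<close>, and by \<open>eigenvalue_le_energy\<close> no normalised
  competitor has less, so the infimum is attained at \<open>lam\<close>.
\<close>

lemma nonneg_eigenfunction_imp_lambda1:
  fixes w :: "'a::euclidean_space \<Rightarrow> real"
  assumes p: "p > 1" "p < real DIM('a)" and s: "0 < s" "s < 1"
    and \<mu>: "\<mu> > 0" and \<theta>: "0 < p * \<theta>" "p * \<theta> < real DIM('a)" and op: "open \<Omega>"
    and w: "test_limit p \<Omega> w G" and w0: "\<And>x. w x \<ge> 0" and wn: "\<not> (AE x in lborel. w x = 0)"
    and eigen: "\<And>v H. test_limit p \<Omega> v H \<Longrightarrow>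
      Borel_form p s \<theta> \<mu> w G v H = lam * (LINT x|lborel. F p (w x) * v x)"
  shows "lambda1 p s \<theta> \<mu> \<Omega> = lam"
  unfolding lambda1_def
proof (rule cInf_eq_minimum)
  have norm_eq: "(LINT x:\<Omega>|lebesgue. \<bar>u x\<bar> powr p) = int_powr p u0"
    and energy_eq: "energy p s \<theta> \<mu> \<Omega> u = Borel_form p s \<theta> \<mu> u0 Gu u0 Gu"
    if "represents p \<Omega> u u0 Gu" for u u0 Gu
    using T_form_represents(1)[OF p s that that, of \<theta> \<mu>] T_form_represents(2)[OF p s that that]
    by (simp_all add: F_mult_self energy_eq_T_form)
  define c where "c = int_powr p w"
  have c: "c > 0" unfolding c_def by (rule int_powr_pos[OF test_limitD(1)[OF w] wn])
  have wc: "Borel_form p s \<theta> \<mu> w G w G = lam * c"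
    using eigen[OF w] by (simp add: c_def F_mult_self)
  \<comment> \<open>The factor that normalises \<open>w\<close> in \<open>L\<^sup>p\<close>.\<close>
  define a where "a = c powr (- 1 / p)"
  have a: "a > 0" using c by (simp add: a_def)
  have "a powr p = c powr - 1" unfolding a_def powr_powr using p by simp
  then have ap: "a powr p * c = 1" using c by (simp add: powr_minus_divide)
  have aw: "test_limit p \<Omega> (\<lambda>x. a * w x) (\<lambda>x. a *\<^sub>R G x)" by (rule test_limit_cmult[OF p(1) w])
  note r = test_limit_represents[OF p(1) op aw]
  have "int_powr p (\<lambda>x. a * w x) = a powr p * c"
    unfolding c_def using a by (simp add: abs_mult powr_mult)
  then have "(LINT x:\<Omega>|lebesgue. \<bar>a * w x\<bar> powr p) = 1" using norm_eq[OF r] ap by simp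
  moreover have "energy p s \<theta> \<mu> \<Omega> (\<lambda>x. a * w x) = lam"
  proof -
    have "a powr p * (lam * c) = lam * (a powr p * c)" by simp
    then show ?thesis unfolding energy_eq[OF r] Borel_form_scale[OF a] wc ap by simp
  qed
  moreover have "(\<lambda>x. a * w x) \<in> X_space p \<Omega>" by (rule test_limit_imp_X_space[OF p(1) op aw])
  ultimately show "lam \<in> {energy p s \<theta> \<mu> \<Omega> u |u. u \<in> X_space p \<Omega> \<and> (LINT x:\<Omega>|lebesgue. \<bar>u x\<bar> powr p) = 1}"
    by (intro CollectI exI[of _ "\<lambda>x. a * w x"]) simp
  fix E assume "E \<in> {energy p s \<theta> \<mu> \<Omega> u |u. u \<in> X_space p \<Omega> \<and> (LINT x:\<Omega>|lebesgue. \<bar>u x\<bar> powr p) = 1}"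
  then obtain u where u: "E = energy p s \<theta> \<mu> \<Omega> u" "u \<in> X_space p \<Omega>" "(LINT x:\<Omega>|lebesgue. \<bar>u x\<bar> powr p) = 1"
    by auto
  obtain u0 Gu where ru: "represents p \<Omega> u u0 Gu" using X_space_represents[OF p(1) op u(2)] by blast
  have tu: "test_limit p \<Omega> u0 Gu" using ru by (simp add: represents_def)
  have "lam * int_powr p u0 \<le> Borel_form p s \<theta> \<mu> u0 Gu u0 Gu"
    by (rule eigenvalue_le_energy[OF p s \<mu> \<theta> w w0 wn eigen tu])
  then show "lam \<le> E" using u(3) norm_eq[OF ru] unfolding u(1) energy_eq[OF ru] by simp
qed

text \<open>
  The operator is odd, so \<open>\<sigma> w\<close> is an eigenfunction with the same eigenvalue. Its representative
  is cut off at \<open>0\<close>, which changes it on a null set only, to make it nonnegative everywhere.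
\<close>

lemma one_signed_eigenfunction_imp_lambda1:
  fixes w :: "'a::euclidean_space \<Rightarrow> real"
  assumes p: "p > 1" "p < real DIM('a)" and s: "0 < s" "s < 1"
    and \<mu>: "\<mu> > 0" and \<theta>: "0 < p * \<theta>" "p * \<theta> < real DIM('a)" and op: "open \<Omega>"
    and eig: "is_eigenfunction p s \<theta> \<mu> \<Omega> lam w"
    and \<sigma>: "\<sigma> = 1 \<or> \<sigma> = -1" and sign: "AE x in lborel. x \<in> \<Omega> \<longrightarrow> \<sigma> * w x \<ge> 0"
  shows "lambda1 p s \<theta> \<mu> \<Omega> = lam"
proof -
  have wX: "w \<in> X_space p \<Omega>" and wn: "\<not> (AE x in lborel. w x = 0)"
    and eigen: "\<And>v. v \<in> X_space p \<Omega> \<Longrightarrow> T_form p s \<theta> \<mu> \<Omega> w v = lam * (LINT x:\<Omega>|lebesgue. F p (w x) * v x)"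
    using eig by (auto simp: is_eigenfunction_def AE_lebesgue_iff)
  obtain w0 G where "represents p \<Omega> w w0 G" using X_space_represents[OF p(1) op wX] by blast
  then have t0: "test_limit p \<Omega> w0 G" and ae0: "AE x in lborel. w x = w0 x"
    and wg: "AE x in lborel. x \<in> \<Omega> \<longrightarrow> weak_grad \<Omega> w x = G x" by (auto simp: represents_def)
  note [measurable] = in_LpD(1)[OF test_limitD(1)[OF t0]]
  have \<sigma>\<sigma>: "\<sigma> * \<sigma> = 1" using \<sigma> by auto
  define w1 where "w1 x = max 0 (\<sigma> * w0 x)" for x
  have ae1: "AE x in lborel. w0 x = \<sigma> * w1 x"
    using sign ae0
  proof eventually_elim
    fix x assume x: "x \<in> \<Omega> \<longrightarrow> \<sigma> * w x \<ge> 0" "w x = w0 x"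
    have "\<sigma> * w0 x \<ge> 0" using x test_limitD(3)[OF t0, of x] by (cases "x \<in> \<Omega>") auto
    then show "w0 x = \<sigma> * w1 x" using \<sigma>\<sigma> by (simp add: w1_def mult.assoc[symmetric])
  qed
  have t1: "test_limit p \<Omega> (\<lambda>x. \<sigma> * w1 x) G"
    by (rule test_limit_cong_AE[OF t0 _ _ ae1]) (auto simp: w1_def test_limitD(3)[OF t0])
  have r1: "represents p \<Omega> w (\<lambda>x. \<sigma> * w1 x) G"
    unfolding represents_def using t1 wg ae0 ae1 by (auto elim: eventually_elim2)
  have eigen1: "Borel_form p s \<theta> \<mu> (\<lambda>x. \<sigma> * w1 x) G v H = lam * (LINT x|lborel. F p (\<sigma> * w1 x) * v x)"
    if v: "test_limit p \<Omega> v H" for v H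
    using eigen[OF test_limit_imp_X_space[OF p(1) op v]]
    unfolding T_form_represents[OF p s r1 test_limit_represents[OF p(1) op v]] .
  have t2: "test_limit p \<Omega> w1 (\<lambda>x. \<sigma> *\<^sub>R G x)"
    using test_limit_cmult[OF p(1) t1, of \<sigma>] \<sigma>\<sigma> by (simp add: mult.assoc[symmetric])
  have eigen2: "Borel_form p s \<theta> \<mu> w1 (\<lambda>x. \<sigma> *\<^sub>R G x) v H = lam * (LINT x|lborel. F p (w1 x) * v x)"
    if v: "test_limit p \<Omega> v H" for v H
    using \<sigma>
  proof
    assume "\<sigma> = 1"
    then show ?thesis using eigen1[OF v] by simp
  next
    assume s1: "\<sigma> = -1"
    have "Borel_form p s \<theta> \<mu> w1 (\<lambda>x. \<sigma> *\<^sub>R G x) v H = - Borel_form p s \<theta> \<mu> (\<lambda>x. \<sigma> * w1 x) G v H"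
      using Borel_form_minus[of p s \<theta> \<mu> "\<lambda>x. - w1 x" G v H] s1 by simp
    then show ?thesis using eigen1[OF v] s1 by (simp add: F_minus)
  qed
  have "\<not> (AE x in lborel. w1 x = 0)"
  proof
    assume "AE x in lborel. w1 x = 0"
    with ae1 ae0 have "AE x in lborel. w x = 0" by eventually_elim simp
    with wn show False ..
  qed
  from nonneg_eigenfunction_imp_lambda1[OF p s \<mu> \<theta> op t2 _ this eigen2]
  show ?thesis by (simp add: w1_def)
qed

theorem theorem4p4:
  fixes \<Omega> :: "'a::euclidean_space set" and p s \<theta> \<mu> lam :: real and w :: "'a \<Rightarrow> real"
  assumes "0 < s" and "s < 1" and "1 < p" and "p < real DIM('a)"
    and "s \<le> \<theta>" and "\<theta> \<le> 1"
    and "open \<Omega>" and "connected \<Omega>" and "\<Omega> \<noteq> {}" and "bounded \<Omega>"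
    and "0 < \<mu>" and "\<mu> < mu0 DIM('a) p s \<theta>"
    and "is_eigenfunction p s \<theta> \<mu> \<Omega> lam w"
    and "lam \<noteq> lambda1 p s \<theta> \<mu> \<Omega>"
  shows "emeasure lebesgue {x \<in> \<Omega>. w x > 0} > 0 \<and> emeasure lebesgue {x \<in> \<Omega>. w x < 0} > 0"
proof -
  have \<theta>: "0 < p * \<theta>" "p * \<theta> < real DIM('a)"
  proof -
    show "0 < p * \<theta>" using assms by simp
    have "p * \<theta> \<le> p * 1" using assms by (intro mult_left_mono) auto
    then show "p * \<theta> < real DIM('a)" using assms by linarith
  qed
  have "w \<in> Lp p UNIV"
    using assms(13) by (simp add: is_eigenfunction_def X_space_def W1p_def)
  then have wm: "w \<in> borel_measurable lebesgue"
    by (simp add: Lp_def set_borel_measurable_def)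
  have "emeasure lebesgue {x \<in> \<Omega>. \<sigma> * w x < 0} > 0" if \<sigma>: "\<sigma> = 1 \<or> \<sigma> = -1" for \<sigma> :: real
  proof (rule ccontr)
    let ?N = "{x \<in> \<Omega>. \<sigma> * w x < 0}"
    assume "\<not> emeasure lebesgue ?N > 0"
    then have "emeasure lebesgue ?N = 0" by simp
    moreover have "?N \<in> sets lebesgue"
    proof -
      have "{x \<in> space lebesgue. \<sigma> * w x < 0} \<in> sets lebesgue" using wm by measurable
      moreover have "\<Omega> \<in> sets lebesgue" using \<open>open \<Omega>\<close> by simp
      ultimately have "\<Omega> \<inter> {x \<in> space lebesgue. \<sigma> * w x < 0} \<in> sets lebesgue" by (rule sets.Int[rotated])
      moreover have "\<Omega> \<inter> {x \<in> space lebesgue. \<sigma> * w x < 0} = ?N" by auto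
      ultimately show ?thesis by simp
    qed
    ultimately have "AE x in lebesgue. x \<notin> ?N" by (intro AE_not_in null_setsI)
    then have "AE x in lborel. x \<in> \<Omega> \<longrightarrow> \<sigma> * w x \<ge> 0"
      unfolding AE_lebesgue_iff by (rule AE_mp) (auto intro!: AE_I2)
    then have "lambda1 p s \<theta> \<mu> \<Omega> = lam"
      by (rule one_signed_eigenfunction_imp_lambda1[OF assms(3,4,1,2,11) \<theta> assms(7,13) \<sigma>])
    with assms(14) show False by simp
  qed
  from this[of 1] this[of "-1"] show ?thesis by simp
qed

end
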